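(* Fix $T>0$ and $\theta,\sigma>0$ with $3\sigma^2<2\theta$. For small $h>0$ let $\pm\xi_b=\pm\xi_b(h)$ be the non-zero solutions of the compatibility equation, $u^e_{\pm\xi_b}$ the corresponding equilibrium densities, $A=A_h$ the set of paths from $u^e_{-\xi_b}$ at time $0$ to $u^e_{\xi_b}$ at time $T$, and $I_h$ the rate function (all as defined in the context). Then there exists a function $\gamma(h)$ with $\gamma(h)\to 0$ as $h\to 0$ such that $$\Big|\inf_{\phi\in A} I_h(\phi)-\frac{2\xi_b^2}{\sigma^2T}\Big|\le \gamma(h)$$ for all sufficiently small $h>0$. (Here $\xi_b=\xi_0+h\xi_1+O(h^2)$ with $\xi_0=\sqrt{1-3\sigma^2/(2\theta)}$ and $\xi_1=\sqrt{1-3\frac{\sigma^2}{2\theta}}\;\frac{6}{\sigma^2}\left(\frac{\sigma^2}{2\theta}\right)^2\frac{1-2(\sigma^2/2\theta)}{1-3(\sigma^2/2\theta)}$.)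
   Context: Parameters: $h,\theta,\sigma>0$; $V(y)=\frac14y^4-\frac12y^2$, $U(y)=V'(y)=y^3-y$. Equilibria: for $\xi\in\mathbb R$, $$u^e_\xi(y)=\frac{1}{Z_\xi\sqrt{2\pi\sigma^2/(2\theta)}}\exp\Big\{-\frac{(y-\xi)^2}{2\,\sigma^2/(2\theta)}-\frac{2h}{\sigma^2}V(y)\Big\},$$ with $Z_\xi$ the constant making $u^e_\xi$ a probability density. The compatibility equation is $\xi=m(\xi):=\int y\,u^e_\xi(y)\,dy$. For given $h,\theta$ there is a critical value $\sigma_c(h,\theta)>0$ such that for $\sigma<\sigma_c(h,\theta)$ it has exactly two non-zero solutions $\pm\xi_b$ ($\xi_b>0$) besides $\xi=0$, and otherwise none; moreover $\sigma_c(h,\theta)=\sqrt{2\theta/3}+O(h)$, so for fixed $\sigma,\theta$ with $3\sigma^2<2\theta$ the solutions $\pm\xi_b$ exist for all small $h$. Path space: $M_1(\mathbb R)$ is the space of probability measures on $\mathbb R$ with the Prohorov metric. Fix $\varphi(y)=1+y^2+\kappa y^4$ with $0\le\kappa\le h/2$. $M_\infty(\mathbb R)=\{\mu\in M_1(\mathbb R):\int\varphi\,d\mu<\infty\}$, with the inductive topology: $\mu_n\to\mu$ iff $\mu_n\to\mu$ in $M_1(\mathbb R)$ and $\sup_n\int\varphi\,d\mu_n<\infty$. $C([0,T],M_\infty(\mathbb R))$ is the space of continuous functions from $[0,T]$ to $M_\infty(\mathbb R)$, with $\phi_n\to\phi$ iff $\phi_n\to\phi$ uniformly on $[0,T]$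 in the Prohorov metric and $\sup_{t}\sup_n\int\varphi(y)\phi_n(t,dy)<\infty$. For $\nu\in M_\infty(\mathbb R)$, $\mathcal E^\nu=\{\phi\in C([0,T],M_\infty(\mathbb R)):\phi(0)=\nu\}$. Here $\nu=u^e_{-\xi_b}$ and $$A=\{\phi\in\mathcal E^\nu:\phi(T)=u^e_{\xi_b}\}.$$ Rate function: with $\langle\mu,f\rangle=\int f\,d\mu$, and derivatives in the sense of distributions in $y$, $$\mathcal L_\phi^*\phi=\tfrac12\sigma^2\phi_{yy}+\theta\,\partial_y\big\{[y-\langle\phi,y\rangle]\phi\big\},\qquad \mathcal M^*\phi=\partial_y[U(y)\phi].$$ If $\phi$ is absolutely continuous in $t$, then $$I_h(\phi)=\frac1{2\sigma^2}\int_0^T\ \sup_{f:\langle\phi(t),f_y^2\rangle\ne0}\frac{\langle\phi_t-\mathcal L_\phi^*\phi-h\mathcal M^*\phi,f\rangle^2}{\langle\phi,f_y^2\rangle}\,dt,$$ the supremum being over real test functions $f$ on $\mathbb R$; otherwise $I_h(\phi)=\infty$. Absolute continuity means: for each compact $K\subset\mathbb R$ there are a neighborhood $U_K$ of $0$ in the space of test functions supported in $K$ and an absolutely continuous $H_K:[0,T]\to\mathbb R$ with $|\langle\phi(t),f\rangle-\langle\phi(s),f\rangle|\le|H_K(t)-H_K(s)|$ for all $s,t\in[0,T]$, $f\in U_K$ (then $\phi_t$ exists in the distribution sense for a.e. $t$). *)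

theory Defs
  imports "HOL-Probability.Probability" "HOL-Library.Landau_Symbols"
begin

definition V :: "real \<Rightarrow> real" where
  "V y = y^4 / 4 - y\<^sup>2 / 2"

definition U :: "real \<Rightarrow> real" where
  "U y = y^3 - y"

definition eq_weight :: "real \<Rightarrow> real \<Rightarrow> real \<Rightarrow> real \<Rightarrow> real \<Rightarrow> real" where
  "eq_weight h \<theta> \<sigma> \<xi> y =
     exp (- ((y - \<xi>)\<^sup>2 / (2 * (\<sigma>\<^sup>2 / (2 * \<theta>)))) - (2 * h / \<sigma>\<^sup>2) * V y)"

definition eq_Z :: "real \<Rightarrow> real \<Rightarrow> real \<Rightarrow> real \<Rightarrow> real" where
  "eq_Z h \<theta> \<sigma> \<xi> =
     (LINT y|lborel. eq_weight h \<theta> \<sigma> \<xi> y / sqrt (2 * pi * (\<sigma>\<^sup>2 / (2 * \<theta>))))"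

definition eq_density :: "real \<Rightarrow> real \<Rightarrow> real \<Rightarrow> real \<Rightarrow> real \<Rightarrow> real" where
  "eq_density h \<theta> \<sigma> \<xi> y =
     1 / (eq_Z h \<theta> \<sigma> \<xi> * sqrt (2 * pi * (\<sigma>\<^sup>2 / (2 * \<theta>)))) * eq_weight h \<theta> \<sigma> \<xi> y"

definition eq_measure :: "real \<Rightarrow> real \<Rightarrow> real \<Rightarrow> real \<Rightarrow> real measure" where
  "eq_measure h \<theta> \<sigma> \<xi> = density lborel (\<lambda>y. ennreal (eq_density h \<theta> \<sigma> \<xi> y))"

definition eq_mean :: "real \<Rightarrow> real \<Rightarrow> real \<Rightarrow> real \<Rightarrow> real" where
  "eq_mean h \<theta> \<sigma> \<xi> = (LINT y|lborel. y * eq_density h \<theta> \<sigma> \<xi> y)"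

definition compatible :: "real \<Rightarrow> real \<Rightarrow> real \<Rightarrow> real \<Rightarrow> bool" where
  "compatible h \<theta> \<sigma> \<xi> \<longleftrightarrow> \<xi> = eq_mean h \<theta> \<sigma> \<xi>"

definition prohorov :: "real measure \<Rightarrow> real measure \<Rightarrow> real" where
  "prohorov \<mu> \<nu> = Inf {e. e > 0 \<and> (\<forall>B\<in>sets borel.
      measure \<mu> B \<le> measure \<nu> (\<Union>x\<in>B. ball x e) + e \<and>
      measure \<nu> B \<le> measure \<mu> (\<Union>x\<in>B. ball x e) + e)}"

definition phi_moment :: "real \<Rightarrow> real measure \<Rightarrow> ennreal" where
  "phi_moment \<kappa> \<mu> = (\<integral>\<^sup>+y. ennreal (1 + y\<^sup>2 + \<kappa> * y^4) \<partial>\<mu>)"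

definition M_inf :: "real \<Rightarrow> real measure set" where
  "M_inf \<kappa> = {\<mu>. real_distribution \<mu> \<and> phi_moment \<kappa> \<mu> < \<infinity>}"

definition M_inf_tendsto :: "real \<Rightarrow> (nat \<Rightarrow> real measure) \<Rightarrow> real measure \<Rightarrow> bool" where
  "M_inf_tendsto \<kappa> \<mu>s \<mu> \<longleftrightarrow>
     (\<lambda>n. prohorov (\<mu>s n) \<mu>) \<longlonglongrightarrow> 0 \<and> (SUP n. phi_moment \<kappa> (\<mu>s n)) < \<infinity>"

text \<open>The topology of \<^const>\<open>M_inf\<close> is given by its convergent sequences. As \<open>[0,T]\<close> is first
  countable, continuity of a path is sequential continuity. A path is a function on \<open>real\<close> of which
  only the restriction to \<open>[0,T]\<close> matters.\<close>

definition path_space :: "real \<Rightarrow> real \<Rightarrow> (real \<Rightarrow> real measure) set" where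
  "path_space \<kappa> T = {\<phi>. (\<forall>t\<in>{0..T}. \<phi> t \<in> M_inf \<kappa>) \<and>
     (\<forall>t\<in>{0..T}. \<forall>s. (\<forall>n. s n \<in> {0..T}) \<and> s \<longlonglongrightarrow> t \<longrightarrow>
        M_inf_tendsto \<kappa> (\<lambda>n. \<phi> (s n)) (\<phi> t))}"

definition paths_from :: "real \<Rightarrow> real \<Rightarrow> real measure \<Rightarrow> (real \<Rightarrow> real measure) set" where
  "paths_from \<kappa> T \<nu> = {\<phi> \<in> path_space \<kappa> T. \<phi> 0 = \<nu>}"

definition transition_paths ::
  "real \<Rightarrow> real \<Rightarrow> real \<Rightarrow> real \<Rightarrow> real \<Rightarrow> real \<Rightarrow> (real \<Rightarrow> real measure) set" where
  "transition_paths \<kappa> h \<theta> \<sigma> T \<xi> =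
     {\<phi> \<in> paths_from \<kappa> T (eq_measure h \<theta> \<sigma> (- \<xi>)). \<phi> T = eq_measure h \<theta> \<sigma> \<xi>}"

text \<open>\<open>test_fun_on K\<close> is the space of smooth functions with support in the compact set \<open>K\<close>, with its
  topology of uniform convergence of all derivatives; \<open>test_nhd K\<close> are the neighbourhoods of \<open>0\<close>.\<close>

definition test_fun_on :: "real set \<Rightarrow> (real \<Rightarrow> real) set" where
  "test_fun_on K = {f. (\<forall>k. (deriv ^^ k) f differentiable_on UNIV) \<and> (\<forall>x. x \<notin> K \<longrightarrow> f x = 0)}"

definition test_fun :: "(real \<Rightarrow> real) set" where
  "test_fun = (\<Union>K\<in>{K. compact K}. test_fun_on K)"

definition test_nhd :: "real set \<Rightarrow> (real \<Rightarrow> real) set \<Rightarrow> bool" where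
  "test_nhd K W \<longleftrightarrow> W \<subseteq> test_fun_on K \<and>
     (\<exists>N. \<exists>e>0. {f \<in> test_fun_on K. \<forall>k\<le>N. \<forall>x. \<bar>(deriv ^^ k) f x\<bar> < e} \<subseteq> W)"

text \<open>Distributions are represented by their action on test functions.\<close>

type_synonym distr = "(real \<Rightarrow> real) \<Rightarrow> real"

definition pairing :: "real measure \<Rightarrow> distr" where
  "pairing \<mu> f = (LINT y|\<mu>. f y)"

definition D_y :: "distr \<Rightarrow> distr" where
  "D_y S f = - S (deriv f)"

definition mult_distr :: "(real \<Rightarrow> real) \<Rightarrow> distr \<Rightarrow> distr" where
  "mult_distr g S f = S (\<lambda>y. g y * f y)"

definition L_star :: "real \<Rightarrow> real \<Rightarrow> real measure \<Rightarrow> distr" where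
  "L_star \<theta> \<sigma> \<mu> f = 1/2 * \<sigma>\<^sup>2 * D_y (D_y (pairing \<mu>)) f
     + \<theta> * D_y (mult_distr (\<lambda>y. y - pairing \<mu> (\<lambda>y. y)) (pairing \<mu>)) f"

definition M_star :: "real measure \<Rightarrow> distr" where
  "M_star \<mu> f = D_y (mult_distr U (pairing \<mu>)) f"

definition abs_cont_on :: "real \<Rightarrow> real \<Rightarrow> (real \<Rightarrow> real) \<Rightarrow> bool" where
  "abs_cont_on a b H \<longleftrightarrow> (\<forall>e>0. \<exists>d>0. \<forall>P :: (real \<times> real) set.
     finite P \<and> (\<forall>(u, v)\<in>P. a \<le> u \<and> u < v \<and> v \<le> b) \<and>
     disjoint_family_on (\<lambda>(u, v). {u<..<v}) P \<and> (\<Sum>(u, v)\<in>P. v - u) < d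
     \<longrightarrow> (\<Sum>(u, v)\<in>P. \<bar>H v - H u\<bar>) < e)"

definition abs_cont_path :: "real \<Rightarrow> (real \<Rightarrow> real measure) \<Rightarrow> bool" where
  "abs_cont_path T \<phi> \<longleftrightarrow> (\<forall>K. compact K \<longrightarrow> (\<exists>W H. test_nhd K W \<and> abs_cont_on 0 T H \<and>
     (\<forall>s\<in>{0..T}. \<forall>t\<in>{0..T}. \<forall>f\<in>W.
        \<bar>pairing (\<phi> t) f - pairing (\<phi> s) f\<bar> \<le> \<bar>H t - H s\<bar>)))"

text \<open>For an absolutely continuous path the derivative below exists, simultaneously for all test
  functions, for almost every \<open>t\<close>; the unspecified values of \<^const>\<open>deriv\<close> at other \<open>t\<close> (and at the
  endpoints) do not affect the time integral in the rate function.\<close>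

definition D_t :: "(real \<Rightarrow> real measure) \<Rightarrow> real \<Rightarrow> distr" where
  "D_t \<phi> t f = deriv (\<lambda>s. pairing (\<phi> s) f) t"

definition rate_integrand ::
  "real \<Rightarrow> real \<Rightarrow> real \<Rightarrow> (real \<Rightarrow> real measure) \<Rightarrow> real \<Rightarrow> ennreal" where
  "rate_integrand h \<theta> \<sigma> \<phi> t =
     (SUP f\<in>{f \<in> test_fun. pairing (\<phi> t) (\<lambda>y. (deriv f y)\<^sup>2) \<noteq> 0}.
        ennreal ((D_t \<phi> t f - L_star \<theta> \<sigma> (\<phi> t) f - h * M_star (\<phi> t) f)\<^sup>2
                 / pairing (\<phi> t) (\<lambda>y. (deriv f y)\<^sup>2)))"

definition rate ::
  "real \<Rightarrow> real \<Rightarrow> real \<Rightarrow> real \<Rightarrow> (real \<Rightarrow> real measure) \<Rightarrow> ennreal" where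
  "rate h \<theta> \<sigma> T \<phi> =
     (if abs_cont_path T \<phi>
      then ennreal (1 / (2 * \<sigma>\<^sup>2)) * (\<integral>\<^sup>+t\<in>{0..T}. rate_integrand h \<theta> \<sigma> \<phi> t \<partial>lborel)
      else \<infinity>)"

end

theory Submission
  imports Defs
begin

text \<open>
  Write \<open>s = \<sigma>\<^sup>2 / (2 \<theta>)\<close> and \<open>b = 2 h / \<sigma>\<^sup>2\<close>.

  Upper bound: move along the equilibria \<open>u\<^sup>e\<^sub>\<xi>\<close> with \<open>\<xi>\<close> linear in \<open>t\<close>. Tested against \<open>f\<close>, the
  residual \<open>\<phi>\<^sub>t - L\<^sup>*\<phi> - h M\<^sup>*\<phi>\<close> is \<open>\<xi>' (\<langle>f'\<rangle> - b Cov(f, U)) + h \<langle>U\<rangle> \<langle>f'\<rangle>\<close>, and a Poincare inequality that is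
  uniform in \<open>h\<close> and \<open>\<xi>\<close> bounds the covariance by \<open>\<langle>f'\<^sup>2\<rangle>\<^sup>1\<^sup>/\<^sup>2\<close>; so the integrand of the action is
  \<open>(\<xi>' + O(h))\<^sup>2\<close>.

  Lower bound: a test function close to \<open>y\<close>, applied to any path, turns the action into a bound on the motion
  of the mean, which has to travel the distance \<open>2 \<xi>\<^sub>b\<close>. The test function has an increasing derivative with
  values in \<open>(0, 1)\<close> that decays at \<open>-\<infinity>\<close> (a softplus function): monotonicity gives the mean-field
  drift a favourable sign, and the decay makes \<open>- U f'\<close> bounded above, so no a priori estimate on the path is needed.
  Truncation to compact support only costs terms controlled by second moments.

  Expansion of \<open>\<xi>\<^sub>b\<close>: integrating by parts, \<open>\<xi>\<close> is compatible iff \<open>\<langle>U\<rangle> = 0\<close>. Expanding \<open>\<langle>U\<rangle>\<close> to first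
  order in \<open>h\<close> with Gaussian moments, the intermediate value theorem produces a positive solution within \<open>O(h\<^sup>2)\<close> of
  \<open>\<xi>\<^sub>0 + h \<xi>\<^sub>1\<close>, and by uniqueness it is \<open>\<xi>\<^sub>b\<close>.
\<close>

section \<open>Absolutely continuous functions\<close>

text \<open>Only second moments of a path are available (\<open>\<kappa>\<close> may be 0), with a
  bound that depends on the path, while \<open>U\<close> is cubic. Hence the cutoff acts on
  \<open>ln (1 + y^2)\<close>: at scale M its slope is of order |y| / (M (1 + y^2)), and multiplied
  by \<open>U\<close> it grows only quadratically. A profile of height \<open>r\<close> with M = r^2
  leaves errors of order 1 / r times the second moment. The limits are nested: \<epsilon> is fixed
  by the tolerance, then \<open>h\<close> is small relative to \<epsilon>^3 exp (-1 / \<epsilon>),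
  and only then, for each single path, r tends to infinity, which removes its moment bound. So
  \<gamma> is obtained by a diagonal choice, without a rate.

  The action sees t-derivatives of pairings only almost everywhere, so the lower bound needs the
  fundamental theorem for the epsilon-delta notion of absolute continuity. The variation splits such
  a function into monotone ones, whose Stieltjes measures have densities.

  The Poincare constant must not depend on h and \<xi>, although \<open>V\<close> is not convex: it
  comes from a tail bound of the weight alone, with f centred at its value at 0.\<close>

definition interval_family :: "real \<Rightarrow> real \<Rightarrow> (real \<times> real) set \<Rightarrow> bool" where
  "interval_family a b P \<longleftrightarrow> finite P \<and> (\<forall>(u, v)\<in>P. a \<le> u \<and> u < v \<and> v \<le> b) \<and>
     disjoint_family_on (\<lambda>(u, v). {u<..<v}) P"

definition variation_sum :: "(real \<Rightarrow> real) \<Rightarrow> (real \<times> real) set \<Rightarrow> real" where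
  "variation_sum \<psi> P = (\<Sum>(u, v)\<in>P. \<bar>\<psi> v - \<psi> u\<bar>)"

text \<open>Total variation. The families may leave gaps, which gives the same value as partitions
  and matches the families quantified over in \<open>abs_cont_on\<close>.\<close>

definition variation :: "(real \<Rightarrow> real) \<Rightarrow> real \<Rightarrow> real \<Rightarrow> real" where
  "variation \<psi> a b = (SUP P\<in>{P. interval_family a b P}. variation_sum \<psi> P)"

lemma abs_cont_on_iff:
  "abs_cont_on a b H \<longleftrightarrow> (\<forall>e>0. \<exists>d>0. \<forall>P. interval_family a b P \<and> (\<Sum>(u, v)\<in>P. v - u) < d
     \<longrightarrow> variation_sum H P < e)"
  unfolding abs_cont_on_def interval_family_def variation_sum_def by auto

lemma interval_family_empty [simp]: "interval_family a b {}"
  by (simp add: interval_family_def disjoint_family_on_def)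

lemma interval_family_single: "a \<le> u \<Longrightarrow> u < v \<Longrightarrow> v \<le> b \<Longrightarrow> interval_family a b {(u, v)}"
  by (simp add: interval_family_def disjoint_family_on_def)

lemma interval_familyD:
  assumes "interval_family a b P"
  shows "finite P" "(u, v) \<in> P \<Longrightarrow> a \<le> u" "(u, v) \<in> P \<Longrightarrow> u < v" "(u, v) \<in> P \<Longrightarrow> v \<le> b"
    "(u, v) \<in> P \<Longrightarrow> (u', v') \<in> P \<Longrightarrow> (u, v) \<noteq> (u', v') \<Longrightarrow> v \<le> u' \<or> v' \<le> u"
proof -
  show 1: "finite P" "(u, v) \<in> P \<Longrightarrow> a \<le> u" "(u, v) \<in> P \<Longrightarrow> u < v" "(u, v) \<in> P \<Longrightarrow> v \<le> b"
    using assms unfolding interval_family_def by auto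
  assume uv: "(u, v) \<in> P" "(u', v') \<in> P" "(u, v) \<noteq> (u', v')"
  have lt: "u < v" "u' < v'" using assms uv unfolding interval_family_def by auto
  have "{u<..<v} \<inter> {u'<..<v'} = {}"
    using disjoint_family_onD[of "\<lambda>(u, v). {u<..<v}" P "(u, v)" "(u', v')"] assms uv
    unfolding interval_family_def by simp
  \<comment> \<open>If the intervals overlapped, the midpoint of their intersection would lie in
    both.\<close>
  then have "(max u u' + min v v') / 2 \<notin> {u<..<v} \<inter> {u'<..<v'}" by blast
  then show "v \<le> u' \<or> v' \<le> u" using lt
    by (auto simp: max_def min_def field_simps split: if_splits)
qed

lemma interval_family_mono:
  assumes "interval_family a b P" "a' \<le> a" "b \<le> b'" shows "interval_family a' b' P"
proof -
  have "a' \<le> u \<and> u < v \<and> v \<le> b'" if "(u, v) \<in> P" for u v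
    using interval_familyD(2-4)[OF assms(1) that] assms(2,3) by linarith
  then show ?thesis using assms(1) unfolding interval_family_def by blast
qed

lemma interval_familyI:
  assumes "finite P" "\<And>u v. (u, v) \<in> P \<Longrightarrow> a \<le> u \<and> u < v \<and> v \<le> b"
    "\<And>u v u' v'. (u, v) \<in> P \<Longrightarrow> (u', v') \<in> P \<Longrightarrow> (u, v) \<noteq> (u', v') \<Longrightarrow> v \<le> u' \<or> v' \<le> u"
  shows "interval_family a b P"
  unfolding interval_family_def disjoint_family_on_def
proof (intro conjI ballI impI)
  fix m n assume mn: "m \<in> P" "n \<in> P" "m \<noteq> n"
  obtain u v u' v' where "m = (u, v)" "n = (u', v')" by fastforce
  then show "(case m of (u, v) \<Rightarrow> {u<..<v}) \<inter> (case n of (u, v) \<Rightarrow> {u<..<v}) = {}"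
    using assms(3)[of u v u' v'] mn by auto
qed (use assms in auto)

lemma interval_family_Un:
  assumes P: "interval_family a c P" and Q: "interval_family c b Q" and "a \<le> c" "c \<le> b"
  shows "interval_family a b (P \<union> Q)" "P \<inter> Q = {}"
proof -
  show "interval_family a b (P \<union> Q)"
  proof (rule interval_familyI)
    show "finite (P \<union> Q)" using P Q by (auto simp: interval_family_def)
    show "a \<le> u \<and> u < v \<and> v \<le> b" if "(u, v) \<in> P \<union> Q" for u v
      using that interval_familyD(2-4)[OF P, of u v] interval_familyD(2-4)[OF Q, of u v] assms(3,4) by force
    show "v \<le> u' \<or> v' \<le> u" if "(u, v) \<in> P \<union> Q" "(u', v') \<in> P \<union> Q" "(u, v) \<noteq> (u', v')" for u v u' v'
    proof -
      from that consider "(u, v) \<in> P" "(u', v') \<in> P" | "(u, v) \<in> Q" "(u', v') \<in> Q"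
        | "(u, v) \<in> P" "(u', v') \<in> Q" | "(u, v) \<in> Q" "(u', v') \<in> P" by blast
      then show ?thesis
      proof cases
        case 1 then show ?thesis using interval_familyD(5)[OF P] that(3) by blast
      next
        case 2 then show ?thesis using interval_familyD(5)[OF Q] that(3) by blast
      next
        case 3 then show ?thesis using interval_familyD(4)[OF P 3(1)] interval_familyD(2)[OF Q 3(2)] by linarith
      next
        case 4 then show ?thesis using interval_familyD(4)[OF P 4(2)] interval_familyD(2)[OF Q 4(1)] by linarith
      qed
    qed
  qed
  show "P \<inter> Q = {}"
  proof (intro equals0I)
    fix p assume "p \<in> P \<inter> Q"
    then obtain u v where "(u, v) \<in> P" "(u, v) \<in> Q" by (cases p) auto
    then show False using interval_familyD(3,4)[OF P, of u v] interval_familyD(2)[OF Q, of u v] by linarith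
  qed
qed

lemma interval_family_length:
  assumes P: "interval_family a b P" and "a \<le> b" shows "(\<Sum>(u, v)\<in>P. v - u) \<le> b - a"
proof -
  have fin: "finite P" using P by (auto simp: interval_family_def)
  have "(\<Sum>(u, v)\<in>P. v - u) = (\<Sum>p\<in>P. measure lborel (case p of (u, v) \<Rightarrow> {u<..<v}))"
    using interval_familyD(3)[OF P] by (intro sum.cong) (auto simp: less_imp_le)
  also have "\<dots> = measure lborel (\<Union>p\<in>P. case p of (u, v) \<Rightarrow> {u<..<v})"
    by (rule measure_finite_Union[symmetric]) (use P fin in \<open>auto simp: interval_family_def emeasure_lborel_Ioo\<close>)
  also have "\<dots> \<le> measure lborel {a..b}"
  proof (rule measure_mono_fmeasurable)
    show "(\<Union>p\<in>P. case p of (u, v) \<Rightarrow> {u<..<v}) \<subseteq> {a..b}"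
      using interval_familyD(2,4)[OF P] by (force split: prod.splits)
    show "(\<Union>p\<in>P. case p of (u, v) \<Rightarrow> {u<..<v}) \<in> sets lborel"
      by (intro sets.finite_UN fin) (auto split: prod.splits)
  qed (simp add: fmeasurable_def emeasure_lborel_Icc_eq)
  finally show ?thesis using assms(2) by simp
qed

text \<open>Clamping all endpoints to [a, c] and to [c, b] cuts the interval that straddles
  \<open>c\<close>, if there is one, and leaves the others alone; the triangle inequality at
  \<open>c\<close> does the rest.\<close>

lemma interval_family_split:
  assumes P: "interval_family a b P" and c: "a \<le> c" "c \<le> b"
  obtains P1 P2 where "interval_family a c P1" "interval_family c b P2"
    "variation_sum \<psi> P \<le> variation_sum \<psi> P1 + variation_sum \<psi> P2"
proof -
  note D = interval_familyD[OF P]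
  let ?A = "{(u, v)\<in>P. u < c}" and ?B = "{(u, v)\<in>P. c < v}"
  let ?f = "\<lambda>(u, v). (min u c, min v c)" and ?g = "\<lambda>(u, v). (max u c, max v c)"
  have A: "u = u' \<and> v = v' \<or> min v c \<le> min u' c \<or> min v' c \<le> min u c" if "(u, v) \<in> P" "(u', v') \<in> P" for u v u' v'
    using D(5)[OF that] by (cases "(u, v) = (u', v')") (auto simp: min_def max_def)
  have B: "u = u' \<and> v = v' \<or> max v c \<le> max u' c \<or> max v' c \<le> max u c" if "(u, v) \<in> P" "(u', v') \<in> P" for u v u' v'
    using D(5)[OF that] by (cases "(u, v) = (u', v')") (auto simp: min_def max_def)
  \<comment> \<open>Members are disjoint and of positive length, and so are their clamped versions;
    injectivity lets the sums be reindexed over the images.\<close>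
  have injf: "inj_on ?f ?A" and injg: "inj_on ?g ?B"
  proof -
    show "inj_on ?f ?A"
    proof (rule inj_onI)
      fix p q assume pq: "p \<in> ?A" "q \<in> ?A" "?f p = ?f q"
      obtain u v u' v' where e: "p = (u, v)" "q = (u', v')" by fastforce
      then have *: "(u, v) \<in> P" "u < c" "(u', v') \<in> P" "u' < c" "(min u c, min v c) = (min u' c, min v' c)" using pq by auto
      then show "p = q" unfolding e using A[OF *(1,3)] D(3)[OF *(1)] D(3)[OF *(3)] by (auto simp: min_def split: if_splits)
    qed
    show "inj_on ?g ?B"
    proof (rule inj_onI)
      fix p q assume pq: "p \<in> ?B" "q \<in> ?B" "?g p = ?g q"
      obtain u v u' v' where e: "p = (u, v)" "q = (u', v')" by fastforce
      then have *: "(u, v) \<in> P" "c < v" "(u', v') \<in> P" "c < v'" "(max u c, max v c) = (max u' c, max v' c)" using pq by auto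
      then show "p = q" unfolding e using B[OF *(1,3)] D(3)[OF *(1)] D(3)[OF *(3)] by (auto simp: max_def split: if_splits)
    qed
  qed
  have finA: "finite ?A" "finite ?B"
    by (rule finite_subset[OF _ D(1)]; blast)+
  have 1: "interval_family a c (?f ` ?A)"
  proof (intro interval_familyI, goal_cases)
    case 1 then show ?case using finA by simp
  next
    case (2 u v)
    then obtain x y where "(x, y) \<in> P" "(u, v) = ?f (x, y)" "x < c" by auto
    then show ?case using D(2-4)[of x y] c by auto
  next
    case (3 u v u' v')
    then obtain x y x' y' where *: "(x, y) \<in> P" "(x', y') \<in> P" "(u, v) = ?f (x, y)" "(u', v') = ?f (x', y')" by auto
    then show ?case using A[OF *(1,2)] 3(3) by auto
  qed
  have 2: "interval_family c b (?g ` ?B)"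
  proof (intro interval_familyI, goal_cases)
    case 1 then show ?case using finA by simp
  next
    case (2 u v)
    then obtain x y where "(x, y) \<in> P" "(u, v) = ?g (x, y)" "c < y" by auto
    then show ?case using D(2-4)[of x y] c by auto
  next
    case (3 u v u' v')
    then obtain x y x' y' where *: "(x, y) \<in> P" "(x', y') \<in> P" "(u, v) = ?g (x, y)" "(u', v') = ?g (x', y')" by auto
    then show ?case using B[OF *(1,2)] 3(3) by auto
  qed
  let ?F = "\<lambda>u v. \<bar>\<psi> v - \<psi> u\<bar>"
  have "variation_sum \<psi> P \<le> (\<Sum>p\<in>P. (if p \<in> ?A then (\<lambda>(u, v). ?F u v) (?f p) else 0) + (if p \<in> ?B then (\<lambda>(u, v). ?F u v) (?g p) else 0))"
    unfolding variation_sum_def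
  proof (intro sum_mono)
    fix p assume "p \<in> P"
    then obtain u v where "p = (u, v)" "u < v" "(u, v) \<in> P" using D(3) by (cases p) auto
    then show "(case p of (u, v) \<Rightarrow> ?F u v) \<le> (if p \<in> ?A then (\<lambda>(u, v). ?F u v) (?f p) else 0) + (if p \<in> ?B then (\<lambda>(u, v). ?F u v) (?g p) else 0)"
      by (auto simp: min_def max_def)
  qed
  also have "\<dots> = (\<Sum>p\<in>?A. (\<lambda>(u, v). ?F u v) (?f p)) + (\<Sum>p\<in>?B. (\<lambda>(u, v). ?F u v) (?g p))"
    unfolding sum.distrib
    by (intro arg_cong2[where f="(+)"] sum.mono_neutral_cong_right D(1)) auto
  also have "\<dots> = variation_sum \<psi> (?f ` ?A) + variation_sum \<psi> (?g ` ?B)"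
    unfolding variation_sum_def by (simp only: sum.reindex[OF injf] sum.reindex[OF injg] comp_def)
  finally show thesis using that 1 2 by blast
qed


lemma variation_sum_Un:
  "interval_family a c P \<Longrightarrow> interval_family c b Q \<Longrightarrow> a \<le> c \<Longrightarrow> c \<le> b \<Longrightarrow>
    variation_sum \<psi> (P \<union> Q) = variation_sum \<psi> P + variation_sum \<psi> Q"
  unfolding variation_sum_def
  using interval_family_Un(2)[of a c P b Q] interval_familyD(1) by (intro sum.union_disjoint) auto

text \<open>With \<open>d\<close> belonging to the tolerance 1, every piece of length at most d / 2
  carries variation below 1; the bound is the number of such pieces.\<close>

lemma abs_cont_on_variation_bounded:
  assumes "abs_cont_on a b \<psi>"
  obtains B where "\<And>P. interval_family a b P \<Longrightarrow> variation_sum \<psi> P \<le> B"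
proof -
  obtain d where d: "d > 0" "\<And>P. interval_family a b P \<Longrightarrow> (\<Sum>(u, v)\<in>P. v - u) < d \<Longrightarrow> variation_sum \<psi> P < 1"
    using assms[unfolded abs_cont_on_iff, rule_format, of 1] by auto
  \<comment> \<open>Induction from the right end: each step peels one piece of length d / 2 off the
    left of [c, b].\<close>
  have "\<forall>c P. a \<le> c \<and> c \<le> b \<and> b - c \<le> real n * (d / 2) \<and> interval_family c b P \<longrightarrow> variation_sum \<psi> P \<le> real n" for n
  proof (induction n)
    case 0
    show ?case
    proof (intro allI impI)
      fix c P assume A: "a \<le> c \<and> c \<le> b \<and> b - c \<le> real 0 * (d / 2) \<and> interval_family c b P"
      have "P = {}"
      proof (rule equals0I)
        fix p assume "p \<in> P"
        moreover obtain u v where "p = (u, v)" by fastforce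
        ultimately show False using A interval_familyD(2-4)[of c b P u v] by auto
      qed
      then show "variation_sum \<psi> P \<le> real 0" by (simp add: variation_sum_def)
    qed
  next
    case (Suc n)
    show ?case
    proof (intro allI impI)
      fix c P assume A: "a \<le> c \<and> c \<le> b \<and> b - c \<le> real (Suc n) * (d / 2) \<and> interval_family c b P"
      let ?e = "min b (c + d / 2)"
      have e: "c \<le> ?e" "?e \<le> b" using A d(1) by auto
      obtain P1 P2 where P: "interval_family c ?e P1" "interval_family ?e b P2"
        "variation_sum \<psi> P \<le> variation_sum \<psi> P1 + variation_sum \<psi> P2"
        using interval_family_split[OF _ e, of P \<psi>] A by blast
      have "(\<Sum>(u, v)\<in>P1. v - u) < d" using interval_family_length[OF P(1) e(1)] d(1) by linarith
      then have "variation_sum \<psi> P1 < 1" using d(2) interval_family_mono[OF P(1), of a b] A e by auto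
      moreover have "variation_sum \<psi> P2 \<le> real n"
        by (rule Suc.IH[rule_format, of ?e]) (use A P e d(1) in \<open>auto simp: min_def algebra_simps\<close>)
      ultimately show "variation_sum \<psi> P \<le> real (Suc n)" using P(3) by simp
    qed
  qed
  note * = this
  obtain n where "(b - a) / (d / 2) \<le> real n" using real_arch_simple by blast
  then have n: "b - a \<le> real n * (d / 2)" using d(1) by (simp add: field_simps)
  show thesis
  proof (rule that[of "real n"])
    fix P assume P: "interval_family a b P"
    show "variation_sum \<psi> P \<le> real n"
    proof (cases "a \<le> b")
      case False
      have "P = {}"
      proof (rule equals0I)
        fix p assume "p \<in> P"
        moreover obtain u v where "p = (u, v)" by fastforce
        ultimately show False using P False interval_familyD(2-4)[of a b P u v] by auto
      qed
      then show ?thesis by (simp add: variation_sum_def)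
    qed (use * n P in auto)
  qed
qed

section \<open>Total variation of an absolutely continuous function\<close>

context
  fixes a b :: real and \<psi> :: "real \<Rightarrow> real"
  assumes ac: "abs_cont_on a b \<psi>"
begin

lemma variation_bdd: "a \<le> u \<Longrightarrow> v \<le> b \<Longrightarrow> bdd_above (variation_sum \<psi> ` {P. interval_family u v P})"
  using abs_cont_on_variation_bounded[OF ac] interval_family_mono
  by (metis (mono_tags, lifting) bdd_aboveI2 mem_Collect_eq)

lemma variation_upper: "a \<le> u \<Longrightarrow> v \<le> b \<Longrightarrow> interval_family u v P \<Longrightarrow> variation_sum \<psi> P \<le> variation \<psi> u v"
  unfolding variation_def by (intro cSUP_upper variation_bdd) auto

lemma variation_nonneg: "a \<le> u \<Longrightarrow> v \<le> b \<Longrightarrow> 0 \<le> variation \<psi> u v"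
  using variation_upper[of u v "{}"] by (simp add: variation_sum_def)

lemma variation_ge: "a \<le> u \<Longrightarrow> u \<le> v \<Longrightarrow> v \<le> b \<Longrightarrow> \<bar>\<psi> v - \<psi> u\<bar> \<le> variation \<psi> u v"
  using variation_upper[of u v "{(u, v)}"] interval_family_single[of u u v v] variation_nonneg[of u v]
  by (cases "u = v") (auto simp: variation_sum_def)

lemma variation_approx:
  assumes "e > 0" obtains P where "interval_family u v P" "variation \<psi> u v - e < variation_sum \<psi> P"
proof -
  have "\<exists>x\<in>variation_sum \<psi> ` {P. interval_family u v P}. variation \<psi> u v - e < x"
  proof (rule ccontr)
    assume "\<not> ?thesis"
    then have "variation \<psi> u v \<le> variation \<psi> u v - e"
      unfolding variation_def by (intro cSUP_least) (auto simp: not_less intro: exI[of _ "{}"])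
    then show False using assms by simp
  qed
  then show thesis using that by auto
qed

text \<open>Splitting a family at \<open>v\<close> gives one inequality, joining near-optimal
  families on both sides the other.\<close>

lemma variation_add:
  assumes "a \<le> u" "u \<le> v" "v \<le> w" "w \<le> b"
  shows "variation \<psi> u w = variation \<psi> u v + variation \<psi> v w"
proof (rule antisym)
  show "variation \<psi> u w \<le> variation \<psi> u v + variation \<psi> v w"
    unfolding variation_def[of _ u w]
  proof (rule cSUP_least, goal_cases)
    case 1 then show ?case by (auto intro: exI[of _ "{}"])
  next
    case (2 P)
    then obtain P1 P2 where "interval_family u v P1" "interval_family v w P2"
      "variation_sum \<psi> P \<le> variation_sum \<psi> P1 + variation_sum \<psi> P2"
      using interval_family_split[OF _ assms(2,3), of P \<psi>] by blast
    then show ?case using variation_upper[of u v P1] variation_upper[of v w P2] assms by linarith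
  qed
  show "variation \<psi> u v + variation \<psi> v w \<le> variation \<psi> u w"
  proof (rule field_le_epsilon)
    fix e :: real assume "e > 0"
    obtain P where P: "interval_family u v P" "variation \<psi> u v - e / 2 < variation_sum \<psi> P"
      using variation_approx[of "e / 2"] \<open>e > 0\<close> by auto
    obtain Q where Q: "interval_family v w Q" "variation \<psi> v w - e / 2 < variation_sum \<psi> Q"
      using variation_approx[of "e / 2"] \<open>e > 0\<close> by auto
    have "variation_sum \<psi> P + variation_sum \<psi> Q \<le> variation \<psi> u w"
      using variation_upper[of u w "P \<union> Q"] interval_family_Un(1)[OF P(1) Q(1)] assms
        variation_sum_Un[OF P(1) Q(1)] by simp
    then show "variation \<psi> u v + variation \<psi> v w \<le> variation \<psi> u w + e" using P Q by linarith
  qed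
qed

text \<open>Refining every member does not increase the total length, so a \<delta> valid for \<psi>
  may be applied to the refinement as well.\<close>

lemma interval_family_UN:
  assumes P: "interval_family a b P" and Q: "\<And>u v. (u, v) \<in> P \<Longrightarrow> interval_family u v (Q (u, v))"
  shows "interval_family a b (\<Union>p\<in>P. Q p)" "variation_sum \<phi> (\<Union>p\<in>P. Q p) = (\<Sum>p\<in>P. variation_sum \<phi> (Q p))"
    "(\<Sum>(u, v)\<in>(\<Union>p\<in>P. Q p). v - u) \<le> (\<Sum>(u, v)\<in>P. v - u)"
proof -
  note D = interval_familyD[OF P]
  have D2: "u \<le> x \<and> x < y \<and> y \<le> v" if "(u, v) \<in> P" "(x, y) \<in> Q (u, v)" for u v x y
    using interval_familyD(2-4)[OF Q[OF that(1)] that(2)] by blast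
  have fin: "finite (Q p)" if "p \<in> P" for p using Q[of "fst p" "snd p"] that by (auto dest: interval_familyD(1))
  have sep: "y \<le> x' \<or> y' \<le> x" if "(u, v) \<in> P" "(x, y) \<in> Q (u, v)" "(u', v') \<in> P" "(x', y') \<in> Q (u', v')" "(u, v) \<noteq> (u', v')"
    for u v x y u' v' x' y'
    using D(5)[OF that(1,3,5)] D2[OF that(1,2)] D2[OF that(3,4)] by linarith
  show "interval_family a b (\<Union>p\<in>P. Q p)"
  proof (rule interval_familyI)
    show "finite (\<Union>p\<in>P. Q p)" using D(1) fin by auto
    show "a \<le> x \<and> x < y \<and> y \<le> b" if xy: "(x, y) \<in> (\<Union>p\<in>P. Q p)" for x y
    proof -
      obtain u v where uv: "(u, v) \<in> P" "(x, y) \<in> Q (u, v)" using xy by auto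
      then show ?thesis using D(2-4)[OF uv(1)] D2[OF uv] by linarith
    qed
    show "y \<le> x' \<or> y' \<le> x" if xy: "(x, y) \<in> (\<Union>p\<in>P. Q p)" "(x', y') \<in> (\<Union>p\<in>P. Q p)" "(x, y) \<noteq> (x', y')" for x y x' y'
    proof -
      obtain u v where uv: "(u, v) \<in> P" "(x, y) \<in> Q (u, v)" using xy by auto
      obtain u' v' where uv': "(u', v') \<in> P" "(x', y') \<in> Q (u', v')" using xy by auto
      show ?thesis
      proof (cases "(u, v) = (u', v')")
        case True
        then show ?thesis using interval_familyD(5)[OF Q[OF uv(1)] uv(2)] uv' xy(3) by simp
      qed (use sep[OF uv uv'] in blast)
    qed
  qed
  have disj: "Q p \<inter> Q q = {}" if "p \<in> P" "q \<in> P" "p \<noteq> q" for p q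
  proof (rule equals0I)
    fix z assume z: "z \<in> Q p \<inter> Q q"
    obtain x y u v u' v' where e: "z = (x, y)" "p = (u, v)" "q = (u', v')" by (metis surj_pair)
    then show False using sep[of u v x y u' v' x y] that z D2[of u v x y] by auto
  qed
  have UN: "(\<Sum>p\<in>(\<Union>p\<in>P. Q p). F p) = (\<Sum>p\<in>P. sum F (Q p))" for F :: "_ \<Rightarrow> real"
    by (rule sum.UNION_disjoint) (use D(1) fin disj in auto)
  show "variation_sum \<phi> (\<Union>p\<in>P. Q p) = (\<Sum>p\<in>P. variation_sum \<phi> (Q p))"
    unfolding variation_sum_def by (rule UN)
  show "(\<Sum>(u, v)\<in>(\<Union>p\<in>P. Q p). v - u) \<le> (\<Sum>(u, v)\<in>P. v - u)"
    unfolding UN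
  proof (rule sum_mono)
    fix p assume p: "p \<in> P"
    obtain u v where e: "p = (u, v)" by fastforce
    then show "(\<Sum>(u, v)\<in>Q p. v - u) \<le> (case p of (u, v) \<Rightarrow> v - u)"
      using interval_family_length[OF Q, of u v] p D(3)[of u v] by simp
  qed
qed

text \<open>Each increment of the variation function is almost attained on a refinement of its
  interval; all refinements together form one family, to which the absolute continuity of \<psi> at
  e / 2 applies.\<close>

lemma abs_cont_on_variation: "abs_cont_on a b (\<lambda>t. variation \<psi> a t)"
  unfolding abs_cont_on_iff
proof (intro allI impI)
  fix e :: real assume "e > 0"
  obtain d where d: "d > 0" "\<And>P. interval_family a b P \<Longrightarrow> (\<Sum>(u, v)\<in>P. v - u) < d \<Longrightarrow> variation_sum \<psi> P < e / 2"
    using ac[unfolded abs_cont_on_iff, rule_format, of "e / 2"] \<open>e > 0\<close> by auto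
  have "variation_sum (\<lambda>t. variation \<psi> a t) P < e" if P: "interval_family a b P \<and> (\<Sum>(u, v)\<in>P. v - u) < d" for P
  proof -
    \<comment> \<open>One error \<delta> per member adds up to less than e / 2; the added 1 covers
      the empty family.\<close>
    define \<delta> where "\<delta> = e / (4 * (real (card P) + 1))"
    have "\<delta> > 0" using \<open>e > 0\<close> by (simp add: \<delta>_def)
    have "\<exists>Q. interval_family (fst p) (snd p) Q \<and> variation \<psi> (fst p) (snd p) - \<delta> < variation_sum \<psi> Q" for p
      using variation_approx[OF \<open>\<delta> > 0\<close>] by metis
    then obtain Q where Q: "\<And>p. interval_family (fst p) (snd p) (Q p)"
      "\<And>p. variation \<psi> (fst p) (snd p) - \<delta> < variation_sum \<psi> (Q p)" by metis
    have Q': "interval_family u v (Q (u, v))" for u v using Q(1)[of "(u, v)"] by simp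
    have "variation_sum (\<lambda>t. variation \<psi> a t) P = (\<Sum>p\<in>P. variation \<psi> (fst p) (snd p))"
      unfolding variation_sum_def
    proof (rule sum.cong[OF refl])
      fix p assume p: "p \<in> P"
      obtain u v where e: "p = (u, v)" by fastforce
      have uv: "a \<le> u" "u \<le> v" "v \<le> b" using P p e interval_familyD(2-4)[of a b P u v] by auto
      then show "(case p of (u, v) \<Rightarrow> \<bar>variation \<psi> a v - variation \<psi> a u\<bar>) = variation \<psi> (fst p) (snd p)"
        using variation_add[of a u v] variation_nonneg[of u v] e by simp
    qed
    also have "\<dots> \<le> (\<Sum>p\<in>P. variation_sum \<psi> (Q p) + \<delta>)"
      by (rule sum_mono) (use Q(2) less_imp_le in \<open>fastforce simp: algebra_simps\<close>)
    also have "\<dots> = variation_sum \<psi> (\<Union>p\<in>P. Q p) + card P * \<delta>"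
      using interval_family_UN(2)[of P Q \<psi>, OF _ Q'] P by (simp add: sum.distrib)
    also have "\<dots> < e / 2 + e / 2"
    proof (rule add_strict_mono)
      show "variation_sum \<psi> (\<Union>p\<in>P. Q p) < e / 2"
        using interval_family_UN(1,3)[of P Q, OF _ Q'] P by (intro d(2)) auto
      show "real (card P) * \<delta> < e / 2" using \<open>e > 0\<close>
        by (simp add: \<delta>_def field_simps) (intro add_pos_nonneg, auto)
    qed
    finally show ?thesis by simp
  qed
  then show "\<exists>d>0. \<forall>P. interval_family a b P \<and> (\<Sum>(u, v)\<in>P. v - u) < d \<longrightarrow>
      variation_sum (\<lambda>t. variation \<psi> a t) P < e" using d(1) by blast
qed

end

lemma abs_cont_on_diff:
  assumes "abs_cont_on a b F" "abs_cont_on a b G" shows "abs_cont_on a b (\<lambda>t. F t - G t)"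
  unfolding abs_cont_on_iff
proof (intro allI impI)
  fix e :: real assume "e > 0"
  obtain d where d: "d > 0" "\<And>P. interval_family a b P \<Longrightarrow> (\<Sum>(u, v)\<in>P. v - u) < d \<Longrightarrow> variation_sum F P < e / 2"
    using assms(1)[unfolded abs_cont_on_iff, rule_format, of "e / 2"] \<open>e > 0\<close> by auto
  obtain d' where d': "d' > 0" "\<And>P. interval_family a b P \<Longrightarrow> (\<Sum>(u, v)\<in>P. v - u) < d' \<Longrightarrow> variation_sum G P < e / 2"
    using assms(2)[unfolded abs_cont_on_iff, rule_format, of "e / 2"] \<open>e > 0\<close> by auto
  have "variation_sum (\<lambda>t. F t - G t) P < e" if P: "interval_family a b P \<and> (\<Sum>(u, v)\<in>P. v - u) < min d d'" for P
  proof -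
    have "variation_sum (\<lambda>t. F t - G t) P \<le> variation_sum F P + variation_sum G P"
      unfolding variation_sum_def sum.distrib[symmetric] by (intro sum_mono) auto
    then show ?thesis using d(2)[of P] d'(2)[of P] P by linarith
  qed
  then show "\<exists>d>0. \<forall>P. interval_family a b P \<and> (\<Sum>(u, v)\<in>P. v - u) < d \<longrightarrow> variation_sum (\<lambda>t. F t - G t) P < e"
    using d(1) d'(1) by (intro exI[of _ "min d d'"]) auto
qed

text \<open>Transfers absolute continuity from the function \<open>H\<close> of
  \<open>abs_cont_path\<close> to a single pairing.\<close>

lemma abs_cont_on_dominated:
  assumes "abs_cont_on a b H" "\<And>s t. s \<in> {a..b} \<Longrightarrow> t \<in> {a..b} \<Longrightarrow> \<bar>\<psi> t - \<psi> s\<bar> \<le> \<bar>H t - H s\<bar>"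
  shows "abs_cont_on a b \<psi>"
  unfolding abs_cont_on_iff
proof (intro allI impI)
  fix e :: real assume "e > 0"
  obtain d where d: "d > 0" "\<And>P. interval_family a b P \<Longrightarrow> (\<Sum>(u, v)\<in>P. v - u) < d \<Longrightarrow> variation_sum H P < e"
    using assms(1)[unfolded abs_cont_on_iff, rule_format, of e] \<open>e > 0\<close> by auto
  have "variation_sum \<psi> P \<le> variation_sum H P" if P: "interval_family a b P" for P
    unfolding variation_sum_def
  proof (rule sum_mono)
    fix p assume p: "p \<in> P"
    obtain u v where e: "p = (u, v)" by fastforce
    show "(case p of (u, v) \<Rightarrow> \<bar>\<psi> v - \<psi> u\<bar>) \<le> (case p of (u, v) \<Rightarrow> \<bar>H v - H u\<bar>)"
      using assms(2)[of u v] interval_familyD(2-4)[OF P, of u v] p e by auto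
  qed
  then show "\<exists>d>0. \<forall>P. interval_family a b P \<and> (\<Sum>(u, v)\<in>P. v - u) < d \<longrightarrow> variation_sum \<psi> P < e"
    using d by (meson le_less_trans)
qed

lemma abs_cont_on_continuous:
  assumes "abs_cont_on a b \<psi>" shows "continuous_on {a..b} \<psi>"
  unfolding continuous_on_iff
proof (intro ballI allI impI)
  fix x e :: real assume x: "x \<in> {a..b}" and "e > 0"
  obtain d where d: "d > 0" "\<And>P. interval_family a b P \<Longrightarrow> (\<Sum>(u, v)\<in>P. v - u) < d \<Longrightarrow> variation_sum \<psi> P < e"
    using assms(1)[unfolded abs_cont_on_iff, rule_format, of e] \<open>e > 0\<close> by auto
  have *: "\<bar>\<psi> v - \<psi> u\<bar> < e" if "u \<in> {a..b}" "v \<in> {a..b}" "u < v" "v - u < d" for u v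
    using d(2)[of "{(u, v)}"] interval_family_single[of a u v b] that by (simp add: variation_sum_def)
  show "\<exists>d>0. \<forall>x'\<in>{a..b}. dist x' x < d \<longrightarrow> dist (\<psi> x') (\<psi> x) < e"
  proof (intro exI[of _ d] conjI ballI impI d(1))
    fix y assume y: "y \<in> {a..b}" "dist y x < d"
    then consider "x < y" | "y < x" | "x = y" by linarith
    then show "dist (\<psi> y) (\<psi> x) < e"
      using *[of x y] *[of y x] x y \<open>e > 0\<close> by cases (auto simp: dist_real_def)
  qed
qed

text \<open>By inner regularity it suffices to bound compact subsets \<open>K\<close> of a null set; the cells of a fine grid that
  meet \<open>K\<close> form a finite family of disjoint intervals of small total length.\<close>

lemma interval_measure_null_if_abs_cont:
  fixes F :: "real \<Rightarrow> real"
  assumes mono: "\<And>x y. x \<le> y \<Longrightarrow> F x \<le> F y" and cont: "continuous_on UNIV F"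
    and left: "\<And>x. x \<le> 0 \<Longrightarrow> F x = F 0" and right: "\<And>x. x \<ge> T \<Longrightarrow> F x = F T"
    and T: "0 < T" and ac: "abs_cont_on 0 T F" and N: "N \<in> null_sets lborel"
  shows "N \<in> null_sets (interval_measure F)" "emeasure (interval_measure F) UNIV = ennreal (F T - F 0)"
proof -
  let ?\<mu> = "interval_measure F"
  have rc: "continuous (at_right a) F" for a
    by (meson UNIV_I cont continuous_on_eq_continuous_at continuous_at_imp_continuous_at_within open_UNIV)
  note Ioc = emeasure_interval_measure_Ioc[OF _ mono rc]
  have U: "UNIV = (\<Union>n::nat. {- real n - 1 <.. T + real n})"
  proof (intro equalityI subsetI UNIV_I)
    fix x :: real
    obtain n :: nat where "real n > \<bar>x\<bar>" using reals_Archimedean2 by blast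
    then show "x \<in> (\<Union>n::nat. {- real n - 1 <.. T + real n})" using T by (auto intro!: exI[of _ n])
  qed
  have "emeasure ?\<mu> (\<Union>n::nat. {- real n - 1 <.. T + real n}) = (SUP n. emeasure ?\<mu> {- real n - 1 <.. T + real n})"
    by (rule SUP_emeasure_incseq[symmetric]) (auto simp: incseq_def)
  also have "\<dots> = (SUP n::nat. ennreal (F T - F 0))"
  proof (intro SUP_cong refl)
    fix n :: nat
    have "F (- real n - 1) = F 0" "F (T + real n) = F T" by (rule left right; simp)+
    then show "emeasure ?\<mu> {- real n - 1 <.. T + real n} = ennreal (F T - F 0)"
      using Ioc[of "- real n - 1" "T + real n"] T by simp
  qed
  finally show total: "emeasure ?\<mu> UNIV = ennreal (F T - F 0)" using U by simp
  \<comment> \<open>F is constant off [0, T], so all mass sits in (0, T] and the grid has to cover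
    only that part of K.\<close>
  have Ncell: "emeasure ?\<mu> (UNIV - {0<..T}) = 0"
    by (subst emeasure_Diff) (use T in \<open>simp_all add: Ioc total flip: ennreal_minus\<close>)
  have small: "emeasure ?\<mu> K \<le> ennreal e" if K: "compact K" "K \<subseteq> N" and e: "e > 0" for K e
  proof -
    obtain d where d: "d > 0" "\<And>P. interval_family 0 T P \<Longrightarrow> (\<Sum>(u, v)\<in>P. v - u) < d \<Longrightarrow> variation_sum F P < e"
      using ac[unfolded abs_cont_on_iff, rule_format, of e] e by auto
    have KS: "K \<in> sets borel" using K by (simp add: borel_compact)
    have "K \<in> null_sets lborel" using null_sets_subset[OF N, of K] K KS by auto
    then have K0: "emeasure lborel K = 0" by auto
    obtain O' where O': "open O'" "K \<subseteq> O'" "emeasure lborel (O' - K) < ennreal d"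
      using outer_regular_lborel[OF KS d(1)] by blast
    have "emeasure lborel O' \<le> emeasure lborel (O' - K) + emeasure lborel K"
      using O' KS by (subst emeasure_Diff_null_set[symmetric]) (use \<open>K \<in> null_sets lborel\<close> in auto)
    then have Od: "emeasure lborel O' < ennreal d" using O' K0 by simp
    obtain r where r: "r > 0" "(\<Union>x\<in>K. ball x r) \<subseteq> O'"
      using compact_subset_open_imp_ball_epsilon_subset[OF K(1) O'(1,2)] by blast
    obtain n :: nat where n: "T / r < real n" using reals_Archimedean2 by blast
    then have n0: "real n > 0" using T r by (meson divide_pos_pos less_trans)
    obtain q where q: "q = T / n" by simp
    \<comment> \<open>Cells shorter than r that meet K stay inside the open set O', whose Lebesgue
      measure is below d.\<close>
    have mesh: "q < r" using n n0 r(1) unfolding q by (simp add: field_simps)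
    have h0: "q > 0" and nq: "real n * q = T" unfolding q using T n0 by simp_all
    define cell where "cell k = {real k * q <.. (real k + 1) * q}" for k :: nat
    define I where "I = {k. k < n \<and> cell k \<inter> K \<noteq> {}}"
    define g where "g k = (real k * q, (real k + 1) * q)" for k :: nat
    have inj: "inj_on g A" for A using h0 by (auto simp: inj_on_def g_def)
    have finI: "finite I" by (simp add: I_def)
    have fam: "interval_family 0 T (g ` I)"
    proof (rule interval_familyI)
      show "finite (g ` I)" using finI by simp
      show "0 \<le> u \<and> u < v \<and> v \<le> T" if "(u, v) \<in> g ` I" for u v
      proof -
        obtain k where k: "k \<in> I" "(u, v) = g k" using \<open>(u, v) \<in> g ` I\<close> by (rule imageE) auto
        have "(real k + 1) * q \<le> real n * q" using k h0 by (intro mult_right_mono) (auto simp: I_def)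
        then show ?thesis using k h0 nq by (auto simp: algebra_simps g_def)
      qed
      show "v \<le> u' \<or> v' \<le> u" if "(u, v) \<in> g ` I" "(u', v') \<in> g ` I" "(u, v) \<noteq> (u', v')" for u v u' v'
      proof -
        obtain k where k: "(u, v) = g k" using \<open>(u, v) \<in> g ` I\<close> by (rule imageE) auto
        obtain l where l: "(u', v') = g l" using \<open>(u', v') \<in> g ` I\<close> by (rule imageE) auto
        note kl = k l
        then have "k \<noteq> l" using that(3) by auto
        then have "real k + 1 \<le> real l \<or> real l + 1 \<le> real k" by linarith
        then show ?thesis using kl h0 mult_right_mono[of _ _ "q"] by (auto simp: g_def)
      qed
    qed
    have cellS: "cell k \<in> sets borel" for k by (simp add: cell_def)
    have sub: "(\<Union>k\<in>I. cell k) \<subseteq> O'"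
    proof
      fix y assume "y \<in> (\<Union>k\<in>I. cell k)"
      then obtain k x where k: "y \<in> cell k" "x \<in> cell k" "x \<in> K" by (auto simp: I_def)
      have "\<bar>x - y\<bar> < q" using k by (auto simp: cell_def algebra_simps abs_less_iff)
      then have "y \<in> ball x r" using mesh by (simp add: dist_real_def)
      then show "y \<in> O'" using r k by blast
    qed
    have disjcell: "disjoint_family_on cell A" for A
    proof -
      have "cell k \<inter> cell l = {}" if "k < l" for k l
      proof -
        have "(real k + 1) * q \<le> real l * q" using that h0 by (intro mult_right_mono) auto
        then show ?thesis by (auto simp: cell_def)
      qed
      then show ?thesis unfolding disjoint_family_on_def by (metis inf_commute linorder_neqE_nat)
    qed
    have len: "(\<Sum>(u, v)\<in>g ` I. v - u) < d"
    proof -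
      have "ennreal (\<Sum>(u, v)\<in>g ` I. v - u) = ennreal (\<Sum>k\<in>I. q)"
        by (subst sum.reindex[OF inj]) (simp add: g_def algebra_simps)
      also have "\<dots> = (\<Sum>k\<in>I. ennreal q)" using h0 by (intro sum_ennreal[symmetric]) auto
      also have "\<dots> = (\<Sum>k\<in>I. emeasure lborel (cell k))"
        using h0 by (intro sum.cong refl) (simp add: cell_def algebra_simps)
      also have "\<dots> = emeasure lborel (\<Union>k\<in>I. cell k)"
        using cellS finI disjcell by (intro sum_emeasure) auto
      also have "\<dots> \<le> emeasure lborel O'" using sub O'(1) by (intro emeasure_mono) auto
      finally show ?thesis using Od d(1) by (metis ennreal_less_iff le_less_trans less_imp_le not_less ennreal_leI)
    qed
    have cover: "K \<inter> {0<..T} \<subseteq> (\<Union>k\<in>I. cell k)"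
    proof
      fix x assume x: "x \<in> K \<inter> {0<..T}"
      \<comment> \<open>k + 1 is the ceiling of x / q, because cells are open on the left and closed
        on the right.\<close>
      define k where "k = nat (\<lceil>x / q\<rceil> - 1)"
      have p: "x / q > 0" using x h0 by simp
      then have c1: "\<lceil>x / q\<rceil> \<ge> 1" by (simp add: le_ceiling_iff)
      then have rk: "real k = \<lceil>x / q\<rceil> - 1" by (simp add: k_def)
      have "real k < x / q" "x / q \<le> real k + 1" unfolding rk by linarith+
      then have xk: "x \<in> cell k" using h0 by (auto simp: cell_def field_simps)
      have "x / q \<le> real n" using x h0 nq by (simp add: field_simps)
      then have "real k < real n" using \<open>real k < x / q\<close> by linarith
      then show "x \<in> (\<Union>k\<in>I. cell k)" using xk x by (auto simp: I_def)
    qed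
    have "emeasure ?\<mu> K \<le> emeasure ?\<mu> ((\<Union>k\<in>I. cell k) \<union> (UNIV - {0<..T}))"
      using cover cellS finI by (intro emeasure_mono) auto
    also have "\<dots> \<le> emeasure ?\<mu> (\<Union>k\<in>I. cell k) + emeasure ?\<mu> (UNIV - {0<..T})"
      using cellS finI by (intro emeasure_subadditive) auto
    also have "\<dots> = (\<Sum>k\<in>I. emeasure ?\<mu> (cell k))"
      unfolding Ncell using cellS finI disjcell by (subst sum_emeasure) auto
    also have "\<dots> = (\<Sum>k\<in>I. ennreal (F (snd (g k)) - F (fst (g k))))"
      using h0 by (intro sum.cong refl) (simp add: cell_def g_def Ioc algebra_simps)
    also have "\<dots> = ennreal (\<Sum>k\<in>I. F (snd (g k)) - F (fst (g k)))"
      using h0 mono by (intro sum_ennreal) (simp add: g_def algebra_simps)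
    also have "(\<Sum>k\<in>I. F (snd (g k)) - F (fst (g k))) \<le> variation_sum F (g ` I)"
      unfolding variation_sum_def by (subst sum.reindex[OF inj], rule sum_mono) (auto simp: g_def)
    also have "variation_sum F (g ` I) \<le> e" using d(2)[OF fam len] by simp
    finally show ?thesis by (simp add: ennreal_leI)
  qed
  have "emeasure ?\<mu> N = (SUP K\<in>{K. K \<subseteq> N \<and> compact K}. emeasure ?\<mu> K)"
    by (rule inner_regular) (use N total in auto)
  also have "\<dots> \<le> 0"
  proof (rule SUP_least)
    fix K assume "K \<in> {K. K \<subseteq> N \<and> compact K}"
    then have "emeasure ?\<mu> K \<le> 0 + ennreal e" if "0 < e" for e using small[of K e] that by simp
    then show "emeasure ?\<mu> K \<le> 0" by (rule ennreal_le_epsilon)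
  qed
  finally show "N \<in> null_sets ?\<mu>" using N by (auto simp: null_sets_def)
qed

text \<open>The Stieltjes measure of F ignores Lebesgue null sets, so Radon-Nikodym supplies
  g.\<close>

lemma mono_abs_cont_density:
  fixes F :: "real \<Rightarrow> real"
  assumes mono: "\<And>x y. x \<le> y \<Longrightarrow> F x \<le> F y" and cont: "continuous_on UNIV F"
    and left: "\<And>x. x \<le> 0 \<Longrightarrow> F x = F 0" and right: "\<And>x. x \<ge> T \<Longrightarrow> F x = F T"
    and T: "0 < T" and ac: "abs_cont_on 0 T F"
  obtains g where "integrable lborel g" "\<And>a b. a \<le> b \<Longrightarrow> (LINT x:{a..b}|lborel. g x) = F b - F a"
proof -
  let ?\<mu> = "interval_measure F"
  have "absolutely_continuous lborel ?\<mu>"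
    unfolding absolutely_continuous_def using interval_measure_null_if_abs_cont(1)[OF assms] by blast
  then obtain f where f: "f \<in> borel_measurable lborel" "density lborel f = ?\<mu>"
    using sigma_finite_measure.Radon_Nikodym[OF sigma_finite_lborel, of ?\<mu>] by auto
  have tot: "(\<integral>\<^sup>+x. f x \<partial>lborel) = ennreal (F T - F 0)"
  proof -
    have "emeasure (density lborel f) UNIV = ennreal (F T - F 0)"
      unfolding f(2) using interval_measure_null_if_abs_cont(2)[OF assms, of "{}"] by simp
    then show ?thesis using f(1) by (simp add: emeasure_density)
  qed
  \<comment> \<open>Finite total mass makes the density finite almost everywhere, so
    \<open>enn2real\<close> alters it only on a null set.\<close>
  have fin: "AE x in lborel. f x \<noteq> \<infinity>"
    by (rule nn_integral_PInf_AE) (use f tot in auto)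
  have [measurable]: "f \<in> borel_measurable borel" using f(1) by simp
  have eq: "(\<integral>\<^sup>+x. ennreal (enn2real (f x) * indicator A x) \<partial>lborel) = emeasure ?\<mu> A" if [measurable]: "A \<in> sets borel" for A
  proof -
    have "(\<integral>\<^sup>+x. ennreal (enn2real (f x) * indicator A x) \<partial>lborel) = (\<integral>\<^sup>+x. f x * indicator A x \<partial>lborel)"
      by (rule nn_integral_cong_AE) (use fin in eventually_elim, auto simp: indicator_def ennreal_enn2real_if)
    also have "\<dots> = emeasure ?\<mu> A" by (subst f(2)[symmetric]) (simp add: emeasure_density)
    finally show ?thesis .
  qed
  show thesis
  proof (rule that[of "\<lambda>x. enn2real (f x)"])
    show "integrable lborel (\<lambda>x. enn2real (f x))"
      by (rule integrableI_nonneg) (use eq[of UNIV] interval_measure_null_if_abs_cont(2)[OF assms, of "{}"] in \<open>auto\<close>)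
    fix a b :: real assume ab: "a \<le> b"
    have "(LINT x:{a..b}|lborel. enn2real (f x)) = enn2real (\<integral>\<^sup>+x. ennreal (enn2real (f x) * indicator {a..b} x) \<partial>lborel)"
      unfolding set_lebesgue_integral_def by (subst integral_eq_nn_integral) (auto simp: mult.commute)
    also have "\<dots> = F b - F a"
      using ab mono by (subst eq) (auto simp: emeasure_interval_measure_Icc[OF _ mono cont])
    finally show "(LINT x:{a..b}|lborel. enn2real (f x)) = F b - F a" .
  qed
qed

text \<open>Lebesgue differentiation: averages over [x, x + h] give the right derivative, and the
  same theorem for the reflected integrand gives the left one. The exceptional set of the latter
  must be reflected back.\<close>

lemma AE_differentiable_indefinite_integral:
  fixes g F :: "real \<Rightarrow> real"
  assumes g: "integrable lborel g" and F: "\<And>a b. a \<le> b \<Longrightarrow> (LINT x:{a..b}|lborel. g x) = F b - F a"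
  shows "AE t in lborel. (F has_real_derivative g t) (at t)"
proof -
  have gi: "g integrable_on cbox a b" for a b
    using integrable_on_subcbox[OF integrable_on_lborel[OF g], of a b] by simp
  have gI: "integral {a..b} g = F b - F a" if "a \<le> b" for a b
  proof -
    have "set_integrable lborel {a..b} g" unfolding set_integrable_def by (intro integrable_mult_indicator g) auto
    then show ?thesis using F[OF that] set_borel_integral_eq_integral(2)[of "{a..b}" g] by simp
  qed
  have gi': "(\<lambda>x. g (- x)) integrable_on cbox a b" for a b
    using iffD2[OF Henstock_Kurzweil_Integration.integrable_reflect[where f = g and a = "-b" and b = "-a"] gi[of "-b" "-a"]]
    by (simp only: minus_minus)
  obtain N1 where N1: "negligible N1" "\<And>x e. \<lbrakk>x \<notin> N1; 0 < e\<rbrakk> \<Longrightarrow>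
      \<exists>d>0. \<forall>h. 0 < h \<and> h < d \<longrightarrow> norm (integral (cbox x (x + h *\<^sub>R One)) g /\<^sub>R h ^ DIM(real) - g x) < e"
    using integrable_ccontinuous_explicit[OF gi] by blast
  obtain N2 where N2: "negligible N2" "\<And>x e. \<lbrakk>x \<notin> N2; 0 < e\<rbrakk> \<Longrightarrow>
      \<exists>d>0. \<forall>h. 0 < h \<and> h < d \<longrightarrow> norm (integral (cbox x (x + h *\<^sub>R One)) (\<lambda>x. g (- x)) /\<^sub>R h ^ DIM(real) - g (- x)) < e"
    using integrable_ccontinuous_explicit[OF gi'] by blast
  have N2': "negligible (uminus ` N2)"
    by (rule negligible_differentiable_image_negligible) (use N2(1) in \<open>auto intro!: derivative_intros\<close>)
  have D: "(F has_real_derivative g t) (at t)" if "t \<notin> N1 \<union> uminus ` N2" for t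
  proof -
    have t2: "- t \<notin> N2" using that by (metis UnCI image_eqI minus_minus)
    have right: "\<exists>d>0. \<forall>h. 0 < h \<and> h < d \<longrightarrow> \<bar>(F (t + h) - F t) / h - g t\<bar> < e" if "e > 0" for e
    proof -
      obtain d where d: "d > 0" "\<And>h. 0 < h \<Longrightarrow> h < d \<Longrightarrow> norm (integral (cbox t (t + h *\<^sub>R One)) g /\<^sub>R h ^ DIM(real) - g t) < e"
        using N1(2)[of t e] \<open>t \<notin> N1 \<union> uminus ` N2\<close> \<open>e > 0\<close> by blast
      show ?thesis
        by (rule exI[of _ d]) (use d gI[of t "t + _"] in \<open>auto simp: divide_inverse mult.commute\<close>)
    qed
    have left: "\<exists>d>0. \<forall>h. 0 < h \<and> h < d \<longrightarrow> \<bar>(F (t - h) - F t) / (- h) - g t\<bar> < e" if "e > 0" for e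
    proof -
      obtain d where d: "d > 0" "\<And>h. 0 < h \<Longrightarrow> h < d \<Longrightarrow> norm (integral (cbox (-t) (-t + h *\<^sub>R One)) (\<lambda>x. g (- x)) /\<^sub>R h ^ DIM(real) - g (- (- t))) < e"
        using N2(2)[OF t2 \<open>e > 0\<close>] by blast
      have I: "integral {- t .. - t + h} (\<lambda>x. g (- x)) = F t - F (t - h)" if "0 < h" for h
      proof -
        have "integral {- t .. - (t - h)} (\<lambda>x. g (- x)) = integral {t - h .. t} g"
          by (rule Henstock_Kurzweil_Integration.integral_reflect_real)
        moreover have "- (t - h) = - t + h" by simp
        ultimately show ?thesis using gI[of "t - h" t] that by simp
      qed
      have "\<bar>(F (t - h) - F t) / (- h) - g t\<bar> < e" if h: "0 < h" "h < d" for h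
      proof -
        have "(F (t - h) - F t) / (- h) = inverse h * (F t - F (t - h))" using h by (simp add: field_simps)
        then show ?thesis using d(2)[OF h] I[OF h(1)] by simp
      qed
      then show ?thesis using d(1) by blast
    qed
    show ?thesis
      unfolding DERIV_def LIM_def
    proof (intro allI impI)
      fix e :: real assume "e > 0"
      obtain d1 where d1: "d1 > 0" "\<And>h. 0 < h \<Longrightarrow> h < d1 \<Longrightarrow> \<bar>(F (t + h) - F t) / h - g t\<bar> < e" using right[OF \<open>e > 0\<close>] by blast
      obtain d2 where d2: "d2 > 0" "\<And>h. 0 < h \<Longrightarrow> h < d2 \<Longrightarrow> \<bar>(F (t - h) - F t) / (- h) - g t\<bar> < e" using left[OF \<open>e > 0\<close>] by blast
      show "\<exists>d>0. \<forall>h. h \<noteq> 0 \<and> dist h 0 < d \<longrightarrow> dist ((F (t + h) - F t) / h) (g t) < e"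
      proof (intro exI[of _ "min d1 d2"] conjI allI impI)
        fix h :: real assume h: "h \<noteq> 0 \<and> dist h 0 < min d1 d2"
        show "dist ((F (t + h) - F t) / h) (g t) < e"
        proof (cases "h > 0")
          case True then show ?thesis using d1(2)[of h] h by (simp add: dist_real_def)
        next
          case False then show ?thesis using d2(2)[of "- h"] h by (simp add: dist_real_def)
        qed
      qed (use d1 d2 in auto)
    qed
  qed
  have "negligible (N1 \<union> uminus ` N2)" using N1(1) N2' by (rule negligible_Un)
  then have "N1 \<union> uminus ` N2 \<in> null_sets lebesgue" by (simp add: negligible_iff_null_sets)
  then have "AE t in lebesgue. (F has_real_derivative g t) (at t)"
    by (rule AE_I'[where N = "N1 \<union> uminus ` N2"]) (use D in blast)
  then show ?thesis by (simp add: AE_completion_iff)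
qed

text \<open>Jordan decomposition: with V the variation function, both V and V - \<psi> are monotone
  and absolutely continuous, so the monotone case applies to each.\<close>

theorem abs_cont_on_FTC:
  fixes \<psi> :: "real \<Rightarrow> real"
  assumes T: "0 < T" and ac: "abs_cont_on 0 T \<psi>"
  obtains g where "integrable lborel g" "(LINT t:{0..T}|lborel. g t) = \<psi> T - \<psi> 0"
    "AE t in lborel. t \<in> {0<..<T} \<longrightarrow> (\<psi> has_real_derivative g t) (at t)"
proof -
  have mono_case: "\<exists>g. integrable lborel g \<and> (LINT t:{0..T}|lborel. g t) = G T - G 0 \<and>
      (AE t in lborel. t \<in> {0<..<T} \<longrightarrow> (G has_real_derivative g t) (at t))"
    if G: "abs_cont_on 0 T G" "\<And>x y. 0 \<le> x \<Longrightarrow> x \<le> y \<Longrightarrow> y \<le> T \<Longrightarrow> G x \<le> G y" for G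
  proof -
    \<comment> \<open>Constant extension beyond [0, T], so that a Stieltjes measure on the whole
      line can be used.\<close>
    define F where "F x = G (max 0 (min T x))" for x
    have FG: "F x = G x" if "x \<in> {0..T}" for x using that by (simp add: F_def)
    have "continuous_on UNIV F" unfolding F_def
      by (rule continuous_on_compose2[OF abs_cont_on_continuous[OF G(1)]]) (use T in \<open>auto intro!: continuous_intros\<close>)
    moreover have "abs_cont_on 0 T F"
      by (rule abs_cont_on_dominated[OF G(1)]) (simp add: FG)
    moreover have "F x \<le> F y" if "x \<le> y" for x y
      unfolding F_def using that T by (intro G(2)) auto
    moreover have "F x = F 0" if "x \<le> 0" for x using that T by (simp add: F_def)
    moreover have "F x = F T" if "x \<ge> T" for x using that T by (simp add: F_def)
    ultimately obtain g where g: "integrable lborel g" "\<And>a b. a \<le> b \<Longrightarrow> (LINT x:{a..b}|lborel. g x) = F b - F a"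
      using mono_abs_cont_density[of F T] T by metis
    have "AE t in lborel. (F has_real_derivative g t) (at t)"
      by (rule AE_differentiable_indefinite_integral[OF g])
    then have "AE t in lborel. t \<in> {0<..<T} \<longrightarrow> (G has_real_derivative g t) (at t)"
    proof eventually_elim
      case (elim t)
      show ?case
      proof
        assume "t \<in> {0<..<T}"
        then show "(G has_real_derivative g t) (at t)"
          using has_field_derivative_transform_within_open[OF elim, of "{0<..<T}" G] FG by auto
      qed
    qed
    then show ?thesis using g(1) g(2)[of 0 T] T FG by auto
  qed
  let ?V = "\<lambda>t. variation \<psi> 0 t"
  have V: "\<bar>\<psi> y - \<psi> x\<bar> \<le> ?V y - ?V x" if "0 \<le> x" "x \<le> y" "y \<le> T" for x y
    using variation_add[OF ac, of 0 x y] variation_ge[OF ac, of x y] that by simp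
  have acV: "abs_cont_on 0 T ?V" by (rule abs_cont_on_variation[OF ac])
  obtain g1 where g1: "integrable lborel g1" "(LINT t:{0..T}|lborel. g1 t) = ?V T - ?V 0"
    "AE t in lborel. t \<in> {0<..<T} \<longrightarrow> (?V has_real_derivative g1 t) (at t)"
    using mono_case[OF acV] V by fastforce
  obtain g2 where g2: "integrable lborel g2" "(LINT t:{0..T}|lborel. g2 t) = (?V T - \<psi> T) - (?V 0 - \<psi> 0)"
    "AE t in lborel. t \<in> {0<..<T} \<longrightarrow> ((\<lambda>t. ?V t - \<psi> t) has_real_derivative g2 t) (at t)"
    using mono_case[OF abs_cont_on_diff[OF acV ac]] V by fastforce
  show thesis
  proof (rule that[of "\<lambda>t. g1 t - g2 t"])
    show "integrable lborel (\<lambda>t. g1 t - g2 t)" using g1 g2 by auto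
    have "set_integrable lborel {0..T} g1" "set_integrable lborel {0..T} g2"
      unfolding set_integrable_def by (intro integrable_mult_indicator g1(1) g2(1); simp)+
    then show "(LINT t:{0..T}|lborel. g1 t - g2 t) = \<psi> T - \<psi> 0"
      using g1(2) g2(2) by (simp add: set_integral_diff)
    show "AE t in lborel. t \<in> {0<..<T} \<longrightarrow> (\<psi> has_real_derivative g1 t - g2 t) (at t)"
      using g1(3) g2(3)
    proof eventually_elim
      case (elim t)
      then show ?case using DERIV_diff[of ?V "g1 t" t UNIV "\<lambda>t. ?V t - \<psi> t" "g2 t"] by simp
    qed
  qed
qed

section \<open>Smooth cutoffs and test functions\<close>

definition smooth :: "(real \<Rightarrow> real) \<Rightarrow> bool" where
  "smooth f \<longleftrightarrow> (\<forall>k. (deriv ^^ k) f differentiable_on UNIV)"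

text \<open>Expressions built from smooth functions and the generators X. This avoids product and
  chain rules of order k: it suffices that differentiating an expression yields an expression of the
  same kind.\<close>

inductive_set smooth_closure :: "(real \<Rightarrow> real) set \<Rightarrow> (real \<Rightarrow> real) set" for X where
  base: "f \<in> X \<Longrightarrow> f \<in> smooth_closure X"
| const: "(\<lambda>x. c) \<in> smooth_closure X"
| ident: "(\<lambda>x. x) \<in> smooth_closure X"
| smooth: "smooth f \<Longrightarrow> f \<in> smooth_closure X"
| add: "f \<in> smooth_closure X \<Longrightarrow> g \<in> smooth_closure X \<Longrightarrow> (\<lambda>x. f x + g x) \<in> smooth_closure X"
| mult: "f \<in> smooth_closure X \<Longrightarrow> g \<in> smooth_closure X \<Longrightarrow> (\<lambda>x. f x * g x) \<in> smooth_closure X"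
| comp: "smooth f \<Longrightarrow> g \<in> smooth_closure X \<Longrightarrow> (\<lambda>x. f (g x)) \<in> smooth_closure X"

lemma smooth_DERIV: "smooth f \<Longrightarrow> (f has_real_derivative deriv f x) (at x)"
  unfolding smooth_def differentiable_on_def
  by (metis DERIV_deriv_iff_real_differentiable UNIV_I funpow_0)

lemma smooth_deriv: "smooth f \<Longrightarrow> smooth (deriv f)"
  unfolding smooth_def by (metis comp_apply funpow_Suc_right)

text \<open>If the generators differentiate into the closure, the closure is stable under
  differentiation, so every iterated derivative stays inside and is differentiable.\<close>

lemma smooth_if_closed:
  assumes X: "\<And>f. f \<in> X \<Longrightarrow> \<exists>f'\<in>smooth_closure X. \<forall>x. (f has_real_derivative f' x) (at x)"
    and u: "u \<in> smooth_closure X"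
  shows "smooth u"
proof -
  have D: "\<exists>u'\<in>smooth_closure X. \<forall>x. (u has_real_derivative u' x) (at x)" if "u \<in> smooth_closure X" for u
    using that
  proof induction
    case (base f) then show ?case by (rule X)
  next
    case (const c) show ?case by (intro bexI[OF _ smooth_closure.const[of 0]]) auto
  next
    case ident show ?case by (intro bexI[OF _ smooth_closure.const[of 1]]) auto
  next
    case (smooth f) then show ?case using smooth_DERIV smooth_deriv smooth_closure.smooth by blast
  next
    case (add f g)
    then obtain f' g' where "f' \<in> smooth_closure X" "g' \<in> smooth_closure X"
      "\<forall>x. (f has_real_derivative f' x) (at x)" "\<forall>x. (g has_real_derivative g' x) (at x)" by blast
    then show ?case by (intro bexI[of _ "\<lambda>x. f' x + g' x"] smooth_closure.add) (auto intro: DERIV_add)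
  next
    case (mult f g)
    then obtain f' g' where "f' \<in> smooth_closure X" "g' \<in> smooth_closure X"
      "\<forall>x. (f has_real_derivative f' x) (at x)" "\<forall>x. (g has_real_derivative g' x) (at x)" by blast
    then show ?case using mult.hyps
      by (intro bexI[of _ "\<lambda>x. f' x * g x + g' x * f x"] smooth_closure.add smooth_closure.mult) (auto intro: DERIV_mult)
  next
    case (comp f g)
    then obtain g' where "g' \<in> smooth_closure X" "\<forall>x. (g has_real_derivative g' x) (at x)" by blast
    then show ?case using comp.hyps
      by (intro bexI[of _ "\<lambda>x. deriv f (g x) * g' x"] allI DERIV_chain2[OF smooth_DERIV]
          smooth_closure.mult smooth_closure.comp[OF smooth_deriv]) auto
  qed
  have "(deriv ^^ k) u \<in> smooth_closure X" for k
  proof (induction k)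
    case (Suc k)
    then obtain w where "w \<in> smooth_closure X" "\<forall>x. ((deriv ^^ k) u has_real_derivative w x) (at x)" using D by blast
    moreover from this(2) have "deriv ((deriv ^^ k) u) = w" by (intro ext DERIV_imp_deriv) auto
    ultimately show ?case by simp
  qed (use u in simp)
  then show ?thesis unfolding smooth_def differentiable_on_def
    by (metis D UNIV_I real_differentiable_def)
qed

lemma smooth_closure_empty: "u \<in> smooth_closure {} \<Longrightarrow> smooth u"
  by (rule smooth_if_closed) auto

lemma smooth_const [intro, simp]: "smooth (\<lambda>x. c)"
  by (rule smooth_closure_empty[OF smooth_closure.const])

lemma smooth_ident [intro, simp]: "smooth (\<lambda>x. x)"
  by (rule smooth_closure_empty[OF smooth_closure.ident])

lemma smooth_add [intro]: "smooth f \<Longrightarrow> smooth g \<Longrightarrow> smooth (\<lambda>x. f x + g x)"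
  by (rule smooth_closure_empty[OF smooth_closure.add]) (erule smooth_closure.smooth)+

lemma smooth_mult [intro]: "smooth f \<Longrightarrow> smooth g \<Longrightarrow> smooth (\<lambda>x. f x * g x)"
  by (rule smooth_closure_empty[OF smooth_closure.mult]) (erule smooth_closure.smooth)+

lemma smooth_compose: "smooth f \<Longrightarrow> smooth g \<Longrightarrow> smooth (\<lambda>x. f (g x))"
  by (rule smooth_closure_empty[OF smooth_closure.comp]) (assumption, erule smooth_closure.smooth)

lemma smooth_cmult: "smooth f \<Longrightarrow> smooth (\<lambda>x. c * f x)" by auto
lemma smooth_minus [intro]: "smooth f \<Longrightarrow> smooth (\<lambda>x. - f x)" using smooth_cmult[of f "-1"] by simp
lemma smooth_diff [intro]: "smooth f \<Longrightarrow> smooth g \<Longrightarrow> smooth (\<lambda>x. f x - g x)"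
  using smooth_add[of f "\<lambda>x. - g x"] by auto
lemma smooth_power [intro]: "smooth f \<Longrightarrow> smooth (\<lambda>x. f x ^ n)"
  by (induction n) auto

lemma smooth_antiderivative:
  assumes "\<And>x. (F has_real_derivative f x) (at x)" "smooth f" shows "smooth F"
  by (rule smooth_if_closed[where X = "{F}"]) (use assms smooth_closure.base smooth_closure.smooth in blast)+

text \<open>The derivative - d' (1 / d)^2 is again an expression in smooth functions and the
  generator 1 / d.\<close>

lemma smooth_inverse:
  assumes d: "smooth d" "\<And>x. d x \<noteq> 0" shows "smooth (\<lambda>x. inverse (d x))"
proof (rule smooth_if_closed[where X = "{\<lambda>x. inverse (d x)}"])
  let ?i = "\<lambda>x. inverse (d x)"
  let ?C = "smooth_closure {?i}"
  fix f assume "f \<in> {?i}"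
  moreover have "(\<lambda>x. (- deriv d x) * (inverse (d x) * inverse (d x))) \<in> ?C"
    by (rule smooth_closure.mult[OF smooth_closure.smooth[OF smooth_minus[OF smooth_deriv[OF d(1)]]]
          smooth_closure.mult[OF smooth_closure.base smooth_closure.base]]) simp_all
  moreover have "((\<lambda>x. inverse (d x)) has_real_derivative (- deriv d x) * (inverse (d x) * inverse (d x))) (at x)" for x
    using DERIV_inverse_fun[OF smooth_DERIV[OF d(1)] d(2), of x] by (simp add: power2_eq_square algebra_simps)
  ultimately show "\<exists>f'\<in>?C. \<forall>x. (f has_real_derivative f' x) (at x)"
    by (intro bexI[of _ "\<lambda>x. (- deriv d x) * (inverse (d x) * inverse (d x))"]) auto
qed (auto intro: smooth_closure.base)

lemma smooth_exp: "smooth exp"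
  by (rule smooth_if_closed[where X = "{exp}"]) (auto intro: smooth_closure.base bexI[of _ exp])

text \<open>The polynomial in 1 / x is a parameter because this family, unlike exp (-1 / x) alone,
  is stable under differentiation.\<close>

definition exp_recip :: "real poly \<Rightarrow> real \<Rightarrow> real" where
  "exp_recip p x = (if x > 0 then poly p (1 / x) * exp (- (1 / x)) else 0)"

lemma poly_times_exp_tendsto_0: "((\<lambda>x::real. poly p x * exp (- x)) \<longlongrightarrow> 0) at_top"
proof -
  have "((\<lambda>x::real. \<Sum>i\<le>degree p. coeff p i * (x ^ i / exp x)) \<longlongrightarrow> (\<Sum>i\<le>degree p. coeff p i * 0)) at_top"
    by (intro tendsto_intros tendsto_power_div_exp_0)
  then show ?thesis by (simp add: poly_altdef sum_distrib_right exp_minus divide_inverse mult.assoc)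
qed

text \<open>With t = 1 / x one has d/dx = - t^2 d/dt, which turns p into t^2 (p - p'). At 0 the
  exponential beats every polynomial.\<close>

lemma exp_recip_DERIV:
  "(exp_recip p has_real_derivative exp_recip (monom 1 2 * (p - pderiv p)) x) (at x)"
proof -
  consider "x > 0" | "x < 0" | "x = 0" by linarith
  then show ?thesis
  proof cases
    case 1
    have "((\<lambda>x. poly p (1 / x) * exp (- (1 / x))) has_real_derivative exp_recip (monom 1 2 * (p - pderiv p)) x) (at x)"
    proof -
      have i: "((\<lambda>x. 1 / x) has_real_derivative - (1 / x\<^sup>2)) (at x)"
        using 1 by (auto intro!: derivative_eq_intros simp: power2_eq_square)
      have "((\<lambda>x. poly p (1 / x) * exp (- (1 / x))) has_real_derivative
          poly (pderiv p) (1 / x) * - (1 / x\<^sup>2) * exp (- (1 / x)) + exp (- (1 / x)) * - (- (1 / x\<^sup>2)) * poly p (1 / x)) (at x)"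
        by (rule DERIV_mult DERIV_chain2[OF poly_DERIV i] DERIV_chain2[OF DERIV_exp] DERIV_minus i)+
      then show ?thesis
        by (rule DERIV_cong) (use 1 in \<open>simp add: exp_recip_def poly_monom power2_eq_square algebra_simps\<close>)
    qed
    then show ?thesis
      by (rule has_field_derivative_transform_within_open[where S = "{0<..}"]) (use 1 in \<open>auto simp: exp_recip_def\<close>)
  next
    case 2
    have "((\<lambda>x. 0) has_real_derivative exp_recip (monom 1 2 * (p - pderiv p)) x) (at x)"
      using 2 by (simp add: exp_recip_def)
    then show ?thesis
      by (rule has_field_derivative_transform_within_open[where S = "{..<0}"]) (use 2 in \<open>auto simp: exp_recip_def\<close>)
  next
    case 3
    have L: "((\<lambda>h. exp_recip p h / h) \<longlongrightarrow> 0) (at_left 0)"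
      by (rule tendsto_eventually) (auto simp: exp_recip_def eventually_at_filter)
    have "((\<lambda>h. poly (monom 1 1 * p) (inverse h) * exp (- inverse h)) \<longlongrightarrow> 0) (at_right 0)"
      by (rule filterlim_compose[OF poly_times_exp_tendsto_0 filterlim_inverse_at_top_right])
    then have R: "((\<lambda>h. exp_recip p h / h) \<longlongrightarrow> 0) (at_right 0)"
      by (rule Lim_transform_eventually)
        (auto simp: exp_recip_def eventually_at_filter poly_monom divide_inverse)
    have "((\<lambda>h. exp_recip p h / h) \<longlongrightarrow> 0) (at 0)" using L R by (rule filterlim_split_at)
    then show ?thesis unfolding 3 DERIV_def by (simp add: exp_recip_def)
  qed
qed

text \<open>The classical flat function exp (-1 / x) on the positive axis.\<close>

definition bump :: "real \<Rightarrow> real" where "bump = exp_recip 1"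

lemma smooth_bump: "smooth bump"
proof (rule smooth_if_closed[where X = "range exp_recip"])
  show "bump \<in> smooth_closure (range exp_recip)" by (auto simp: bump_def intro: smooth_closure.base)
  fix f assume "f \<in> range exp_recip"
  then obtain p where "f = exp_recip p" by blast
  then show "\<exists>f'\<in>smooth_closure (range exp_recip). \<forall>x. (f has_real_derivative f' x) (at x)"
    by (intro bexI[of _ "exp_recip (monom 1 2 * (p - pderiv p))"]) (auto intro: exp_recip_DERIV smooth_closure.base)
qed

lemma bump_pos: "x > 0 \<Longrightarrow> bump x > 0" and bump_zero: "x \<le> 0 \<Longrightarrow> bump x = 0" and bump_nonneg: "bump x \<ge> 0"
  by (auto simp: bump_def exp_recip_def)

text \<open>The usual smooth transition from 1 on x <= 1 to 0 on x >= 2; the two bumps never vanish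
  together.\<close>

definition step :: "real \<Rightarrow> real" where
  "step x = bump (2 - x) * inverse (bump (2 - x) + bump (x - 1))"

lemma step_denom: "bump (2 - x) + bump (x - 1) > 0"
  using bump_pos[of "2 - x"] bump_pos[of "x - 1"] bump_nonneg[of "2 - x"] bump_nonneg[of "x - 1"]
  by (cases "x < 2") auto

lemma smooth_step: "smooth step"
  unfolding step_def[abs_def]
proof (intro smooth_mult smooth_inverse smooth_add)
  show 1: "smooth (\<lambda>x. bump (2 - x))" by (rule smooth_compose[OF smooth_bump]) auto
  then show "smooth (\<lambda>x. bump (2 - x))" .
  show "smooth (\<lambda>x. bump (x - 1))" by (rule smooth_compose[OF smooth_bump]) auto
  show "bump (2 - x) + bump (x - 1) \<noteq> 0" for x using step_denom[of x] by simp
qed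

lemma step_bounds: "0 \<le> step x" "step x \<le> 1"
  using step_denom[of x] bump_nonneg[of "2 - x"] bump_nonneg[of "x - 1"]
  by (auto simp: step_def field_simps)

lemma step_one: "x \<le> 1 \<Longrightarrow> step x = 1" and step_zero: "x \<ge> 2 \<Longrightarrow> step x = 0"
  using step_denom[of x] by (auto simp: step_def bump_zero)

lemma smooth_continuous: "smooth f \<Longrightarrow> continuous_on A f"
  by (meson DERIV_continuous_on smooth_DERIV has_field_derivative_at_within)

lemma smooth_bounded_if_compact_support:
  assumes "smooth f" "\<And>x. x \<notin> {a..b} \<Longrightarrow> f x = 0"
  obtains B where "B > 0" "\<And>x. \<bar>f x\<bar> \<le> B"
proof -
  have "compact (f ` {a..b})" by (intro compact_continuous_image smooth_continuous assms) auto
  then have "bounded (f ` {a..b})" by (rule compact_imp_bounded)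
  then obtain B where B: "\<And>y. y \<in> f ` {a..b} \<Longrightarrow> \<bar>y\<bar> \<le> B"
    unfolding bounded_iff real_norm_def by blast
  show thesis
  proof (rule that[of "\<bar>B\<bar> + 1"])
    show "\<bar>f x\<bar> \<le> \<bar>B\<bar> + 1" for x
      using B[of "f x"] assms(2)[of x] by (cases "x \<in> {a..b}") auto
  qed simp
qed

lemma deriv_zero_outside:
  assumes "\<And>x. x \<notin> {a..b} \<Longrightarrow> f x = c" "x \<notin> {a..b}" shows "deriv f x = (0::real)"
proof -
  have "((\<lambda>x::real. c) has_real_derivative 0) (at x)" by simp
  then have "(f has_real_derivative 0) (at x)"
    by (rule has_field_derivative_transform_within_open[where S = "- {a..b}"]) (use assms in auto)
  then show ?thesis by (rule DERIV_imp_deriv)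
qed

text \<open>\<open>step\<close> is constant on either side of [1, 2], so both derivatives have
  compact support.\<close>

lemma step_deriv_bounds:
  obtains C where "C > 0" "\<And>x. \<bar>deriv step x\<bar> \<le> C" "\<And>x. \<bar>deriv (deriv step) x\<bar> \<le> C"
proof -
  have z: "deriv step x = 0" if "x \<notin> {1..2}" for x
  proof (cases "x < 1")
    case True
    have "((\<lambda>x::real. 1) has_real_derivative 0) (at x)" by simp
    then have "(step has_real_derivative 0) (at x)"
      by (rule has_field_derivative_transform_within_open[where S = "{..<1}"]) (use True step_one in auto)
    then show ?thesis by (rule DERIV_imp_deriv)
  next
    case False
    have "((\<lambda>x::real. 0) has_real_derivative 0) (at x)" by simp
    then have "(step has_real_derivative 0) (at x)"
      by (rule has_field_derivative_transform_within_open[where S = "{2<..}"]) (use False that step_zero in auto)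
    then show ?thesis by (rule DERIV_imp_deriv)
  qed
  obtain B1 where "B1 > 0" "\<And>x. \<bar>deriv step x\<bar> \<le> B1"
    using smooth_bounded_if_compact_support[OF smooth_deriv[OF smooth_step], of 1 2] z by blast
  moreover obtain B2 where "B2 > 0" "\<And>x. \<bar>deriv (deriv step) x\<bar> \<le> B2"
    using smooth_bounded_if_compact_support[OF smooth_deriv[OF smooth_deriv[OF smooth_step]], of 1 2]
      deriv_zero_outside[of 1 2 "deriv step" 0] z by blast
  ultimately show thesis by (intro that[of "max B1 B2"]) (auto simp: le_max_iff_disj)
qed

section \<open>Cutoffs on a logarithmic scale\<close>

lemma log_quad_bounds: "0 \<le> ln (1 + y\<^sup>2)" "ln (1 + y\<^sup>2) \<le> 2 * (1 + \<bar>y\<bar>)" for y :: real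
proof -
  show "0 \<le> ln (1 + y\<^sup>2)" by simp
  have "1 + y\<^sup>2 \<le> (1 + \<bar>y\<bar>)\<^sup>2" by (simp add: power2_sum)
  then have "ln (1 + y\<^sup>2) \<le> ln ((1 + \<bar>y\<bar>)\<^sup>2)" by (subst ln_le_cancel_iff) (auto intro: add_pos_nonneg)
  also have "\<dots> = 2 * ln (1 + \<bar>y\<bar>)" by (simp add: ln_realpow)
  also have "\<dots> \<le> 2 * (1 + \<bar>y\<bar>)" using ln_add_one_self_le_self[of "\<bar>y\<bar>"] by simp
  finally show "ln (1 + y\<^sup>2) \<le> 2 * (1 + \<bar>y\<bar>)" .
qed

text \<open>It is 1 while ln (1 + y^2) <= M and 0 once this logarithm reaches 2 M. On the
  logarithmic scale the slope is of order |y| / (M (1 + y^2)), so even the cubic \<open>U\<close>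
  times the slope is only of order y^2 / M.\<close>

definition cutoff :: "real \<Rightarrow> real \<Rightarrow> real" where
  "cutoff M y = step (ln (1 + y\<^sup>2) / M)"

lemma quad_pos: "1 + y\<^sup>2 > (0::real)" by (rule add_pos_nonneg) auto

lemma log_quad_DERIV: "((\<lambda>y::real. ln (1 + y\<^sup>2)) has_real_derivative 2 * y * inverse (1 + y\<^sup>2)) (at y)"
  using quad_pos[of y] by (auto intro!: derivative_eq_intros simp: divide_inverse)

lemma smooth_log_quad: "smooth (\<lambda>y. ln (1 + y\<^sup>2))"
  by (rule smooth_antiderivative[OF log_quad_DERIV])
    (intro smooth_mult smooth_inverse smooth_add smooth_power smooth_const smooth_ident quad_pos[THEN less_imp_neq, symmetric])

lemma smooth_cutoff: "smooth (cutoff M)"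
  unfolding cutoff_def[abs_def] divide_inverse
  by (rule smooth_compose[OF smooth_step]) (intro smooth_mult smooth_log_quad smooth_const)

lemma cutoff_bounds: "0 \<le> cutoff M y" "cutoff M y \<le> 1"
  by (auto simp: cutoff_def step_bounds)

lemma cutoff_one: "M > 0 \<Longrightarrow> ln (1 + y\<^sup>2) \<le> M \<Longrightarrow> cutoff M y = 1"
  by (simp add: cutoff_def step_one)

text \<open>A Markov-type bound: the left side is non-zero only where the logarithm exceeds M, and
  there its bound 2 (1 + |y|) makes the right side at least 1.\<close>

lemma one_minus_cutoff_le: "M > 0 \<Longrightarrow> 1 - cutoff M y \<le> 2 * (1 + \<bar>y\<bar>) / M"
proof (cases "ln (1 + y\<^sup>2) \<le> M")
  case False
  assume "M > 0"
  then have "1 \<le> 2 * (1 + \<bar>y\<bar>) / M" using False log_quad_bounds(2)[of y] by simp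
  then show ?thesis using cutoff_bounds(1)[of M y] by linarith
qed (simp add: cutoff_one)

lemma cutoff_zero: "M > 0 \<Longrightarrow> y \<notin> {- exp M..exp M} \<Longrightarrow> cutoff M y = 0"
proof -
  assume M: "M > 0" "y \<notin> {- exp M..exp M}"
  then have "exp M < \<bar>y\<bar>" by auto
  then have "(exp M)\<^sup>2 \<le> y\<^sup>2" by (metis abs_le_square_iff abs_of_pos exp_gt_zero less_imp_le)
  then have "exp (2 * M) \<le> 1 + y\<^sup>2" by (simp add: exp_double)
  then have "2 * M \<le> ln (1 + y\<^sup>2)" using quad_pos[of y] by (simp add: ln_ge_iff)
  then have "2 \<le> ln (1 + y\<^sup>2) / M" using M by (simp add: pos_le_divide_eq)
  then show "cutoff M y = 0" by (simp add: cutoff_def step_zero)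
qed

lemma cutoff_derivs:
  obtains C where "C > 0" "\<And>M y. M \<ge> 1 \<Longrightarrow> \<bar>deriv (cutoff M) y\<bar> \<le> C / M * (\<bar>y\<bar> / (1 + y\<^sup>2))"
    "\<And>M y. M \<ge> 1 \<Longrightarrow> \<bar>deriv (deriv (cutoff M)) y\<bar> \<le> C / M"
proof -
  obtain C where C: "C > 0" "\<And>x. \<bar>deriv step x\<bar> \<le> C" "\<And>x. \<bar>deriv (deriv step) x\<bar> \<le> C"
    using step_deriv_bounds by blast
  let ?L = "\<lambda>y::real. ln (1 + y\<^sup>2)" and ?L1 = "\<lambda>y::real. 2 * y / (1 + y\<^sup>2)"
    and ?L2 = "\<lambda>y::real. 2 * (1 - y\<^sup>2) / (1 + y\<^sup>2)\<^sup>2"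
  have L1: "(?L has_real_derivative ?L1 y) (at y)" for y using log_quad_DERIV[of y] by (simp add: divide_inverse)
  have L2: "(?L1 has_real_derivative ?L2 y) (at y)" for y
    using quad_pos[of y] by (auto intro!: derivative_eq_intros simp: power2_eq_square field_simps)
  have d1: "deriv (cutoff M) y = deriv step (?L y / M) * (?L1 y / M)" for M y
    unfolding cutoff_def[abs_def]
    by (rule DERIV_imp_deriv, rule DERIV_chain2[OF smooth_DERIV[OF smooth_step] DERIV_cdivide[OF L1]])
  have d2: "deriv (deriv (cutoff M)) y
      = deriv (deriv step) (?L y / M) * (?L1 y / M) * (?L1 y / M) + ?L2 y / M * deriv step (?L y / M)" for M y
    unfolding d1[abs_def]
    by (rule DERIV_imp_deriv, rule DERIV_mult[OF DERIV_chain2[OF smooth_DERIV[OF smooth_deriv[OF smooth_step]] DERIV_cdivide[OF L1]] DERIV_cdivide[OF L2]])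
  have b1: "\<bar>?L1 y\<bar> \<le> 1" for y
  proof -
    have "2 * \<bar>y\<bar> \<le> 1 + y\<^sup>2" using sum_squares_bound[of "\<bar>y\<bar>" 1] by simp
    then show ?thesis using quad_pos[of y] by (simp add: abs_mult field_simps)
  qed
  have b2: "\<bar>?L2 y\<bar> \<le> 2" for y
  proof -
    have "\<bar>1 - y\<^sup>2\<bar> \<le> 1 + y\<^sup>2" by (simp add: abs_le_iff)
    also have "\<dots> \<le> (1 + y\<^sup>2)\<^sup>2" using power_increasing[of 1 2 "1 + y\<^sup>2"] by simp
    finally show ?thesis using quad_pos[of y] by (simp add: abs_mult field_simps)
  qed
  show thesis
  \<comment> \<open>The first derivative costs 2 C / M, the second C / M + 2 C / M, as the logarithm
    has first and second derivatives bounded by 1 and 2.\<close>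
  proof (rule that[of "3 * C"])
    fix M y :: real assume M: "M \<ge> 1"
    have "\<bar>deriv (cutoff M) y\<bar> \<le> C * (2 * (\<bar>y\<bar> / (1 + y\<^sup>2)) / M)"
      unfolding d1 abs_mult using C M quad_pos[of y] by (intro mult_mono) (auto simp: abs_mult)
    also have "\<dots> \<le> 3 * C / M * (\<bar>y\<bar> / (1 + y\<^sup>2))"
    proof -
      have e: "C * (2 * z / M) \<le> 3 * C / M * z" if "0 \<le> z" for z
        using C M that by (simp add: divide_right_mono)
      show ?thesis by (rule e) (use quad_pos[of y] in simp)
    qed
    finally show "\<bar>deriv (cutoff M) y\<bar> \<le> 3 * C / M * (\<bar>y\<bar> / (1 + y\<^sup>2))" .
    have a: "\<bar>?L1 y / M\<bar> \<le> 1 / M" "\<bar>?L1 y / M\<bar> \<le> 1" "\<bar>?L2 y / M\<bar> \<le> 2 / M"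
    proof -
      have *: "\<bar>l / M\<bar> \<le> k / M" if "\<bar>l\<bar> \<le> k" for l k using M that by (simp add: divide_right_mono)
      show "\<bar>?L1 y / M\<bar> \<le> 1 / M" "\<bar>?L2 y / M\<bar> \<le> 2 / M" by (rule * b1 b2)+
      then show "\<bar>?L1 y / M\<bar> \<le> 1" using M by (smt (verit) divide_le_eq_1)
    qed
    have "\<bar>deriv (deriv (cutoff M)) y\<bar> \<le> C * 1 * (1 / M) + 2 / M * C"
      unfolding d2
      by (rule order_trans[OF abs_triangle_ineq], unfold abs_mult, intro add_mono mult_mono) (use C a M in \<open>auto simp: less_imp_le\<close>)
    then show "\<bar>deriv (deriv (cutoff M)) y\<bar> \<le> 3 * C / M" by (simp add: field_simps)
  qed (use C in auto)
qed

lemma test_fun_iff: "f \<in> test_fun \<longleftrightarrow> smooth f \<and> (\<exists>A. \<forall>x. x \<notin> {- A..A} \<longrightarrow> f x = 0)"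
proof
  assume "f \<in> test_fun"
  then obtain K where K: "compact K" "f \<in> test_fun_on K" by (auto simp: test_fun_def)
  obtain A where "\<And>x. x \<in> K \<Longrightarrow> \<bar>x\<bar> \<le> A" using compact_imp_bounded[OF K(1)] by (auto simp: bounded_iff)
  then have "x \<notin> K" if "x \<notin> {- A..A}" for x using that abs_le_iff by fastforce
  then show "smooth f \<and> (\<exists>A. \<forall>x. x \<notin> {- A..A} \<longrightarrow> f x = 0)"
    using K(2) unfolding test_fun_on_def smooth_def by blast
next
  assume "smooth f \<and> (\<exists>A. \<forall>x. x \<notin> {- A..A} \<longrightarrow> f x = 0)"
  then obtain A where "smooth f" "\<forall>x. x \<notin> {- A..A} \<longrightarrow> f x = 0" by blast
  then show "f \<in> test_fun"
    unfolding test_fun_def test_fun_on_def smooth_def by (intro UN_I[of "{- A..A}"]) auto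
qed

lemma test_fun_on_iff: "f \<in> test_fun_on K \<longleftrightarrow> smooth f \<and> (\<forall>x. x \<notin> K \<longrightarrow> f x = 0)"
  by (simp add: test_fun_on_def smooth_def)

lemma test_fun_mult: "smooth g \<Longrightarrow> f \<in> test_fun \<Longrightarrow> (\<lambda>x. g x * f x) \<in> test_fun"
  unfolding test_fun_iff by (auto 0 3)

lemma test_fun_deriv: "f \<in> test_fun \<Longrightarrow> deriv f \<in> test_fun"
  unfolding test_fun_iff using deriv_zero_outside smooth_deriv by metis

lemma test_fun_bounded: assumes "f \<in> test_fun" obtains B where "B > 0" "\<And>x. \<bar>f x\<bar> \<le> B"
  using assms smooth_bounded_if_compact_support unfolding test_fun_iff by metis

lemma test_fun_smooth: "f \<in> test_fun \<Longrightarrow> smooth f" by (simp add: test_fun_iff)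

section \<open>Tilted Gaussian weights\<close>

text \<open>The unnormalised equilibrium density in reduced parameters; b = 0 is the Gaussian around
  which the expansion in h is made.\<close>

definition wt :: "real \<Rightarrow> real \<Rightarrow> real \<Rightarrow> real \<Rightarrow> real" where
  "wt s b \<xi> y = exp (- ((y - \<xi>)\<^sup>2 / (2 * s)) - b * V y)"

text \<open>A class closed under algebraic operations, containing polynomials, indicators,
  exponentials and test functions, and integrable against every weight; it settles all integrability
  side conditions.\<close>

definition exp_growth :: "(real \<Rightarrow> real) \<Rightarrow> bool" where
  "exp_growth f \<longleftrightarrow> f \<in> borel_measurable borel \<and> (\<exists>C a. \<forall>y. \<bar>f y\<bar> \<le> C * exp (a * \<bar>y\<bar>))"

lemma exp_growthE:
  assumes "exp_growth f"
  obtains C a where "C > 0" "a > 0" "\<And>y. \<bar>f y\<bar> \<le> C * exp (a * \<bar>y\<bar>)"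
proof -
  obtain C a where *: "\<And>y. \<bar>f y\<bar> \<le> C * exp (a * \<bar>y\<bar>)" using assms by (auto simp: exp_growth_def)
  show thesis
  proof (rule that[of "\<bar>C\<bar> + 1" "\<bar>a\<bar> + 1"])
    fix y
    have "C * exp (a * \<bar>y\<bar>) \<le> (\<bar>C\<bar> + 1) * exp ((\<bar>a\<bar> + 1) * \<bar>y\<bar>)"
      by (rule mult_mono) (auto intro!: mult_right_mono)
    then show "\<bar>f y\<bar> \<le> (\<bar>C\<bar> + 1) * exp ((\<bar>a\<bar> + 1) * \<bar>y\<bar>)" using *[of y] by linarith
  qed auto
qed

lemma exp_growthI: "f \<in> borel_measurable borel \<Longrightarrow> (\<And>y. \<bar>f y\<bar> \<le> C * exp (a * \<bar>y\<bar>)) \<Longrightarrow> exp_growth f"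
  by (auto simp: exp_growth_def)

lemma exp_growth_measurable [measurable_dest]: "exp_growth f \<Longrightarrow> f \<in> borel_measurable borel"
  by (simp add: exp_growth_def)

lemma exp_growth_bounded: "f \<in> borel_measurable borel \<Longrightarrow> (\<And>y. \<bar>f y\<bar> \<le> B) \<Longrightarrow> exp_growth f"
  by (rule exp_growthI[of f B 0]) auto

lemma exp_growth_const [intro, simp]: "exp_growth (\<lambda>y. c)"
  by (rule exp_growth_bounded[of _ "\<bar>c\<bar>"]) auto

lemma exp_growth_exp [intro, simp]: "exp_growth (\<lambda>y. exp (c * y))"
proof (rule exp_growthI[of _ 1 "\<bar>c\<bar>"])
  show "\<bar>exp (c * y)\<bar> \<le> 1 * exp (\<bar>c\<bar> * \<bar>y\<bar>)" for y using abs_ge_self[of "c * y"] by (simp add: abs_mult)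
qed measurable

lemma exp_growth_exp_abs [intro, simp]: "exp_growth (\<lambda>y. exp (c * \<bar>y\<bar>))"
  by (rule exp_growthI[of _ 1 c]) auto

lemma exp_growth_ident [intro, simp]: "exp_growth (\<lambda>y. y)"
proof (rule exp_growthI[of _ 1 1])
  have "z \<le> exp z" for z :: real using exp_ge_add_one_self[of z] by linarith
  then show "\<bar>y\<bar> \<le> 1 * exp (1 * \<bar>y\<bar>)" for y :: real by simp
qed measurable

lemma exp_growth_add [intro]:
  assumes "exp_growth f" "exp_growth g" shows "exp_growth (\<lambda>y. f y + g y)"
proof -
  obtain C a where f: "C > 0" "a > 0" "\<And>y. \<bar>f y\<bar> \<le> C * exp (a * \<bar>y\<bar>)" using exp_growthE[OF assms(1)] by blast
  obtain D c where g: "D > 0" "c > 0" "\<And>y. \<bar>g y\<bar> \<le> D * exp (c * \<bar>y\<bar>)" using exp_growthE[OF assms(2)] by blast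
  show ?thesis
  proof (rule exp_growthI[of _ "C + D" "a + c"])
    fix y :: real
    have "C * exp (a * \<bar>y\<bar>) \<le> C * exp ((a + c) * \<bar>y\<bar>)" "D * exp (c * \<bar>y\<bar>) \<le> D * exp ((a + c) * \<bar>y\<bar>)"
      using f g by (auto intro!: mult_left_mono mult_right_mono)
    then have "\<bar>f y\<bar> + \<bar>g y\<bar> \<le> C * exp ((a + c) * \<bar>y\<bar>) + D * exp ((a + c) * \<bar>y\<bar>)"
      by (intro add_mono order_trans[OF f(3)] order_trans[OF g(3)])
    then show "\<bar>f y + g y\<bar> \<le> (C + D) * exp ((a + c) * \<bar>y\<bar>)"
      unfolding distrib_right by (rule order_trans[OF abs_triangle_ineq])
  qed (use assms in measurable)
qed

lemma exp_growth_mult [intro]: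
  assumes "exp_growth f" "exp_growth g" shows "exp_growth (\<lambda>y. f y * g y)"
proof -
  obtain C a where f: "C > 0" "a > 0" "\<And>y. \<bar>f y\<bar> \<le> C * exp (a * \<bar>y\<bar>)" using exp_growthE[OF assms(1)] by blast
  obtain D c where g: "D > 0" "c > 0" "\<And>y. \<bar>g y\<bar> \<le> D * exp (c * \<bar>y\<bar>)" using exp_growthE[OF assms(2)] by blast
  show ?thesis
  proof (rule exp_growthI[of _ "C * D" "a + c"])
    fix y :: real
    have "\<bar>f y\<bar> * \<bar>g y\<bar> \<le> (C * exp (a * \<bar>y\<bar>)) * (D * exp (c * \<bar>y\<bar>))"
      using f g by (intro mult_mono) (auto simp: less_imp_le)
    then show "\<bar>f y * g y\<bar> \<le> C * D * exp ((a + c) * \<bar>y\<bar>)"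
      by (simp add: abs_mult algebra_simps exp_add)
  qed (use assms in measurable)
qed

lemma exp_growth_minus [intro]: "exp_growth f \<Longrightarrow> exp_growth (\<lambda>y. - f y)"
  using exp_growth_mult[OF exp_growth_const[of "-1"], of f] by simp
lemma exp_growth_diff [intro]: "exp_growth f \<Longrightarrow> exp_growth g \<Longrightarrow> exp_growth (\<lambda>y. f y - g y)"
  using exp_growth_add[OF _ exp_growth_minus, of f g] by simp
lemma exp_growth_divide [intro]: "exp_growth f \<Longrightarrow> exp_growth (\<lambda>y. f y / c)"
  using exp_growth_mult[OF _ exp_growth_const[of "1 / c"], of f] by simp
lemma exp_growth_power [intro]: "exp_growth f \<Longrightarrow> exp_growth (\<lambda>y. f y ^ n)"
  by (induction n) auto
lemma exp_growth_abs [intro]: "exp_growth f \<Longrightarrow> exp_growth (\<lambda>y. \<bar>f y\<bar>)"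
  unfolding exp_growth_def by auto
lemma exp_growth_indicator [intro]: "A \<in> sets borel \<Longrightarrow> exp_growth (indicator A)"
  by (rule exp_growth_bounded[of _ 1]) (auto simp: indicator_def)
lemmas exp_growth_intros = exp_growth_const exp_growth_ident exp_growth_add exp_growth_diff exp_growth_minus
  exp_growth_mult exp_growth_divide exp_growth_power exp_growth_abs exp_growth_exp

lemma exp_growth_U [intro, simp]: "exp_growth U"
  unfolding U_def[abs_def] by (intro exp_growth_intros)
lemma exp_growth_V [intro, simp]: "exp_growth V"
  unfolding V_def[abs_def] by (intro exp_growth_intros)

section \<open>Bounds on the weights, uniform in b and in bounded \<xi>\<close>

lemma V_ge: "V y \<ge> - (1 / 4)"
proof -
  have "V y = (y\<^sup>2 - 1)\<^sup>2 / 4 - 1 / 4" by (simp add: V_def power2_eq_square power4_eq_xxxx algebra_simps)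
  then show ?thesis by simp
qed

lemma V_nonpos: "\<bar>y\<bar> \<le> 1 \<Longrightarrow> V y \<le> 0"
proof -
  assume "\<bar>y\<bar> \<le> 1"
  then have "y\<^sup>2 - 2 \<le> 0" using abs_square_le_1[of y] by linarith
  then have "y\<^sup>2 * (y\<^sup>2 - 2) \<le> 0" by (intro mult_nonneg_nonpos) auto
  moreover have "V y = y\<^sup>2 * (y\<^sup>2 - 2) / 4" by (simp add: V_def power2_eq_square power4_eq_xxxx algebra_simps)
  ultimately show ?thesis by linarith
qed

lemma wt_pos: "wt s b \<xi> y > 0" by (simp add: wt_def)

lemma wt_continuous: "continuous_on A (wt s b \<xi>)"
  unfolding wt_def[abs_def] V_def divide_inverse by (intro continuous_intros)

lemma wt_measurable [measurable]: "wt s b \<xi> \<in> borel_measurable borel"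
  by (rule borel_measurable_continuous_onI[OF wt_continuous])

text \<open>From (y - \<xi>)^2 >= y^2 / 2 - \<xi>^2, and from V >= -1/4 with b <= 1. One centred
  Gaussian dominates all weights with bounded \<xi>.\<close>

lemma wt_le:
  assumes "s > 0" "0 \<le> b" "b \<le> 1"
  shows "wt s b \<xi> y \<le> exp (1 / 4 + \<xi>\<^sup>2 / (2 * s)) * exp (- (y\<^sup>2 / (4 * s)))"
proof -
  have "y\<^sup>2 / 2 - \<xi>\<^sup>2 \<le> (y - \<xi>)\<^sup>2" using zero_le_power2[of "y - 2 * \<xi>"]
    by (simp add: power2_eq_square algebra_simps)
  then have "(y\<^sup>2 / 2 - \<xi>\<^sup>2) / (2 * s) \<le> (y - \<xi>)\<^sup>2 / (2 * s)"
    using assms(1) by (intro divide_right_mono) auto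
  moreover have "(y\<^sup>2 / 2 - \<xi>\<^sup>2) / (2 * s) = y\<^sup>2 / (4 * s) - \<xi>\<^sup>2 / (2 * s)"
    using assms(1) by (simp add: field_simps)
  moreover have "b * (- (1 / 4)) \<le> b * V y" using assms V_ge by (intro mult_left_mono) auto
  ultimately show ?thesis unfolding wt_def exp_add[symmetric] using assms by simp
qed

lemma gauss_exp_integrable:
  assumes s: "s > 0" shows "integrable lborel (\<lambda>y. exp (a * \<bar>y\<bar>) * exp (- (y\<^sup>2 / (4 * s))) :: real)"
proof -
  have i: "integrable lborel (\<lambda>y. exp (a * y) * exp (- (y\<^sup>2 / (4 * s))))" for a :: real
  proof -
    \<comment> \<open>Completing the square in a y - y^2 / (4 s) gives a normal density of mean 2 a
      s and variance 2 s.\<close>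
    have "integrable lborel (\<lambda>y. exp (a\<^sup>2 * s) * sqrt (4 * pi * s) * normal_density (2 * a * s) (sqrt (2 * s)) y)"
      using normal_moment_even[of "sqrt (2 * s)" "2 * a * s" 0] s by (intro integrable_mult_right) (auto simp: has_bochner_integral_iff)
    moreover have "exp (a\<^sup>2 * s) * sqrt (4 * pi * s) * normal_density (2 * a * s) (sqrt (2 * s)) y = exp (a * y) * exp (- (y\<^sup>2 / (4 * s)))" for y
    proof -
      have D: "sqrt (4 * pi * s) * (1 / sqrt (2 * pi * (sqrt (2 * s))\<^sup>2)) = 1" using s by (simp add: mult.assoc)
      have "a\<^sup>2 * s + - (y - 2 * a * s)\<^sup>2 / (2 * (2 * s)) = a * y - y\<^sup>2 / (4 * s)"
        using s by (simp add: field_simps power2_eq_square)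
      then have "exp (a\<^sup>2 * s) * exp (- (y - 2 * a * s)\<^sup>2 / (2 * (sqrt (2 * s))\<^sup>2)) = exp (a * y) * exp (- (y\<^sup>2 / (4 * s)))"
        using s by (simp add: exp_add[symmetric])
      moreover have "exp (a\<^sup>2 * s) * sqrt (4 * pi * s) * normal_density (2 * a * s) (sqrt (2 * s)) y
          = (sqrt (4 * pi * s) * (1 / sqrt (2 * pi * (sqrt (2 * s))\<^sup>2))) *
            (exp (a\<^sup>2 * s) * exp (- (y - 2 * a * s)\<^sup>2 / (2 * (sqrt (2 * s))\<^sup>2)))"
        by (simp add: normal_density_def)
      ultimately show ?thesis unfolding D by simp
    qed
    ultimately show ?thesis by simp
  qed
  show ?thesis
  proof (rule Bochner_Integration.integrable_bound[OF Bochner_Integration.integrable_add[OF i[of a] i[of "-a"]]])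
    show "AE y in lborel. norm (exp (a * \<bar>y\<bar>) * exp (- (y\<^sup>2 / (4 * s)))) \<le> norm (exp (a * y) * exp (- (y\<^sup>2 / (4 * s))) + exp (- a * y) * exp (- (y\<^sup>2 / (4 * s))))"
    proof (rule AE_I2)
      fix y
      have "exp (a * \<bar>y\<bar>) \<le> exp (a * y) + exp (- a * y)" by (cases "y \<ge> 0") (auto simp: add_increasing add_increasing2)
      then have "exp (a * \<bar>y\<bar>) * exp (- (y\<^sup>2 / (4 * s))) \<le> (exp (a * y) + exp (- a * y)) * exp (- (y\<^sup>2 / (4 * s)))"
        by (rule mult_right_mono) simp
      then show "norm (exp (a * \<bar>y\<bar>) * exp (- (y\<^sup>2 / (4 * s)))) \<le> norm (exp (a * y) * exp (- (y\<^sup>2 / (4 * s))) + exp (- a * y) * exp (- (y\<^sup>2 / (4 * s))))"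
        by (simp only: real_norm_def abs_of_nonneg add_nonneg_nonneg mult_nonneg_nonneg exp_ge_zero distrib_right)
    qed
  qed measurable
qed

definition mom :: "real \<Rightarrow> real \<Rightarrow> (real \<Rightarrow> real) \<Rightarrow> real \<Rightarrow> real" where
  "mom s b f \<xi> = (LINT y|lborel. f y * wt s b \<xi> y)"

definition avg :: "real \<Rightarrow> real \<Rightarrow> (real \<Rightarrow> real) \<Rightarrow> real \<Rightarrow> real" where
  "avg s b f \<xi> = mom s b f \<xi> / mom s b (\<lambda>_. 1) \<xi>"

context
  fixes s :: real assumes s: "s > 0"
begin

lemma exp_growth_integrable_gauss: "exp_growth f \<Longrightarrow> integrable lborel (\<lambda>y. f y * exp (- (y\<^sup>2 / (4 * s))))"
proof -
  assume f: "exp_growth f"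
  obtain C a where *: "\<And>y. \<bar>f y\<bar> \<le> C * exp (a * \<bar>y\<bar>)" using exp_growthE[OF f] by metis
  show ?thesis
  proof (rule Bochner_Integration.integrable_bound[OF integrable_mult_right[OF gauss_exp_integrable[OF s]]])
    show "AE y in lborel. norm (f y * exp (- (y\<^sup>2 / (4 * s)))) \<le> norm (C * (exp (a * \<bar>y\<bar>) * exp (- (y\<^sup>2 / (4 * s)))))"
    proof (rule AE_I2)
      fix y
      have "\<bar>f y\<bar> \<le> \<bar>C\<bar> * exp (a * \<bar>y\<bar>)" using *[of y] abs_ge_self[of C] by (meson exp_ge_zero mult_right_mono order_trans)
      then show "norm (f y * exp (- (y\<^sup>2 / (4 * s)))) \<le> norm (C * (exp (a * \<bar>y\<bar>) * exp (- (y\<^sup>2 / (4 * s)))))"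
        by (simp add: abs_mult)
    qed
  qed (use f in measurable)
qed

lemma exp_growth_integrable:
  assumes f: "exp_growth f" and b: "0 \<le> b" "b \<le> 1"
  shows "integrable lborel (\<lambda>y. f y * wt s b \<xi> y)"
proof (rule Bochner_Integration.integrable_bound[OF integrable_mult_right[OF exp_growth_integrable_gauss[OF exp_growth_abs[OF f]]]])
  let ?K = "exp (1 / 4 + \<xi>\<^sup>2 / (2 * s))"
  show "AE y in lborel. norm (f y * wt s b \<xi> y) \<le> norm (?K * (\<bar>f y\<bar> * exp (- (y\<^sup>2 / (4 * s)))))"
  proof (rule AE_I2)
    fix y
    have "\<bar>f y\<bar> * wt s b \<xi> y \<le> \<bar>f y\<bar> * (?K * exp (- (y\<^sup>2 / (4 * s))))" by (intro mult_left_mono wt_le s b) auto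
    then show "norm (f y * wt s b \<xi> y) \<le> norm (?K * (\<bar>f y\<bar> * exp (- (y\<^sup>2 / (4 * s)))))"
      using wt_pos[of s b \<xi> y] by (simp add: abs_mult algebra_simps)
  qed
qed (use f in measurable)

context
  fixes b :: real assumes b: "0 \<le> b" "b \<le> 1"
begin

lemma weighted_integrable: "exp_growth f \<Longrightarrow> integrable lborel (\<lambda>y. f y * wt s b \<xi> y)"
  by (rule exp_growth_integrable[OF _ b])

lemma mom_add: "exp_growth f \<Longrightarrow> exp_growth g \<Longrightarrow> mom s b (\<lambda>y. f y + g y) \<xi> = mom s b f \<xi> + mom s b g \<xi>"
  unfolding mom_def distrib_right by (intro Bochner_Integration.integral_add weighted_integrable)

lemma mom_diff: "exp_growth f \<Longrightarrow> exp_growth g \<Longrightarrow> mom s b (\<lambda>y. f y - g y) \<xi> = mom s b f \<xi> - mom s b g \<xi>"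
  unfolding mom_def left_diff_distrib by (intro Bochner_Integration.integral_diff weighted_integrable)

lemma mom_cmult: "mom s b (\<lambda>y. c * f y) \<xi> = c * mom s b f \<xi>"
  unfolding mom_def by (simp add: mult.assoc)

lemma mom_mono: "exp_growth f \<Longrightarrow> exp_growth g \<Longrightarrow> (\<And>y. f y \<le> g y) \<Longrightarrow> mom s b f \<xi> \<le> mom s b g \<xi>"
  unfolding mom_def by (intro integral_mono weighted_integrable) (auto intro!: mult_right_mono less_imp_le[OF wt_pos])

lemma mom_nonneg: "(\<And>y. 0 \<le> f y) \<Longrightarrow> 0 \<le> mom s b f \<xi>"
  unfolding mom_def by (intro integral_nonneg_AE AE_I2) (auto intro!: mult_nonneg_nonneg less_imp_le[OF wt_pos])

lemma mom_abs_le: "exp_growth f \<Longrightarrow> \<bar>mom s b f \<xi>\<bar> \<le> mom s b (\<lambda>y. \<bar>f y\<bar>) \<xi>"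
  unfolding mom_def using wt_pos[of s b \<xi>] integral_norm_bound[of lborel "\<lambda>y. f y * wt s b \<xi> y"]
  by (simp add: abs_mult less_imp_le)

lemma mom_abs_le_gauss:
  assumes "exp_growth f" "\<bar>\<xi>\<bar> \<le> R"
  shows "mom s b (\<lambda>y. \<bar>f y\<bar>) \<xi> \<le> exp (1 / 4 + R\<^sup>2 / (2 * s)) * (LINT y|lborel. \<bar>f y\<bar> * exp (- (y\<^sup>2 / (4 * s))))"
  unfolding mom_def integral_mult_right_zero[symmetric]
proof (intro integral_mono weighted_integrable integrable_mult_right exp_growth_integrable_gauss exp_growth_abs assms)
  fix y
  have "\<xi>\<^sup>2 / (2 * s) \<le> R\<^sup>2 / (2 * s)" using s assms(2) abs_le_square_iff[of \<xi> R] by (intro divide_right_mono) auto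
  then have "wt s b \<xi> y \<le> exp (1 / 4 + R\<^sup>2 / (2 * s)) * exp (- (y\<^sup>2 / (4 * s)))"
    using wt_le[OF s b, of \<xi> y] by (smt (verit) exp_ge_zero exp_le_cancel_iff mult_right_mono)
  then show "\<bar>f y\<bar> * wt s b \<xi> y \<le> exp (1 / 4 + R\<^sup>2 / (2 * s)) * (\<bar>f y\<bar> * exp (- (y\<^sup>2 / (4 * s))))"
    using mult_left_mono[of "wt s b \<xi> y" "exp (1 / 4 + R\<^sup>2 / (2 * s)) * exp (- (y\<^sup>2 / (4 * s)))" "\<bar>f y\<bar>"]
    by (simp add: mult.left_commute)
qed

text \<open>On [-1, 1], an interval of length 2, \<open>V\<close> is not positive and |y - \<xi>| is
  at most 1 + R.\<close>

lemma mom_one_ge: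
  assumes "\<bar>\<xi>\<bar> \<le> R" shows "2 * exp (- ((1 + R)\<^sup>2 / (2 * s))) \<le> mom s b (\<lambda>_. 1) \<xi>"
proof -
  have "2 * exp (- ((1 + R)\<^sup>2 / (2 * s))) = (LINT y|lborel. indicator {-1..1::real} y * exp (- ((1 + R)\<^sup>2 / (2 * s))))"
    by simp
  also have "\<dots> \<le> (LINT y|lborel. 1 * wt s b \<xi> y)"
  proof (rule integral_mono)
    show "integrable lborel (\<lambda>y. indicator {-1..1::real} y * exp (- ((1 + R)\<^sup>2 / (2 * s))))" by simp
    show "integrable lborel (\<lambda>y. 1 * wt s b \<xi> y)" by (intro weighted_integrable) auto
    fix y :: real
    show "indicator {-1..1} y * exp (- ((1 + R)\<^sup>2 / (2 * s))) \<le> 1 * wt s b \<xi> y"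
    proof (cases "y \<in> {-1..1}")
      case True
      then have "\<bar>y - \<xi>\<bar> \<le> 1 + R" using assms by auto
      then have "(y - \<xi>)\<^sup>2 / (2 * s) \<le> (1 + R)\<^sup>2 / (2 * s)"
        using s abs_le_square_iff[of "y - \<xi>" "1 + R"] by (intro divide_right_mono) auto
      moreover have "V y \<le> 0" using True by (intro V_nonpos) auto
      then have "b * V y \<le> 0" using b by (simp add: mult_nonneg_nonpos)
      ultimately show ?thesis using True by (simp add: wt_def)
    qed (simp add: wt_pos less_imp_le)
  qed
  finally show ?thesis by (simp add: mom_def)
qed

lemma mom_one_pos: "mom s b (\<lambda>_. 1) \<xi> > 0"
  using mom_one_ge[of \<xi> "\<bar>\<xi>\<bar>"] by (smt (verit) exp_gt_zero)

lemma avg_add: "exp_growth f \<Longrightarrow> exp_growth g \<Longrightarrow> avg s b (\<lambda>y. f y + g y) \<xi> = avg s b f \<xi> + avg s b g \<xi>"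
  by (simp add: avg_def mom_add add_divide_distrib)
lemma avg_diff: "exp_growth f \<Longrightarrow> exp_growth g \<Longrightarrow> avg s b (\<lambda>y. f y - g y) \<xi> = avg s b f \<xi> - avg s b g \<xi>"
  by (simp add: avg_def mom_diff diff_divide_distrib)
lemma avg_cmult: "avg s b (\<lambda>y. c * f y) \<xi> = c * avg s b f \<xi>"
  by (simp add: avg_def mom_cmult)
lemma avg_const: "avg s b (\<lambda>y. c) \<xi> = c"
  using avg_cmult[of c "\<lambda>_. 1" \<xi>] mom_one_pos[of \<xi>] by (simp add: avg_def)
lemma avg_mono: "exp_growth f \<Longrightarrow> exp_growth g \<Longrightarrow> (\<And>y. f y \<le> g y) \<Longrightarrow> avg s b f \<xi> \<le> avg s b g \<xi>"
  using mom_one_pos[of \<xi>] by (simp add: avg_def divide_right_mono mom_mono)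
lemma avg_nonneg: "(\<And>y. 0 \<le> f y) \<Longrightarrow> 0 \<le> avg s b f \<xi>"
  using mom_one_pos[of \<xi>] mom_nonneg[of f \<xi>] by (simp add: avg_def)
lemma avg_abs_le: "exp_growth f \<Longrightarrow> \<bar>avg s b f \<xi>\<bar> \<le> avg s b (\<lambda>y. \<bar>f y\<bar>) \<xi>"
  using mom_one_pos[of \<xi>] mom_abs_le[of f \<xi>] by (simp add: avg_def divide_right_mono)

end

text \<open>Gaussian domination above and \<open>mom_one_ge\<close> below. K precedes b and \<xi> in
  the quantifiers: it is the source of the constants that must not depend on h.\<close>

lemma avg_bounded:
  assumes f: "exp_growth f"
  obtains K where "K > 0" "\<And>b \<xi>. 0 \<le> b \<Longrightarrow> b \<le> 1 \<Longrightarrow> \<bar>\<xi>\<bar> \<le> R \<Longrightarrow> avg s b (\<lambda>y. \<bar>f y\<bar>) \<xi> \<le> K"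
proof -
  define A where "A = exp (1 / 4 + R\<^sup>2 / (2 * s)) * (LINT y|lborel. \<bar>f y\<bar> * exp (- (y\<^sup>2 / (4 * s))))"
  define B where "B = 2 * exp (- ((1 + R)\<^sup>2 / (2 * s)))"
  have B: "B > 0" by (simp add: B_def)
  have A: "A \<ge> 0" unfolding A_def by (intro mult_nonneg_nonneg integral_nonneg_AE AE_I2) auto
  show thesis
  proof (rule that[of "A / B + 1"])
    show "A / B + 1 > 0" using A B by (intro add_nonneg_pos) auto
    fix b \<xi> :: real assume b: "0 \<le> b" "b \<le> 1" "\<bar>\<xi>\<bar> \<le> R"
    have "mom s b (\<lambda>y. \<bar>f y\<bar>) \<xi> \<le> A" unfolding A_def by (rule mom_abs_le_gauss[OF b(1,2) f b(3)])
    moreover have "B \<le> mom s b (\<lambda>_. 1) \<xi>" unfolding B_def by (rule mom_one_ge[OF b])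
    ultimately have "mom s b (\<lambda>y. \<bar>f y\<bar>) \<xi> / mom s b (\<lambda>_. 1) \<xi> \<le> A / B"
      using A B by (intro frac_le) auto
    then show "avg s b (\<lambda>y. \<bar>f y\<bar>) \<xi> \<le> A / B + 1" by (simp add: avg_def)
  qed
qed

end

text \<open>Only the inequality 1 + z <= exp z is used, at z and at -z; the maximum treats both
  signs of z at once.\<close>

lemma exp_second_order: "\<bar>exp z - 1 - z\<bar> \<le> z\<^sup>2 * max 1 (exp z)" for z :: real
proof -
  have 0: "0 \<le> exp z - 1 - z" using exp_ge_add_one_self[of z] by linarith
  have "(1 - z) * exp z \<le> exp (- z) * exp z" using exp_ge_add_one_self[of "- z"] by (intro mult_right_mono) auto
  then have 1: "exp z - 1 \<le> z * exp z" by (simp add: exp_minus algebra_simps)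
  have "exp z - 1 - z \<le> z * (exp z - 1)" using 1 by (simp add: algebra_simps)
  also have "\<dots> \<le> z\<^sup>2 * max 1 (exp z)"
  proof (cases "z \<ge> 0")
    case True
    have "z * (exp z - 1) \<le> z * (z * exp z)" using 1 True by (intro mult_left_mono) auto
    then show ?thesis using True by (simp add: power2_eq_square max_def mult.assoc)
  next
    case False
    have "- z * (1 - exp z) \<le> - z * (- z)" using False exp_ge_add_one_self[of z] by (intro mult_left_mono) linarith+
    then show ?thesis using False by (simp add: power2_eq_square max_def algebra_simps)
  qed
  finally show ?thesis using 0 by simp
qed

text \<open>A route to differentiation under the integral sign: the required remainder is what
  \<open>exp_second_order\<close> gives after integration.\<close>

lemma DERIV_if_quadratic_remainder:
  fixes F :: "real \<Rightarrow> real"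
  assumes "\<And>\<eta>. \<bar>\<eta>\<bar> \<le> 1 \<Longrightarrow> \<bar>F (x + \<eta>) - F x - \<eta> * D\<bar> \<le> K * \<eta>\<^sup>2"
  shows "(F has_real_derivative D) (at x)"
  unfolding DERIV_def LIM_def
proof (intro allI impI)
  fix e :: real assume e: "e > 0"
  show "\<exists>d>0. \<forall>h. h \<noteq> 0 \<and> dist h 0 < d \<longrightarrow> dist ((F (x + h) - F x) / h) D < e"
  proof (intro exI[of _ "min 1 (e / (\<bar>K\<bar> + 1))"] conjI allI impI)
    fix h :: real assume h: "h \<noteq> 0 \<and> dist h 0 < min 1 (e / (\<bar>K\<bar> + 1))"
    then have "\<bar>h\<bar> \<le> 1" "\<bar>h\<bar> * (\<bar>K\<bar> + 1) < e" by (auto simp: pos_less_divide_eq)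
    have "\<bar>(F (x + h) - F x) / h - D\<bar> = \<bar>F (x + h) - F x - h * D\<bar> / \<bar>h\<bar>"
      using h by (simp add: abs_divide[symmetric] diff_divide_distrib)
    also have "\<dots> \<le> K * h\<^sup>2 / \<bar>h\<bar>" using assms[OF \<open>\<bar>h\<bar> \<le> 1\<close>] by (intro divide_right_mono) auto
    also have "\<dots> = \<bar>h\<bar> * K" using h by (simp add: power2_eq_square abs_if)
    also have "\<dots> \<le> \<bar>h\<bar> * (\<bar>K\<bar> + 1)" by (intro mult_left_mono) auto
    finally show "dist ((F (x + h) - F x) / h) D < e" using \<open>\<bar>h\<bar> * (\<bar>K\<bar> + 1) < e\<close> by (simp add: dist_real_def)
  qed (use e in simp)
qed

text \<open>Expanding the square in the weight moves \<xi> into the linear exponent. The factor exp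
  (- \<xi>^2 / (2 s)) left out here cancels in averages, and differentiating in \<xi> merely
  multiplies f by y / s.\<close>

definition tilt :: "real \<Rightarrow> real \<Rightarrow> (real \<Rightarrow> real) \<Rightarrow> real \<Rightarrow> real" where
  "tilt s b f \<xi> = (LINT y|lborel. f y * exp (\<xi> / s * y) * wt s b 0 y)"

lemma mom_eq_tilt: assumes "s > 0" shows "mom s b f \<xi> = exp (- (\<xi>\<^sup>2 / (2 * s))) * tilt s b f \<xi>"
proof -
  have "wt s b \<xi> y = exp (- (\<xi>\<^sup>2 / (2 * s))) * (exp (\<xi> / s * y) * wt s b 0 y)" for y
  proof -
    have "(y - \<xi>)\<^sup>2 / (2 * s) = y\<^sup>2 / (2 * s) + \<xi>\<^sup>2 / (2 * s) - \<xi> / s * y"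
      using assms by (simp add: field_simps power2_eq_square)
    then show ?thesis by (simp add: wt_def exp_add[symmetric])
  qed
  then show ?thesis unfolding mom_def tilt_def integral_mult_right_zero[symmetric] by (simp add: algebra_simps)
qed

context
  fixes s b :: real assumes s: "s > 0" and b: "0 \<le> b" "b \<le> 1"
begin

lemma avg_eq_tilt: "avg s b f \<xi> = tilt s b f \<xi> / tilt s b (\<lambda>_. 1) \<xi>"
  by (simp add: avg_def mom_eq_tilt[OF s])

lemma tilt_one_pos: "tilt s b (\<lambda>_. 1) \<xi> > 0"
  using mom_one_pos[OF s b, of \<xi>] by (simp add: mom_eq_tilt[OF s] zero_less_mult_iff)

lemma tilt_DERIV:
  assumes f: "exp_growth f"
  shows "(tilt s b f has_real_derivative tilt s b (\<lambda>y. f y * (y / s)) \<xi>) (at \<xi>)"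
proof (rule DERIV_if_quadratic_remainder)
  let ?w = "\<lambda>y. wt s b 0 y"
  \<comment> \<open>Majorant of the second-order remainder: for |\<eta>| <= 1, exp (\<eta> y / s) is
    at most exp (|y| / s).\<close>
  let ?G = "\<lambda>y. \<bar>f y\<bar> * exp (\<xi> / s * y) * ((y / s)\<^sup>2 * exp (1 / s * \<bar>y\<bar>))"
  have gG: "exp_growth ?G" by (intro exp_growth_intros exp_growth_exp_abs f)
  fix \<eta> :: real assume \<eta>: "\<bar>\<eta>\<bar> \<le> 1"
  have g1: "exp_growth (\<lambda>y. f y * exp (\<zeta> / s * y))" for \<zeta> by (intro exp_growth_intros f)
  have g2: "exp_growth (\<lambda>y. f y * (y / s) * exp (\<xi> / s * y))" by (intro exp_growth_intros f)
  let ?R = "\<lambda>y. f y * exp ((\<xi> + \<eta>) / s * y) - f y * exp (\<xi> / s * y) - \<eta> * (f y * (y / s) * exp (\<xi> / s * y))"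
  have gR: "exp_growth ?R" by (intro exp_growth_diff g1 exp_growth_mult[OF exp_growth_const] g2)
  have e: "tilt s b f (\<xi> + \<eta>) - tilt s b f \<xi> - \<eta> * tilt s b (\<lambda>y. f y * (y / s)) \<xi> = mom s b ?R 0"
    unfolding mom_diff[OF s b exp_growth_diff[OF g1 g1] exp_growth_mult[OF exp_growth_const g2]]
      mom_diff[OF s b g1 g1] mom_cmult[OF s b] by (simp add: tilt_def mom_def)
  have "\<bar>mom s b ?R 0\<bar> \<le> mom s b (\<lambda>y. \<bar>?R y\<bar>) 0" by (rule mom_abs_le[OF s b gR])
  also have "\<dots> \<le> mom s b (\<lambda>y. \<eta>\<^sup>2 * ?G y) 0"
  proof (rule mom_mono[OF s b exp_growth_abs[OF gR] exp_growth_mult[OF exp_growth_const gG]])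
    fix y
    let ?z = "\<eta> * (y / s)"
    have "?R y = f y * exp (\<xi> / s * y) * (exp ?z - 1 - ?z)"
      by (simp add: add_divide_distrib distrib_right exp_add algebra_simps)
    then have "\<bar>?R y\<bar> = \<bar>f y\<bar> * exp (\<xi> / s * y) * \<bar>exp ?z - 1 - ?z\<bar>" by (simp add: abs_mult)
    also have "\<dots> \<le> \<bar>f y\<bar> * exp (\<xi> / s * y) * (?z\<^sup>2 * max 1 (exp ?z))"
      by (intro mult_left_mono exp_second_order) auto
    also have "\<dots> \<le> \<bar>f y\<bar> * exp (\<xi> / s * y) * (?z\<^sup>2 * exp (1 / s * \<bar>y\<bar>))"
    proof -
      have "\<bar>?z\<bar> \<le> 1 / s * \<bar>y\<bar>" using \<eta> s by (simp add: abs_mult divide_right_mono mult_left_le_one_le)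
      then have "exp ?z \<le> exp (1 / s * \<bar>y\<bar>)" by (meson abs_ge_self exp_le_cancel_iff order_trans)
      then have "max 1 (exp ?z) \<le> exp (1 / s * \<bar>y\<bar>)" using s by (intro max.boundedI) auto
      then show ?thesis by (intro mult_left_mono) auto
    qed
    also have "\<dots> = \<eta>\<^sup>2 * ?G y" by (simp add: power_mult_distrib power_divide)
    finally show "\<bar>?R y\<bar> \<le> \<eta>\<^sup>2 * ?G y" .
  qed
  finally have "\<bar>mom s b ?R 0\<bar> \<le> mom s b (\<lambda>y. \<eta>\<^sup>2 * ?G y) 0" .
  then show "\<bar>tilt s b f (\<xi> + \<eta>) - tilt s b f \<xi> - \<eta> * tilt s b (\<lambda>y. f y * (y / s)) \<xi>\<bar> \<le> mom s b ?G 0 * \<eta>\<^sup>2"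
    unfolding e mom_cmult[OF s b] by (simp add: mult.commute)
qed

text \<open>Quotient rule for the tilted integrals. As in any exponential family, moving the
  parameter produces a covariance, here that of f and y, divided by s.\<close>

lemma avg_DERIV:
  assumes f: "exp_growth f"
  shows "(avg s b f has_real_derivative (avg s b (\<lambda>y. f y * y) \<xi> - avg s b f \<xi> * avg s b (\<lambda>y. y) \<xi>) / s) (at \<xi>)"
proof -
  have t: "tilt s b (\<lambda>y. g y * (y / s)) \<xi> = tilt s b (\<lambda>y. g y * y) \<xi> / s" for g
    unfolding tilt_def integral_divide_zero[symmetric] by (simp add: algebra_simps)
  let ?N = "tilt s b (\<lambda>_. 1)"
  have t1: "tilt s b (\<lambda>y. 1 * (y / s)) \<xi> = tilt s b (\<lambda>y. y) \<xi> / s"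
    unfolding t[of "\<lambda>_. 1"] by (simp add: tilt_def)
  have "((\<lambda>\<xi>. tilt s b f \<xi> / ?N \<xi>) has_real_derivative
      (tilt s b (\<lambda>y. f y * (y / s)) \<xi> * ?N \<xi> - tilt s b f \<xi> * tilt s b (\<lambda>y. 1 * (y / s)) \<xi>) / (?N \<xi> * ?N \<xi>)) (at \<xi>)"
    by (intro DERIV_divide tilt_DERIV f exp_growth_const) (use tilt_one_pos[of \<xi>] in simp)
  moreover have "(tilt s b (\<lambda>y. f y * (y / s)) \<xi> * ?N \<xi> - tilt s b f \<xi> * tilt s b (\<lambda>y. 1 * (y / s)) \<xi>) / (?N \<xi> * ?N \<xi>)
     = (avg s b (\<lambda>y. f y * y) \<xi> - avg s b f \<xi> * avg s b (\<lambda>y. y) \<xi>) / s"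
    unfolding avg_eq_tilt t[of f] t1 using tilt_one_pos[of \<xi>] s by (simp add: field_simps)
  ultimately show ?thesis unfolding avg_eq_tilt[abs_def] by (simp add: avg_eq_tilt)
qed

end

section \<open>Integration by parts and the Poincare inequality\<close>

lemma wt_DERIV:
  assumes "s > 0" shows "(wt s b \<xi> has_real_derivative - ((y - \<xi>) / s + b * U y) * wt s b \<xi> y) (at y)"
proof -
  have V: "(V has_real_derivative U y) (at y)"
    unfolding V_def[abs_def] U_def by (auto intro!: derivative_eq_intros simp: field_simps)
  have "((\<lambda>y. - ((y - \<xi>)\<^sup>2 / (2 * s)) - b * V y) has_real_derivative - ((y - \<xi>) / s + b * U y)) (at y)"
  proof -
    have "((\<lambda>y. - ((y - \<xi>)\<^sup>2 / (2 * s))) has_real_derivative - ((y - \<xi>) / s)) (at y)"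
      using assms by (auto intro!: derivative_eq_intros simp: field_simps)
    from DERIV_diff[OF this DERIV_cmult[OF V, of b]] show ?thesis by (rule DERIV_cong) simp
  qed
  from DERIV_chain2[OF DERIV_exp this] show ?thesis
    unfolding wt_def[abs_def] by (rule DERIV_cong) simp
qed

text \<open>The fundamental theorem on [-n, n], then dominated convergence.\<close>

lemma integral_deriv_eq_0:
  fixes k k' :: "real \<Rightarrow> real"
  assumes D: "\<And>y. (k has_real_derivative k' y) (at y)" and k': "integrable lborel k'"
    and lim: "(\<lambda>n. k (real n)) \<longlonglongrightarrow> 0" "(\<lambda>n. k (- real n)) \<longlonglongrightarrow> 0"
  shows "(LINT y|lborel. k' y) = 0"
proof -
  have e: "(LINT y|lborel. indicator {- real n..real n} y * k' y) = k (real n) - k (- real n)" for n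
  proof -
    have "(k' has_integral (k (real n) - k (- real n))) {- real n..real n}"
      by (rule fundamental_theorem_of_calculus)
        (auto intro!: has_field_derivative_at_within D simp: has_real_derivative_iff_has_vector_derivative[symmetric])
    moreover have "set_integrable lborel {- real n..real n} k'"
      unfolding set_integrable_def by (intro integrable_mult_indicator k') simp
    ultimately show ?thesis
      using set_borel_integral_eq_integral(2)[of "{- real n..real n}" k'] by (simp add: set_lebesgue_integral_def integral_unique)
  qed
  have "(\<lambda>n. LINT y|lborel. indicator {- real n..real n} y * k' y) \<longlonglongrightarrow> (LINT y|lborel. k' y)"
  proof (rule integral_dominated_convergence[where w = "\<lambda>y. \<bar>k' y\<bar>"])
    show "AE y in lborel. (\<lambda>n. indicator {- real n..real n} y * k' y) \<longlonglongrightarrow> k' y"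
    proof (rule AE_I2)
      fix y :: real
      obtain N :: nat where N: "\<bar>y\<bar> \<le> real N" using real_arch_simple by blast
      have "eventually (\<lambda>n. indicator {- real n..real n} y * k' y = k' y) sequentially"
        using eventually_ge_at_top[of N]
      proof eventually_elim
        case (elim n)
        then have "\<bar>y\<bar> \<le> real n" using N by linarith
        then show ?case by (simp add: indicator_def abs_le_iff)
      qed
      then show "(\<lambda>n. indicator {- real n..real n} y * k' y) \<longlonglongrightarrow> k' y" by (rule tendsto_eventually)
    qed
    show "AE y in lborel. norm (indicator {- real n..real n} y * k' y) \<le> \<bar>k' y\<bar>" for n
      by (rule AE_I2) (simp add: indicator_def)
  qed (use k' in auto)
  moreover have "(\<lambda>n. k (real n) - k (- real n)) \<longlonglongrightarrow> 0 - 0" by (intro tendsto_diff lim)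
  ultimately show ?thesis unfolding e using LIMSEQ_unique by fastforce
qed

lemma gauss_decay:
  fixes a s :: real assumes "s > 0" shows "(\<lambda>n. exp (a * real n) * exp (- ((real n)\<^sup>2 / (4 * s)))) \<longlonglongrightarrow> 0"
proof -
  have "filterlim (\<lambda>n. real n * (real n / (4 * s) - a)) at_top sequentially"
  proof (rule filterlim_at_top_mult_at_top[OF filterlim_real_sequentially])
    have "filterlim (\<lambda>n. - a + 1 / (4 * s) * real n) at_top sequentially"
      by (intro filterlim_tendsto_add_at_top[OF tendsto_const] filterlim_tendsto_pos_mult_at_top[OF tendsto_const])
        (use assms in \<open>auto intro: filterlim_real_sequentially\<close>)
    then show "filterlim (\<lambda>n. real n / (4 * s) - a) at_top sequentially" by simp
  qed
  then have "(\<lambda>n. exp (- (real n * (real n / (4 * s) - a)))) \<longlonglongrightarrow> 0"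
    by (intro filterlim_compose[OF exp_at_bot] filterlim_compose[OF filterlim_uminus_at_bot_at_top])
  moreover have "exp (- (real n * (real n / (4 * s) - a))) = exp (a * real n) * exp (- ((real n)\<^sup>2 / (4 * s)))" for n
    by (simp add: exp_add[symmetric] power2_eq_square algebra_simps)
  ultimately show ?thesis by simp
qed

text \<open>\<open>V\<close> is even. This carries half-line estimates over to the negative
  axis.\<close>

lemma mom_reflect: "mom s b f \<xi> = mom s b (\<lambda>y. f (- y)) (- \<xi>)"
proof -
  have "(- y - \<xi>)\<^sup>2 = (y - - \<xi>)\<^sup>2" for y by (simp add: power2_eq_square algebra_simps)
  then have "wt s b \<xi> (- y) = wt s b (- \<xi>) y" for y by (simp add: wt_def V_def)
  then show ?thesis unfolding mom_def
    using lborel_integral_real_affine[of "-1" "\<lambda>y. f y * wt s b \<xi> y" 0] by simp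
qed

context
  fixes s b :: real assumes s: "s > 0" and b: "0 \<le> b" "b \<le> 1"
begin

lemma exp_growth_wt_tendsto_0:
  assumes f: "exp_growth f"
  shows "(\<lambda>n. f (real n) * wt s b \<xi> (real n)) \<longlonglongrightarrow> 0" "(\<lambda>n. f (- real n) * wt s b \<xi> (- real n)) \<longlonglongrightarrow> 0"
proof -
  obtain C a where C: "C > 0" "\<And>y. \<bar>f y\<bar> \<le> C * exp (a * \<bar>y\<bar>)" using exp_growthE[OF f] by metis
  let ?K = "exp (1 / 4 + \<xi>\<^sup>2 / (2 * s))"
  have bd: "norm (f y * wt s b \<xi> y) \<le> C * ?K * (exp (a * real n) * exp (- ((real n)\<^sup>2 / (4 * s))))" if "\<bar>y\<bar> = real n" for y n
  proof -
    have "y\<^sup>2 = (real n)\<^sup>2" using that by (metis power2_abs)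
    then have "\<bar>f y\<bar> * wt s b \<xi> y \<le> (C * exp (a * real n)) * (?K * exp (- ((real n)\<^sup>2 / (4 * s))))"
      using C(2)[of y] wt_le[OF s b, of \<xi> y] that wt_pos[of s b \<xi> y] C(1) by (intro mult_mono) auto
    then show ?thesis using wt_pos[of s b \<xi> y] by (simp add: abs_mult mult_ac)
  qed
  have lim: "(\<lambda>n. C * ?K * (exp (a * real n) * exp (- ((real n)\<^sup>2 / (4 * s))))) \<longlonglongrightarrow> 0"
    using tendsto_mult_right_zero[OF gauss_decay[OF s]] by blast
  show "(\<lambda>n. f (real n) * wt s b \<xi> (real n)) \<longlonglongrightarrow> 0"
    by (rule Lim_null_comparison[OF always_eventually lim], intro allI bd) simp
  show "(\<lambda>n. f (- real n) * wt s b \<xi> (- real n)) \<longlonglongrightarrow> 0"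
    by (rule Lim_null_comparison[OF always_eventually lim], intro allI bd) simp
qed

text \<open>The derivative of f times the weight integrates to 0; the logarithmic derivative of the
  weight is minus the bracket.\<close>

lemma mom_integration_by_parts:
  assumes f: "exp_growth f" "exp_growth f'" and D: "\<And>y. (f has_real_derivative f' y) (at y)"
  shows "mom s b f' \<xi> = mom s b (\<lambda>y. f y * ((y - \<xi>) / s + b * U y)) \<xi>"
proof -
  have g: "exp_growth (\<lambda>y. f y * ((y - \<xi>) / s + b * U y))"
    by (intro exp_growth_intros f exp_growth_U)
  have "mom s b (\<lambda>y. f' y - f y * ((y - \<xi>) / s + b * U y)) \<xi> = 0"
    unfolding mom_def
  proof (rule integral_deriv_eq_0)
    show "((\<lambda>y. f y * wt s b \<xi> y) has_real_derivative (f' y - f y * ((y - \<xi>) / s + b * U y)) * wt s b \<xi> y) (at y)" for y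
      using DERIV_mult[OF D wt_DERIV[OF s]] by (rule DERIV_cong) (simp add: algebra_simps)
    show "integrable lborel (\<lambda>y. (f' y - f y * ((y - \<xi>) / s + b * U y)) * wt s b \<xi> y)"
      by (intro exp_growth_integrable[OF s _ b] exp_growth_diff f g)
  qed (rule exp_growth_wt_tendsto_0[OF f(1)])+
  then show ?thesis using mom_diff[OF s b f(2) g] by simp
qed

lemma avg_integration_by_parts:
  assumes f: "exp_growth f" "exp_growth f'" and D: "\<And>y. (f has_real_derivative f' y) (at y)"
  shows "avg s b f' \<xi> = avg s b (\<lambda>y. f y * ((y - \<xi>) / s + b * U y)) \<xi>"
  unfolding avg_def mom_integration_by_parts[OF assms] ..

text \<open>Integration by parts with f = 1: the force (y - \<xi>) / s + b U has mean zero.\<close>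

lemma avg_shift: "avg s b (\<lambda>y. y) \<xi> - \<xi> = - (s * b) * avg s b U \<xi>"
proof -
  have "0 = avg s b (\<lambda>y. 1 * ((y - \<xi>) / s + b * U y)) \<xi>"
    using avg_integration_by_parts[of "\<lambda>_. 1" "\<lambda>_. 0" \<xi>] avg_const[OF s b, of 0 \<xi>] by simp
  also have "\<dots> = avg s b (\<lambda>y. (1 / s) * (y - \<xi>) + b * U y) \<xi>" by simp
  also have "\<dots> = (1 / s) * (avg s b (\<lambda>y. y) \<xi> - \<xi>) + b * avg s b U \<xi>"
    by (subst avg_add[OF s b], (intro exp_growth_intros exp_growth_U)+)
      (simp only: avg_cmult[OF s b] avg_diff[OF s b exp_growth_ident exp_growth_const] avg_const[OF s b])
  finally show ?thesis using s by (simp add: field_simps)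
qed

lemma mom_Cauchy_Schwarz:
  assumes f: "exp_growth f" and g: "exp_growth g"
  shows "(mom s b (\<lambda>y. f y * g y) \<xi>)\<^sup>2 \<le> mom s b (\<lambda>y. (f y)\<^sup>2) \<xi> * mom s b (\<lambda>y. (g y)\<^sup>2) \<xi>"
proof -
  let ?A = "mom s b (\<lambda>y. (f y)\<^sup>2) \<xi>" and ?B = "mom s b (\<lambda>y. f y * g y) \<xi>" and ?C = "mom s b (\<lambda>y. (g y)\<^sup>2) \<xi>"
  have q: "0 \<le> t\<^sup>2 * ?A + 2 * t * ?B + ?C" for t
  proof -
    have "0 \<le> mom s b (\<lambda>y. (t * f y + g y)\<^sup>2) \<xi>" by (rule mom_nonneg[OF s b]) simp
    also have "(\<lambda>y. (t * f y + g y)\<^sup>2) = (\<lambda>y. (t\<^sup>2 * (f y)\<^sup>2 + 2 * t * (f y * g y)) + (g y)\<^sup>2)"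
      by (intro ext) (simp add: power2_eq_square algebra_simps)
    also have "mom s b \<dots> \<xi> = t\<^sup>2 * ?A + 2 * t * ?B + ?C"
    proof -
      have g1: "exp_growth (\<lambda>y. t\<^sup>2 * (f y)\<^sup>2)" "exp_growth (\<lambda>y. 2 * t * (f y * g y))" "exp_growth (\<lambda>y. (g y)\<^sup>2)"
        by (intro exp_growth_intros f g)+
      show ?thesis
        by (simp only: mom_add[OF s b exp_growth_add[OF g1(1,2)] g1(3)] mom_add[OF s b g1(1,2)] mom_cmult[OF s b])
    qed
    finally show ?thesis .
  qed
  have A: "?A \<ge> 0" by (rule mom_nonneg[OF s b]) simp
  show ?thesis
  proof (cases "?A = 0")
    case True
    have "?B = 0"
    proof (rule ccontr)
      assume "?B \<noteq> 0"
      \<comment> \<open>With ?A = 0 the quadratic is affine in t; this t gives it the value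
        -1.\<close>
      then have "2 * (- (?C + 1) / (2 * ?B)) * ?B = - (?C + 1)" by simp
      then show False using q[of "- (?C + 1) / (2 * ?B)"] True by simp
    qed
    then show ?thesis using True by simp
  next
    case False
    then have A: "?A > 0" using A by simp
    have "0 \<le> (- ?B / ?A)\<^sup>2 * ?A + 2 * (- ?B / ?A) * ?B + ?C" by (rule q)
    also have "\<dots> = ?C - ?B\<^sup>2 / ?A" using A by (simp add: power2_eq_square field_simps)
    finally have "?B\<^sup>2 / ?A \<le> ?C" by simp
    then show ?thesis using A by (simp add: pos_divide_le_eq mult.commute)
  qed
qed

lemma avg_Cauchy_Schwarz:
  assumes f: "exp_growth f" and g: "exp_growth g"
  shows "(avg s b (\<lambda>y. f y * g y) \<xi>)\<^sup>2 \<le> avg s b (\<lambda>y. (f y)\<^sup>2) \<xi> * avg s b (\<lambda>y. (g y)\<^sup>2) \<xi>"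
  using divide_right_mono[OF mom_Cauchy_Schwarz[OF assms], of "(mom s b (\<lambda>_. 1) \<xi>)\<^sup>2" \<xi>]
  unfolding avg_def by (simp add: power_divide power2_eq_square)

lemma wt_tail_le:
  assumes "\<bar>\<xi>\<bar> \<le> R" "0 \<le> y" "y \<le> z"
  shows "wt s b \<xi> z \<le> exp (R\<^sup>2 / s + 1 / 4) * wt s b \<xi> y * exp (- ((z - y)\<^sup>2 / (4 * s)))"
proof -
  define u where "u = z - y"
  have u: "u \<ge> 0" using assms by (simp add: u_def)
  have R2: "\<xi>\<^sup>2 \<le> R\<^sup>2" using assms(1) abs_le_square_iff[of \<xi> R] by simp
  have "0 \<le> 2 * (u / 2 - \<bar>\<xi>\<bar>)\<^sup>2" by simp
  then have "2 * (u * \<bar>\<xi>\<bar>) \<le> u\<^sup>2 / 2 + 2 * \<xi>\<^sup>2" by (simp add: power2_eq_square algebra_simps)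
  moreover have "u * \<xi> \<le> u * \<bar>\<xi>\<bar>" using u by (intro mult_left_mono) auto
  moreover have "0 \<le> u * y" using u assms by simp
  ultimately have "u\<^sup>2 / 2 - 2 * R\<^sup>2 \<le> (z - \<xi>)\<^sup>2 - (y - \<xi>)\<^sup>2"
  proof -
    have "(z - \<xi>)\<^sup>2 - (y - \<xi>)\<^sup>2 = u\<^sup>2 + 2 * (u * y) - 2 * (u * \<xi>)"
      by (simp add: u_def power2_eq_square algebra_simps)
    then show "u\<^sup>2 / 2 - 2 * R\<^sup>2 \<le> (z - \<xi>)\<^sup>2 - (y - \<xi>)\<^sup>2"
      using R2 \<open>2 * (u * \<bar>\<xi>\<bar>) \<le> u\<^sup>2 / 2 + 2 * \<xi>\<^sup>2\<close> \<open>u * \<xi> \<le> u * \<bar>\<xi>\<bar>\<close> \<open>0 \<le> u * y\<close> by linarith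
  qed
  then have "(u\<^sup>2 / 2 - 2 * R\<^sup>2) / (2 * s) \<le> ((z - \<xi>)\<^sup>2 - (y - \<xi>)\<^sup>2) / (2 * s)"
    using s by (intro divide_right_mono) auto
  then have 1: "u\<^sup>2 / (4 * s) - R\<^sup>2 / s \<le> (z - \<xi>)\<^sup>2 / (2 * s) - (y - \<xi>)\<^sup>2 / (2 * s)"
    using s by (simp add: diff_divide_distrib)
  have 2: "V y - 1 / 4 \<le> V z"
  proof (cases "y \<le> 1")
    case True
    have "V y \<le> 0" using True assms by (intro V_nonpos) auto
    then show ?thesis using V_ge[of z] by linarith
  next
    case False
    have "(y\<^sup>2 - 1)\<^sup>2 \<le> (z\<^sup>2 - 1)\<^sup>2"
    proof (intro power_mono diff_right_mono)
      show "y \<le> z" "0 \<le> y" using assms by auto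
      show "0 \<le> y\<^sup>2 - 1" using False one_le_power[of y 2] by simp
    qed
    moreover have "V x = (x\<^sup>2 - 1)\<^sup>2 / 4 - 1 / 4" for x by (simp add: V_def power2_eq_square power4_eq_xxxx algebra_simps)
    ultimately show ?thesis by simp
  qed
  have "b * (V y - V z) \<le> 1 * (1 / 4)"
  proof (cases "V y - V z \<ge> 0")
    case True then show ?thesis using 2 b by (intro mult_mono) auto
  next
    case False then show ?thesis using mult_nonneg_nonpos[of b "V y - V z"] b by simp
  qed
  then show ?thesis using 1 unfolding wt_def exp_add[symmetric] u_def[symmetric] by (simp add: algebra_simps)
qed

text \<open>A Mills-ratio bound. The constant depends on R and s only, and so does the Poincare
  constant built from it.\<close>

lemma wt_tail_integral:
  assumes "\<bar>\<xi>\<bar> \<le> R" "0 \<le> y"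
  shows "(LINT z|lborel. indicator {y<..} z * wt s b \<xi> z) \<le> exp (R\<^sup>2 / s + 1 / 4) * sqrt (4 * pi * s) * wt s b \<xi> y"
proof -
  let ?K = "exp (R\<^sup>2 / s + 1 / 4)"
  have n: "exp (- ((z - y)\<^sup>2 / (4 * s))) = sqrt (4 * pi * s) * normal_density y (sqrt (2 * s)) z" for z
    using s by (simp add: normal_density_def mult.assoc)
  have ni: "integrable lborel (\<lambda>z. exp (- ((z - y)\<^sup>2 / (4 * s))))" "(LINT z|lborel. exp (- ((z - y)\<^sup>2 / (4 * s)))) = sqrt (4 * pi * s)"
    unfolding n using normal_moment_even[of "sqrt (2 * s)" y 0] s
    by (auto simp: has_bochner_integral_iff)
  have "(LINT z|lborel. indicator {y<..} z * wt s b \<xi> z) \<le> (LINT z|lborel. ?K * wt s b \<xi> y * exp (- ((z - y)\<^sup>2 / (4 * s))))"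
  proof (rule integral_mono)
    show "integrable lborel (\<lambda>z. indicator {y<..} z * wt s b \<xi> z)"
      by (rule exp_growth_integrable[OF s _ b]) auto
    show "integrable lborel (\<lambda>z. ?K * wt s b \<xi> y * exp (- ((z - y)\<^sup>2 / (4 * s))))"
      by (intro integrable_mult_right ni)
    show "indicator {y<..} z * wt s b \<xi> z \<le> ?K * wt s b \<xi> y * exp (- ((z - y)\<^sup>2 / (4 * s)))" for z
      using wt_tail_le[OF assms, of z] wt_pos[of s b \<xi> y] by (auto simp: indicator_def)
  qed
  also have "\<dots> = ?K * sqrt (4 * pi * s) * wt s b \<xi> y" using ni(2) by simp
  finally show ?thesis .
qed

text \<open>A Hardy-type argument: integrate \<open>(f - f 0)\<^sup>2\<close> by parts against the tail integral \<open>Q\<close> of the weight, which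
  is at most a constant times the weight on the half line.\<close>

lemma half_line_poincare:
  assumes R: "\<bar>\<xi>\<bar> \<le> R" and f: "exp_growth f" "exp_growth f'"
    and D: "\<And>y. (f has_real_derivative f' y) (at y)" and f'c: "continuous_on UNIV f'"
    and A: "A \<ge> 0" "\<And>y. y \<ge> A \<Longrightarrow> f y = 0"
  defines "C \<equiv> exp (R\<^sup>2 / s + 1 / 4) * sqrt (4 * pi * s)"
  shows "mom s b (\<lambda>y. indicator {0..} y * (f y - f 0)\<^sup>2) \<xi> \<le> 4 * C\<^sup>2 * mom s b (\<lambda>y. indicator {0..} y * (f' y)\<^sup>2) \<xi>"
proof -
  let ?w = "wt s b \<xi>" and ?g = "\<lambda>y. f y - f 0"
  define I where "I S k = (LINT y|lborel. indicator S y * (k y * ?w y))" for S k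
  have C: "C \<ge> 0" using s by (simp add: C_def)
  have mI: "mom s b (\<lambda>y. indicator S y * k y) \<xi> = I S k" for S k by (simp add: mom_def I_def mult.assoc)
  have ii: "integrable lborel (\<lambda>y. indicator S y * (k y * ?w y))" if "exp_growth k" "S \<in> sets borel" for S k
    using exp_growth_integrable[OF s _ b, of "\<lambda>y. indicator S y * k y" \<xi>] that by (auto simp: mult.assoc)
  have Iadd: "I (S \<union> S') k = I S k + I S' k" if "exp_growth k" "S \<in> sets borel" "S' \<in> sets borel" "S \<inter> S' = {}" for S S' k
    unfolding I_def using ii[OF that(1)] that(2-4)
    by (subst Bochner_Integration.integral_add[symmetric]) (auto simp: indicator_add distrib_right[symmetric])
  have Ihk: "I {0..y} k = integral {0..y} (\<lambda>y. k y * ?w y)" if "exp_growth k" for k y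
    unfolding I_def using set_borel_integral_eq_integral(2)[of "{0..y}" "\<lambda>y. k y * ?w y"] ii[OF that, of "{0..y}"]
    by (simp add: set_lebesgue_integral_def set_integrable_def)
  have half: "{0..} = {0..y} \<union> {y<..}" "{0..y} \<inter> {y<..} = {}" if "y \<ge> 0" for y :: real using that by auto
  \<comment> \<open>The tail integral, written through the integral over [0, y] so that the
    fundamental theorem yields its derivative.\<close>
  define Q where "Q y = I {0..} (\<lambda>_. 1) - integral {0..y} ?w" for y
  have Q: "Q y = I {y<..} (\<lambda>_. 1)" if "y \<ge> 0" for y
    using Iadd[of "\<lambda>_. 1" "{0..y}" "{y<..}"] half[OF that] Ihk[of "\<lambda>_. 1" y] by (simp add: Q_def)
  have Qle: "Q y \<le> C * ?w y" if "y \<ge> 0" for y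
    using wt_tail_integral[OF R that] unfolding Q[OF that] I_def C_def by simp
  have Qnn: "Q y \<ge> 0" if "y \<ge> 0" for y
    unfolding Q[OF that] I_def by (intro integral_nonneg_AE AE_I2) (simp add: wt_pos less_imp_le)
  have QD: "(Q has_real_derivative - ?w y) (at y within {0..A})" if "y \<in> {0..A}" for y
    unfolding Q_def[abs_def]
    using DERIV_diff[OF DERIV_const integral_has_real_derivative[OF wt_continuous that]] by simp
  have Qc: "continuous_on {0..A} Q" by (rule DERIV_continuous_on[OF QD])
  have Dw: "(f has_real_derivative f' y) (at y within {0..A})" for y by (rule has_field_derivative_at_within[OF D])
  have fc: "continuous_on B f" for B by (rule DERIV_continuous_on[OF has_field_derivative_at_within[OF D]])
  have f'cA: "continuous_on B f'" for B using f'c continuous_on_subset by blast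
  let ?G = "\<lambda>y. (?g y)\<^sup>2 * Q y"
  have "((\<lambda>y. 2 * ?g y * f' y * Q y - (?g y)\<^sup>2 * ?w y) has_integral (?G A - ?G 0)) {0..A}"
  proof (rule fundamental_theorem_of_calculus[OF A(1)])
    fix y assume y: "y \<in> {0..A}"
    have "((\<lambda>y. (?g y)\<^sup>2) has_real_derivative 2 * ?g y * f' y) (at y within {0..A})"
      by (auto intro!: derivative_eq_intros Dw)
    from DERIV_mult[OF this QD[OF y]]
    have "(?G has_real_derivative (2 * ?g y * f' y * Q y - (?g y)\<^sup>2 * ?w y)) (at y within {0..A})"
      by (rule DERIV_cong) (simp add: algebra_simps)
    then show "(?G has_vector_derivative (2 * ?g y * f' y * Q y - (?g y)\<^sup>2 * ?w y)) (at y within {0..A})"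
      by (simp add: has_real_derivative_iff_has_vector_derivative)
  qed
  then have G: "integral {0..A} (\<lambda>y. 2 * ?g y * f' y * Q y - (?g y)\<^sup>2 * ?w y) = (f 0)\<^sup>2 * Q A"
    using A(2)[of A] by (simp add: integral_unique)
  have i1: "(\<lambda>y. 2 * ?g y * f' y * Q y) integrable_on {0..A}"
    by (intro integrable_continuous_interval continuous_intros fc f'cA Qc)
  have i2: "(\<lambda>y. (?g y)\<^sup>2 * ?w y) integrable_on {0..A}"
    by (intro integrable_continuous_interval continuous_intros fc wt_continuous)
  have i3: "(\<lambda>y. (f' y)\<^sup>2 * ?w y) integrable_on {0..A}"
    by (intro integrable_continuous_interval continuous_intros f'cA wt_continuous)
  define X where "X = I {0..} (\<lambda>y. (?g y)\<^sup>2)"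
  define X0 where "X0 = integral {0..A} (\<lambda>y. (?g y)\<^sup>2 * ?w y)"
  define Y0 where "Y0 = integral {0..A} (\<lambda>y. (f' y)\<^sup>2 * ?w y)"
  have gg: "exp_growth (\<lambda>y. (?g y)\<^sup>2)" "exp_growth (\<lambda>y. (f' y)\<^sup>2)" by (intro exp_growth_intros f)+
  \<comment> \<open>Beyond A, where f vanishes, the integrand is (f 0)^2 times the weight: exactly
    the boundary term of the integration by parts.\<close>
  have tail: "I {A<..} (\<lambda>y. (?g y)\<^sup>2) = (f 0)\<^sup>2 * Q A"
  proof -
    have "I {A<..} (\<lambda>y. (?g y)\<^sup>2) = (LINT y|lborel. (f 0)\<^sup>2 * (indicator {A<..} y * (1 * ?w y)))"
      unfolding I_def by (intro Bochner_Integration.integral_cong refl) (auto simp: indicator_def A(2))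
    then show ?thesis unfolding Q[OF A(1)] I_def by simp
  qed
  have X: "X = X0 + (f 0)\<^sup>2 * Q A"
    using Iadd[OF gg(1), of "{0..A}" "{A<..}"] half[OF A(1)] Ihk[OF gg(1), of A] tail by (simp add: X_def X0_def)
  have X0X: "X0 \<le> X" using X Qnn[OF A(1)] by simp
  have "integral {0..A} (\<lambda>y. 2 * ?g y * f' y * Q y) - X0 = (f 0)\<^sup>2 * Q A"
    using G Henstock_Kurzweil_Integration.integral_diff[OF i1 i2] by (simp add: X0_def)
  then have "X = integral {0..A} (\<lambda>y. 2 * ?g y * f' y * Q y)" using X by simp
  also have "\<dots> \<le> integral {0..A} (\<lambda>y. 1 / 2 * ((?g y)\<^sup>2 * ?w y) + 2 * C\<^sup>2 * ((f' y)\<^sup>2 * ?w y))"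
  proof (rule integral_le[OF i1])
    show "(\<lambda>y. 1 / 2 * ((?g y)\<^sup>2 * ?w y) + 2 * C\<^sup>2 * ((f' y)\<^sup>2 * ?w y)) integrable_on {0..A}"
      by (intro integrable_add integrable_on_mult_right i2 i3)
    fix y assume y: "y \<in> {0..A}"
    have "2 * ?g y * f' y * Q y \<le> \<bar>2 * ?g y * f' y\<bar> * Q y" using Qnn[of y] y by (intro mult_right_mono) auto
    also have "\<dots> \<le> \<bar>2 * ?g y * f' y\<bar> * (C * ?w y)" using Qle[of y] y by (intro mult_left_mono) auto
    also have "\<dots> = (2 * C * \<bar>?g y\<bar> * \<bar>f' y\<bar>) * ?w y" by (simp only: abs_mult abs_numeral mult_ac)
    also have "\<dots> \<le> (1 / 2 * (?g y)\<^sup>2 + 2 * C\<^sup>2 * (f' y)\<^sup>2) * ?w y"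
    proof (rule mult_right_mono)
      \<comment> \<open>Weighted so that half of the quantity to be bounded reappears and can be
        absorbed, which doubles 2 C^2 to 4 C^2.\<close>
      have "0 \<le> (\<bar>?g y\<bar> - 2 * C * \<bar>f' y\<bar>)\<^sup>2" by simp
      also have "\<dots> = \<bar>?g y\<bar>\<^sup>2 - 4 * C * \<bar>?g y\<bar> * \<bar>f' y\<bar> + 4 * C\<^sup>2 * \<bar>f' y\<bar>\<^sup>2"
        by (simp only: power2_eq_square) (simp only: algebra_simps)
      finally show "2 * C * \<bar>?g y\<bar> * \<bar>f' y\<bar> \<le> 1 / 2 * (?g y)\<^sup>2 + 2 * C\<^sup>2 * (f' y)\<^sup>2" by simp
    qed (simp add: wt_pos less_imp_le)
    finally show "2 * ?g y * f' y * Q y \<le> 1 / 2 * ((?g y)\<^sup>2 * ?w y) + 2 * C\<^sup>2 * ((f' y)\<^sup>2 * ?w y)"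
      by (simp add: algebra_simps)
  qed
  also have "\<dots> = 1 / 2 * X0 + 2 * C\<^sup>2 * Y0"
    unfolding X0_def Y0_def
    by (subst Henstock_Kurzweil_Integration.integral_add) (auto intro!: integrable_on_mult_right integrable_on_cmult_left i2 i3 simp del: times_divide_eq_left)
  finally have "X \<le> 1 / 2 * X + 2 * C\<^sup>2 * Y0" using X0X by simp
  then have "X \<le> 4 * C\<^sup>2 * Y0" by simp
  also have "\<dots> \<le> 4 * C\<^sup>2 * I {0..} (\<lambda>y. (f' y)\<^sup>2)"
  proof (rule mult_left_mono)
    have "0 \<le> I {A<..} (\<lambda>y. (f' y)\<^sup>2)"
      unfolding I_def by (intro integral_nonneg_AE AE_I2) (simp add: wt_pos less_imp_le)
    then show "Y0 \<le> I {0..} (\<lambda>y. (f' y)\<^sup>2)"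
      using Iadd[OF gg(2), of "{0..A}" "{A<..}"] half[OF A(1)] Ihk[OF gg(2), of A] by (simp add: Y0_def)
  qed simp
  finally show ?thesis unfolding mI X_def .
qed

text \<open>The half-line estimate for f and for its reflection. Centring at \<open>f 0\<close>
  rather than at the mean decouples the two halves, and any constant serves for a covariance.
  Bounding each half by the full integral gives 4 + 4 = 8.\<close>

lemma poincare:
  assumes R: "\<bar>\<xi>\<bar> \<le> R" and f: "exp_growth f" "exp_growth f'"
    and D: "\<And>y. (f has_real_derivative f' y) (at y)" and f'c: "continuous_on UNIV f'"
    and A: "\<And>y. y \<notin> {- A..A} \<Longrightarrow> f y = 0"
  defines "C \<equiv> exp (R\<^sup>2 / s + 1 / 4) * sqrt (4 * pi * s)"
  shows "avg s b (\<lambda>y. (f y - f 0)\<^sup>2) \<xi> \<le> 8 * C\<^sup>2 * avg s b (\<lambda>y. (f' y)\<^sup>2) \<xi>"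
proof -
  \<comment> \<open>\<open>|A| + 1\<close> is non-negative whatever the sign of A, as the half-line
    estimate demands.\<close>
  have A': "f y = 0" if "y \<ge> \<bar>A\<bar> + 1" for y using A[of y] that by (auto simp: abs_if split: if_splits)
  have A'': "f (- y) = 0" if "y \<ge> \<bar>A\<bar> + 1" for y using A[of "- y"] that by (auto simp: abs_if split: if_splits)
  have refl: "exp_growth (\<lambda>y. k (- y))" if k: "exp_growth k" for k
  proof -
    obtain C a where "\<And>y. \<bar>k y\<bar> \<le> C * exp (a * \<bar>y\<bar>)" using exp_growthE[OF k] by blast
    then have "\<bar>k (- y)\<bar> \<le> C * exp (a * \<bar>y\<bar>)" for y by (metis abs_minus_cancel)
    moreover have [measurable]: "k \<in> borel_measurable borel" using k by (rule exp_growth_measurable)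
    ultimately show ?thesis by (intro exp_growthI[of _ C a]) simp_all
  qed
  have P: "mom s b (\<lambda>y. indicator {0..} y * (f y - f 0)\<^sup>2) \<xi> \<le> 4 * C\<^sup>2 * mom s b (\<lambda>y. indicator {0..} y * (f' y)\<^sup>2) \<xi>"
    unfolding C_def by (rule half_line_poincare[OF R f D f'c _ A']) auto
  have D2: "((\<lambda>y. f (- y)) has_real_derivative - f' (- y)) (at y)" for y
    using DERIV_chain2[OF D DERIV_minus[OF DERIV_ident], of y] by simp
  have "mom s b (\<lambda>y. indicator {0..} y * (f (- y) - f (- 0))\<^sup>2) (- \<xi>) \<le> 4 * C\<^sup>2 * mom s b (\<lambda>y. indicator {0..} y * (- f' (- y))\<^sup>2) (- \<xi>)"
    unfolding C_def
    by (rule half_line_poincare[OF _ refl[OF f(1)] exp_growth_minus[OF refl[OF f(2)]] D2 _ _ A''])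
      (use R f'c in \<open>auto intro!: continuous_intros continuous_on_compose2[OF f'c]\<close>)
  moreover have i: "indicator {..0} (- y) = (indicator {0..} y :: real)" for y :: real by (simp add: indicator_def)
  ultimately have N: "mom s b (\<lambda>y. indicator {..0} y * (f y - f 0)\<^sup>2) \<xi> \<le> 4 * C\<^sup>2 * mom s b (\<lambda>y. indicator {..0} y * (f' y)\<^sup>2) \<xi>"
    unfolding mom_reflect[of s b "\<lambda>y. indicator {..0} y * (f y - f 0)\<^sup>2" \<xi>] mom_reflect[of s b "\<lambda>y. indicator {..0} y * (f' y)\<^sup>2" \<xi>] i
    by simp
  have gi: "exp_growth (\<lambda>y. indicator S y * k y)" if "exp_growth k" "S \<in> sets borel" for S k
    by (rule exp_growth_mult[OF exp_growth_indicator that(1)]) (rule that(2))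
  have gg: "exp_growth (\<lambda>y. (f y - f 0)\<^sup>2)" "exp_growth (\<lambda>y. (f' y)\<^sup>2)" by (intro exp_growth_intros f)+
  have "mom s b (\<lambda>y. (f y - f 0)\<^sup>2) \<xi> \<le> mom s b (\<lambda>y. indicator {0..} y * (f y - f 0)\<^sup>2 + indicator {..0} y * (f y - f 0)\<^sup>2) \<xi>"
    by (intro mom_mono[OF s b] exp_growth_add gi gg) (auto simp: indicator_def)
  also have "\<dots> = mom s b (\<lambda>y. indicator {0..} y * (f y - f 0)\<^sup>2) \<xi> + mom s b (\<lambda>y. indicator {..0} y * (f y - f 0)\<^sup>2) \<xi>"
    by (intro mom_add[OF s b] gi gg) auto
  also have "\<dots> \<le> 4 * C\<^sup>2 * mom s b (\<lambda>y. (f' y)\<^sup>2) \<xi> + 4 * C\<^sup>2 * mom s b (\<lambda>y. (f' y)\<^sup>2) \<xi>"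
    by (intro add_mono order_trans[OF P] order_trans[OF N] mult_left_mono mom_mono[OF s b] gi gg) (auto simp: indicator_def)
  finally have "mom s b (\<lambda>y. (f y - f 0)\<^sup>2) \<xi> \<le> 8 * C\<^sup>2 * mom s b (\<lambda>y. (f' y)\<^sup>2) \<xi>" by simp
  then show ?thesis unfolding avg_def times_divide_eq_right
    using mom_one_pos[OF s b, of \<xi>] by (intro divide_right_mono) auto
qed

end

section \<open>Equilibrium measures\<close>

lemma exp_growth_test_fun: assumes "f \<in> test_fun" shows "exp_growth f"
proof -
  obtain B where "\<And>x. \<bar>f x\<bar> \<le> B" using test_fun_bounded[OF assms] by blast
  then show ?thesis
    by (rule exp_growth_bounded[rotated]) (rule borel_measurable_continuous_onI[OF smooth_continuous[OF test_fun_smooth[OF assms]]])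
qed

lemma eq_weight_eq_wt: "eq_weight h \<theta> \<sigma> \<xi> y = wt (\<sigma>\<^sup>2 / (2 * \<theta>)) (2 * h / \<sigma>\<^sup>2) \<xi> y"
  by (simp add: eq_weight_def wt_def)

text \<open>The derivative in \<xi> is a covariance with y over s, at most 2 K / s when |f| <= 1.
  Indicators f give continuity in total variation, test functions absolute continuity in
  time.\<close>

lemma avg_Lipschitz:
  assumes s: "s > 0"
  shows "\<exists>L>0. \<forall>b \<xi> \<zeta> f. 0 \<le> b \<and> b \<le> 1 \<and> \<bar>\<xi>\<bar> \<le> R \<and> \<bar>\<zeta>\<bar> \<le> R \<and> f \<in> borel_measurable borel \<and> (\<forall>y. \<bar>f y\<bar> \<le> 1)
    \<longrightarrow> \<bar>avg s b f \<xi> - avg s b f \<zeta>\<bar> \<le> L * \<bar>\<xi> - \<zeta>\<bar>"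
proof -
  obtain K where K: "K > 0" "\<And>b \<xi>. 0 \<le> b \<Longrightarrow> b \<le> 1 \<Longrightarrow> \<bar>\<xi>\<bar> \<le> R \<Longrightarrow> avg s b (\<lambda>y. \<bar>y\<bar>) \<xi> \<le> K"
    using avg_bounded[OF s exp_growth_ident, of R] by blast
  show ?thesis
  proof (intro exI[of _ "2 * K / s"] conjI allI impI)
    fix b \<xi> \<zeta> :: real and f :: "real \<Rightarrow> real"
    assume A: "0 \<le> b \<and> b \<le> 1 \<and> \<bar>\<xi>\<bar> \<le> R \<and> \<bar>\<zeta>\<bar> \<le> R \<and> f \<in> borel_measurable borel \<and> (\<forall>y. \<bar>f y\<bar> \<le> 1)"
    then have b: "0 \<le> b" "b \<le> 1" and \<xi>: "\<bar>\<xi>\<bar> \<le> R" "\<bar>\<zeta>\<bar> \<le> R" and f: "f \<in> borel_measurable borel" "\<And>y. \<bar>f y\<bar> \<le> 1"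
      by simp_all
    have fg: "exp_growth f" by (rule exp_growth_bounded[OF f])
    let ?D = "\<lambda>\<xi>. (avg s b (\<lambda>y. f y * y) \<xi> - avg s b f \<xi> * avg s b (\<lambda>y. y) \<xi>) / s"
    have bd: "norm (?D z) \<le> 2 * K / s" if "z \<in> {-R..R}" for z
    proof -
      have z: "\<bar>z\<bar> \<le> R" using that by auto
      have "\<bar>avg s b (\<lambda>y. f y * y) z\<bar> \<le> avg s b (\<lambda>y. \<bar>f y * y\<bar>) z" by (rule avg_abs_le[OF s b]) (intro exp_growth_intros fg)
      also have "\<dots> \<le> avg s b (\<lambda>y. \<bar>y\<bar>) z"
        by (rule avg_mono[OF s b]) (use f(2) in \<open>auto simp: abs_mult mult_left_le_one_le intro!: exp_growth_intros fg\<close>)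
      also have "\<dots> \<le> K" by (rule K(2)[OF b z])
      finally have 1: "\<bar>avg s b (\<lambda>y. f y * y) z\<bar> \<le> K" .
      have "\<bar>avg s b f z\<bar> \<le> avg s b (\<lambda>y. \<bar>f y\<bar>) z" by (rule avg_abs_le[OF s b fg])
      also have "\<dots> \<le> avg s b (\<lambda>y. 1) z" by (intro avg_mono[OF s b] exp_growth_abs fg exp_growth_const f(2))
      finally have 2: "\<bar>avg s b f z\<bar> \<le> 1" by (simp add: avg_const[OF s b])
      have 3: "\<bar>avg s b (\<lambda>y. y) z\<bar> \<le> K" using avg_abs_le[OF s b exp_growth_ident, of z] K(2)[OF b z] by linarith
      have "\<bar>avg s b f z * avg s b (\<lambda>y. y) z\<bar> \<le> 1 * K" unfolding abs_mult using 2 3 by (intro mult_mono) auto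
      then have "\<bar>avg s b (\<lambda>y. f y * y) z - avg s b f z * avg s b (\<lambda>y. y) z\<bar> \<le> 2 * K" using 1 by linarith
      then show ?thesis using s by (simp add: abs_divide divide_right_mono)
    qed
    have "norm (avg s b f \<xi> - avg s b f \<zeta>) \<le> 2 * K / s * norm (\<xi> - \<zeta>)"
    proof (rule field_differentiable_bound[of "{-R..R}"])
      show "(avg s b f has_field_derivative ?D z) (at z within {-R..R})" for z
        by (rule has_field_derivative_at_within[OF avg_DERIV[OF s b fg]])
    qed (use bd \<xi> in auto)
    then show "\<bar>avg s b f \<xi> - avg s b f \<zeta>\<bar> \<le> 2 * K / s * \<bar>\<xi> - \<zeta>\<bar>" by simp
  qed (use K s in simp)
qed

text \<open>Every set is contained in its own \<delta>-neighbourhood, so a bound in total variation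
  is one in the Prohorov distance.\<close>

lemma prohorov_le:
  assumes \<mu>: "real_distribution \<mu>" and \<nu>: "real_distribution \<nu>" and "\<delta> > 0"
    and le: "\<And>B. B \<in> sets borel \<Longrightarrow> \<bar>measure \<mu> B - measure \<nu> B\<bar> \<le> \<delta>"
  shows "0 \<le> prohorov \<mu> \<nu>" "prohorov \<mu> \<nu> \<le> \<delta>"
proof -
  interpret \<mu>: real_distribution \<mu> by fact
  interpret \<nu>: real_distribution \<nu> by fact
  let ?S = "{e. e > 0 \<and> (\<forall>B\<in>sets borel. measure \<mu> B \<le> measure \<nu> (\<Union>x\<in>B. ball x e) + e \<and>
      measure \<nu> B \<le> measure \<mu> (\<Union>x\<in>B. ball x e) + e)}"
  have "\<delta> \<in> ?S"
  proof (intro CollectI conjI ballI)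
    fix B :: "real set" assume B: "B \<in> sets borel"
    have "B \<subseteq> (\<Union>x\<in>B. ball x \<delta>)" using \<open>\<delta> > 0\<close> by auto
    moreover have "open (\<Union>x\<in>B. ball x \<delta>)" by auto
    ultimately have "measure \<nu> B \<le> measure \<nu> (\<Union>x\<in>B. ball x \<delta>)" "measure \<mu> B \<le> measure \<mu> (\<Union>x\<in>B. ball x \<delta>)"
      by (auto intro!: \<nu>.finite_measure_mono \<mu>.finite_measure_mono)
    then show "measure \<mu> B \<le> measure \<nu> (\<Union>x\<in>B. ball x \<delta>) + \<delta>" "measure \<nu> B \<le> measure \<mu> (\<Union>x\<in>B. ball x \<delta>) + \<delta>"
      using le[OF B] by linarith+
  qed fact
  moreover have "bdd_below ?S" by (rule bdd_belowI[of _ 0]) auto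
  ultimately show "prohorov \<mu> \<nu> \<le> \<delta>" unfolding prohorov_def by (intro cInf_lower)
  show "0 \<le> prohorov \<mu> \<nu>" unfolding prohorov_def by (rule cInf_greatest) (use \<open>\<delta> \<in> ?S\<close> in auto)
qed

context
  fixes h \<theta> \<sigma> s b :: real
  assumes \<theta>: "\<theta> > 0" and \<sigma>: "\<sigma> > 0" and h: "0 \<le> h" "2 * h / \<sigma>\<^sup>2 \<le> 1"
    and s_eq: "s = \<sigma>\<^sup>2 / (2 * \<theta>)" and b_eq: "b = 2 * h / \<sigma>\<^sup>2"
begin

lemma s_pos: "s > 0" using \<theta> \<sigma> by (simp add: s_eq)
lemma b_bounds: "0 \<le> b" "b \<le> 1" using h by (simp_all add: b_eq)

lemmas sb = s_pos b_bounds

lemma eq_density_eq: "eq_density h \<theta> \<sigma> \<xi> y = wt s b \<xi> y / mom s b (\<lambda>_. 1) \<xi>"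
proof -
  have p: "sqrt (2 * pi * s) \<noteq> 0" using s_pos by simp
  have "eq_Z h \<theta> \<sigma> \<xi> = mom s b (\<lambda>_. 1) \<xi> / sqrt (2 * pi * s)"
    unfolding eq_Z_def mom_def eq_weight_eq_wt mult_1 s_eq[symmetric] b_eq[symmetric] by (rule integral_divide_zero)
  then have "eq_Z h \<theta> \<sigma> \<xi> * sqrt (2 * pi * s) = mom s b (\<lambda>_. 1) \<xi>"
    using p by (metis nonzero_eq_divide_eq)
  then show ?thesis unfolding eq_density_def eq_weight_eq_wt s_eq[symmetric] b_eq[symmetric] by simp
qed

lemma eq_density_nonneg: "0 \<le> eq_density h \<theta> \<sigma> \<xi> y"
  unfolding eq_density_eq using wt_pos[of s b \<xi> y] mom_one_pos[OF sb, of \<xi>] by simp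

lemma eq_density_measurable [measurable]: "eq_density h \<theta> \<sigma> \<xi> \<in> borel_measurable borel"
  unfolding eq_density_eq[abs_def] by measurable

lemma integral_eq_density: "(LINT y|lborel. f y * eq_density h \<theta> \<sigma> \<xi> y) = avg s b f \<xi>"
  unfolding eq_density_eq avg_def mom_def by simp

lemma pairing_eq_measure: "f \<in> borel_measurable borel \<Longrightarrow> pairing (eq_measure h \<theta> \<sigma> \<xi>) f = avg s b f \<xi>"
  unfolding pairing_def eq_measure_def integral_eq_density[symmetric]
  by (subst integral_density) (auto simp: eq_density_nonneg mult.commute)

lemma eq_mean_eq: "eq_mean h \<theta> \<sigma> \<xi> = avg s b (\<lambda>y. y) \<xi>"
  unfolding eq_mean_def by (rule integral_eq_density)

lemma nn_integral_eq_measure: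
  assumes f: "exp_growth f" "\<And>y. 0 \<le> f y"
  shows "(\<integral>\<^sup>+y. ennreal (f y) \<partial>eq_measure h \<theta> \<sigma> \<xi>) = ennreal (avg s b f \<xi>)"
proof -
  have [measurable]: "f \<in> borel_measurable borel" using f(1) by (rule exp_growth_measurable)
  have "(\<integral>\<^sup>+y. ennreal (f y) \<partial>eq_measure h \<theta> \<sigma> \<xi>) = (\<integral>\<^sup>+y. ennreal (f y * eq_density h \<theta> \<sigma> \<xi> y) \<partial>lborel)"
    unfolding eq_measure_def using f(2) eq_density_nonneg
    by (subst nn_integral_density) (auto simp: ennreal_mult[symmetric] mult.commute)
  also have "\<dots> = ennreal (LINT y|lborel. f y * eq_density h \<theta> \<sigma> \<xi> y)"
  proof (rule nn_integral_eq_integral)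
    have "integrable lborel (\<lambda>y. (1 / mom s b (\<lambda>_. 1) \<xi>) * (f y * wt s b \<xi> y))"
      by (intro integrable_mult_right exp_growth_integrable[OF s_pos f(1) b_bounds])
    then show "integrable lborel (\<lambda>y. f y * eq_density h \<theta> \<sigma> \<xi> y)" unfolding eq_density_eq by simp
  qed (use f(2) eq_density_nonneg in auto)
  finally show ?thesis unfolding integral_eq_density .
qed

lemma integrable_eq_measure: assumes f: "exp_growth f" shows "integrable (eq_measure h \<theta> \<sigma> \<xi>) f"
proof -
  have [measurable]: "f \<in> borel_measurable borel" using f by (rule exp_growth_measurable)
  have "integrable lborel (\<lambda>y. (1 / mom s b (\<lambda>_. 1) \<xi>) * (f y * wt s b \<xi> y))"
    by (intro integrable_mult_right exp_growth_integrable[OF s_pos f b_bounds])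
  then have "integrable lborel (\<lambda>y. eq_density h \<theta> \<sigma> \<xi> y *\<^sub>R f y)" unfolding eq_density_eq by (simp add: mult.commute)
  then show ?thesis unfolding eq_measure_def
    by (subst integrable_density) (auto simp: eq_density_nonneg)
qed

lemma real_distribution_eq_measure: "real_distribution (eq_measure h \<theta> \<sigma> \<xi>)"
proof -
  have "emeasure (eq_measure h \<theta> \<sigma> \<xi>) (space (eq_measure h \<theta> \<sigma> \<xi>)) = 1"
    using nn_integral_eq_measure[of "\<lambda>_. 1" \<xi>] by (simp add: avg_const[OF sb])
  then interpret prob_space "eq_measure h \<theta> \<sigma> \<xi>" by (rule prob_spaceI)
  show ?thesis by unfold_locales (simp_all add: eq_measure_def)
qed

lemma measure_eq_measure: "B \<in> sets borel \<Longrightarrow> measure (eq_measure h \<theta> \<sigma> \<xi>) B = avg s b (indicator B) \<xi>"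
proof -
  assume B: "B \<in> sets borel"
  interpret real_distribution "eq_measure h \<theta> \<sigma> \<xi>" by (rule real_distribution_eq_measure)
  have "measure (eq_measure h \<theta> \<sigma> \<xi>) B = pairing (eq_measure h \<theta> \<sigma> \<xi>) (indicator B)"
    using B by (simp add: pairing_def)
  then show ?thesis using B by (simp add: pairing_eq_measure)
qed

lemma phi_moment_eq_measure:
  "\<kappa> \<ge> 0 \<Longrightarrow> phi_moment \<kappa> (eq_measure h \<theta> \<sigma> \<xi>) = ennreal (avg s b (\<lambda>y. 1 + y\<^sup>2 + \<kappa> * y^4) \<xi>)"
  unfolding phi_moment_def by (intro nn_integral_eq_measure exp_growth_intros) auto

text \<open>By \<open>avg_shift\<close> the defect of the compatibility equation is - s b times the
  average of \<open>U\<close>, and s b > 0.\<close>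

lemma compatible_iff: "h > 0 \<Longrightarrow> compatible h \<theta> \<sigma> \<xi> \<longleftrightarrow> mom s b U \<xi> = 0"
proof -
  assume "h > 0"
  then have "s * b > 0" using \<theta> \<sigma> by (simp add: s_eq b_eq)
  then have "compatible h \<theta> \<sigma> \<xi> \<longleftrightarrow> avg s b U \<xi> = 0"
    unfolding compatible_def eq_mean_eq using avg_shift[OF sb, of \<xi>] by (auto simp: algebra_simps)
  then show ?thesis using mom_one_pos[OF sb, of \<xi>] by (simp add: avg_def)
qed

lemma eq_measure_continuity:
  fixes \<xi> :: "nat \<Rightarrow> real"
  assumes \<kappa>: "\<kappa> \<ge> 0" and R: "\<And>n. \<bar>\<xi> n\<bar> \<le> R" "\<bar>\<zeta>\<bar> \<le> R" and lim: "\<xi> \<longlonglongrightarrow> \<zeta>"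
  shows "M_inf_tendsto \<kappa> (\<lambda>n. eq_measure h \<theta> \<sigma> (\<xi> n)) (eq_measure h \<theta> \<sigma> \<zeta>)"
  unfolding M_inf_tendsto_def
proof
  obtain L where L: "L > 0" "\<forall>b \<xi> \<zeta> f. 0 \<le> b \<and> b \<le> 1 \<and> \<bar>\<xi>\<bar> \<le> R \<and> \<bar>\<zeta>\<bar> \<le> R \<and> f \<in> borel_measurable borel \<and> (\<forall>y. \<bar>f y\<bar> \<le> 1)
    \<longrightarrow> \<bar>avg s b f \<xi> - avg s b f \<zeta>\<bar> \<le> L * \<bar>\<xi> - \<zeta>\<bar>"
    using avg_Lipschitz[OF s_pos, of R] by (elim exE conjE) simp
  \<comment> \<open>The summand 1 / (n + 1) keeps the bound positive when \<xi> n = \<zeta>.\<close>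
  let ?\<delta> = "\<lambda>n. L * \<bar>\<xi> n - \<zeta>\<bar> + 1 / real (Suc n)"
  have P: "0 \<le> prohorov (eq_measure h \<theta> \<sigma> (\<xi> n)) (eq_measure h \<theta> \<sigma> \<zeta>) \<and>
      prohorov (eq_measure h \<theta> \<sigma> (\<xi> n)) (eq_measure h \<theta> \<sigma> \<zeta>) \<le> ?\<delta> n" for n
  proof -
    have "0 < ?\<delta> n" using L(1) by (intro add_nonneg_pos) auto
    moreover have "\<bar>measure (eq_measure h \<theta> \<sigma> (\<xi> n)) B - measure (eq_measure h \<theta> \<sigma> \<zeta>) B\<bar> \<le> ?\<delta> n" if B: "B \<in> sets borel" for B
    proof -
      have "\<bar>avg s b (indicator B) (\<xi> n) - avg s b (indicator B) \<zeta>\<bar> \<le> L * \<bar>\<xi> n - \<zeta>\<bar>"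
        using L(2)[THEN spec, of b, THEN spec, of "\<xi> n", THEN spec, of \<zeta>, THEN spec, of "indicator B"] b_bounds R B
        by (auto simp: indicator_def)
      then show ?thesis unfolding measure_eq_measure[OF B] by (simp add: add_increasing2)
    qed
    ultimately show ?thesis
      using prohorov_le[OF real_distribution_eq_measure real_distribution_eq_measure] by blast
  qed
  have lim\<delta>: "?\<delta> \<longlonglongrightarrow> L * \<bar>\<zeta> - \<zeta>\<bar> + 0"
    by (intro tendsto_add tendsto_mult tendsto_const tendsto_rabs tendsto_diff lim LIMSEQ_Suc[OF lim_1_over_n])
  show "(\<lambda>n. prohorov (eq_measure h \<theta> \<sigma> (\<xi> n)) (eq_measure h \<theta> \<sigma> \<zeta>)) \<longlonglongrightarrow> 0"
  proof (rule real_tendsto_sandwich[where f = "\<lambda>_. 0" and h = ?\<delta>])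
    show "?\<delta> \<longlonglongrightarrow> 0" using lim\<delta> by simp
  qed (use P in simp_all)
  have gq: "exp_growth (\<lambda>y. 1 + y\<^sup>2 + \<kappa> * y^4)" by (intro exp_growth_intros)
  obtain K where K: "K > 0" "\<And>b \<xi>. 0 \<le> b \<Longrightarrow> b \<le> 1 \<Longrightarrow> \<bar>\<xi>\<bar> \<le> R \<Longrightarrow> avg s b (\<lambda>y. \<bar>1 + y\<^sup>2 + \<kappa> * y^4\<bar>) \<xi> \<le> K"
    using avg_bounded[OF s_pos gq, of R] by blast
  have "phi_moment \<kappa> (eq_measure h \<theta> \<sigma> (\<xi> n)) \<le> ennreal K" for n
    using K(2)[OF b_bounds R(1), of n] \<kappa> by (simp add: phi_moment_eq_measure ennreal_leI)
  then have "(SUP n. phi_moment \<kappa> (eq_measure h \<theta> \<sigma> (\<xi> n))) \<le> ennreal K" by (rule SUP_least)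
  then show "(SUP n. phi_moment \<kappa> (eq_measure h \<theta> \<sigma> (\<xi> n))) < \<infinity>" by (rule le_less_trans) simp
qed


text \<open>Speed v and point \<xi> are arbitrary: the equilibria met on the way are not compatible
  in general, and their residual mean-field force is the source of the term h K.\<close>

lemma rate_functional_bound:
  assumes f: "f \<in> test_fun" and C: "C > 0" "avg s b (\<lambda>y. (f y - f 0)\<^sup>2) \<xi> \<le> C * avg s b (\<lambda>y. (deriv f y)\<^sup>2) \<xi>"
    and K: "\<bar>avg s b U \<xi>\<bar> \<le> K" "avg s b (\<lambda>y. (U y)\<^sup>2) \<xi> \<le> K"
  shows "(v * ((avg s b (\<lambda>y. f y * y) \<xi> - avg s b f \<xi> * avg s b (\<lambda>y. y) \<xi>) / s)
      - L_star \<theta> \<sigma> (eq_measure h \<theta> \<sigma> \<xi>) f - h * M_star (eq_measure h \<theta> \<sigma> \<xi>) f)\<^sup>2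
    \<le> (\<bar>v\<bar> + b * \<bar>v\<bar> * sqrt (C * K) + h * K)\<^sup>2 * avg s b (\<lambda>y. (deriv f y)\<^sup>2) \<xi>"
proof -
  let ?a = "\<lambda>f. avg s b f \<xi>"
  let ?f1 = "deriv f" and ?f2 = "deriv (deriv f)"
  let ?W = "\<lambda>y. (y - \<xi>) / s + b * U y"
  let ?m = "?a (\<lambda>y. y)" and ?Y = "?a (\<lambda>y. (?f1 y)\<^sup>2)" and ?u = "?a U"
  have f1: "?f1 \<in> test_fun" and f2: "?f2 \<in> test_fun" using f test_fun_deriv by auto
  note g = exp_growth_test_fun[OF f] exp_growth_test_fun[OF f1] exp_growth_test_fun[OF f2]
  have D: "\<And>y. (f has_real_derivative ?f1 y) (at y)" "\<And>y. (?f1 has_real_derivative ?f2 y) (at y)"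
    using smooth_DERIV[OF test_fun_smooth] f f1 by auto
  note gi = exp_growth_intros exp_growth_U g
  have a_lin: "?a (\<lambda>y. k y * ?W y) = (?a (\<lambda>y. k y * y) - \<xi> * ?a k) / s + b * ?a (\<lambda>y. k y * U y)" if k: "exp_growth k" for k
  proof -
    have "(\<lambda>y. k y * ?W y) = (\<lambda>y. (1 / s * (k y * y) - \<xi> / s * k y) + b * (k y * U y))"
      by (intro ext) (simp add: diff_divide_distrib algebra_simps)
    moreover have "?a (\<lambda>y. (1 / s * (k y * y) - \<xi> / s * k y) + b * (k y * U y)) = (1 / s * ?a (\<lambda>y. k y * y) - \<xi> / s * ?a k) + b * ?a (\<lambda>y. k y * U y)"
    proof -
      have g1: "exp_growth (\<lambda>y. 1 / s * (k y * y))" "exp_growth (\<lambda>y. \<xi> / s * k y)" "exp_growth (\<lambda>y. b * (k y * U y))"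
        by (intro exp_growth_intros exp_growth_U k)+
      show ?thesis
        by (simp only: avg_add[OF sb exp_growth_diff[OF g1(1,2)] g1(3)] avg_diff[OF sb g1(1,2)] avg_cmult[OF sb])
    qed
    ultimately show ?thesis by (simp add: diff_divide_distrib)
  qed
  have shift: "?m - \<xi> = - (s * b) * ?u" by (rule avg_shift[OF sb])
  have ip1: "?a ?f1 = (?a (\<lambda>y. f y * y) - \<xi> * ?a f) / s + b * ?a (\<lambda>y. f y * U y)"
    unfolding avg_integration_by_parts[OF sb g(1,2) D(1)] by (rule a_lin[OF g(1)])
  have ip2: "?a ?f2 = (?a (\<lambda>y. ?f1 y * y) - \<xi> * ?a ?f1) / s + b * ?a (\<lambda>y. ?f1 y * U y)"
    unfolding avg_integration_by_parts[OF sb g(2,3) D(2)] by (rule a_lin[OF g(2)])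
  define c where "c = ?a (\<lambda>y. f y * U y) - ?a f * ?u"
  \<comment> \<open>Integration by parts trades the covariance with y for the average of f', up to b
    times the covariance c with \<open>U\<close>; replacing \<xi> by the true mean completes
    c.\<close>
  have cov: "(?a (\<lambda>y. f y * y) - ?a f * ?m) / s = ?a ?f1 - b * c"
  proof -
    have m: "?m = \<xi> - s * b * ?u" using shift by simp
    have "?a f * ?m = \<xi> * ?a f - s * b * ?u * ?a f" unfolding m by (simp add: algebra_simps)
    then show ?thesis unfolding ip1 c_def using s_pos by (simp add: field_simps)
  qed
  have meas: "\<And>k. exp_growth k \<Longrightarrow> pairing (eq_measure h \<theta> \<sigma> \<xi>) k = ?a k"
    by (intro pairing_eq_measure exp_growth_measurable)
  have L: "L_star \<theta> \<sigma> (eq_measure h \<theta> \<sigma> \<xi>) f = 1/2 * \<sigma>\<^sup>2 * ?a ?f2 - \<theta> * (?a (\<lambda>y. ?f1 y * y) - ?m * ?a ?f1)"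
  proof -
    have "?a (\<lambda>y. (y - ?m) * ?f1 y) = ?a (\<lambda>y. ?f1 y * y - ?m * ?f1 y)" by (simp add: algebra_simps)
    also have "\<dots> = ?a (\<lambda>y. ?f1 y * y) - ?m * ?a ?f1"
    proof -
      have "exp_growth (\<lambda>y. ?f1 y * y)" "exp_growth (\<lambda>y. ?m * ?f1 y)" by (intro gi)+
      then show ?thesis by (simp only: avg_diff[OF sb] avg_cmult[OF sb])
    qed
    finally have e: "?a (\<lambda>y. (y - ?m) * ?f1 y) = ?a (\<lambda>y. ?f1 y * y) - ?m * ?a ?f1" .
    have "exp_growth (\<lambda>y. (y - ?m) * ?f1 y)" by (intro gi)
    then show ?thesis unfolding L_star_def D_y_def mult_distr_def meas[OF exp_growth_ident] meas[OF g(3)]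
      using e by (simp add: meas right_diff_distrib)
  qed
  have M: "M_star (eq_measure h \<theta> \<sigma> \<xi>) f = - ?a (\<lambda>y. ?f1 y * U y)"
  proof -
    have "exp_growth (\<lambda>y. U y * ?f1 y)" by (intro gi)
    then show ?thesis unfolding M_star_def D_y_def mult_distr_def by (simp add: meas mult.commute)
  qed
  \<comment> \<open>Were the mean equal to \<xi>, the equilibrium would be stationary. What survives
    is the force \<theta> (m - \<xi>), which \<open>avg_shift\<close> turns into - h times the
    average of \<open>U\<close>.\<close>
  have LM: "L_star \<theta> \<sigma> (eq_measure h \<theta> \<sigma> \<xi>) f + h * M_star (eq_measure h \<theta> \<sigma> \<xi>) f = - h * ?u * ?a ?f1"
  proof -
    have p1: "1/2 * \<sigma>\<^sup>2 * (z / s) = \<theta> * z" for z using \<theta> \<sigma> by (simp add: s_eq field_simps)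
    have p2: "1/2 * \<sigma>\<^sup>2 * b = h" using \<sigma> by (simp add: b_eq)
    have "1/2 * \<sigma>\<^sup>2 * ?a ?f2 = \<theta> * (?a (\<lambda>y. ?f1 y * y) - \<xi> * ?a ?f1) + h * ?a (\<lambda>y. ?f1 y * U y)"
      unfolding ip2 distrib_left p1 p2[symmetric] by (simp add: mult.assoc)
    then have "L_star \<theta> \<sigma> (eq_measure h \<theta> \<sigma> \<xi>) f + h * M_star (eq_measure h \<theta> \<sigma> \<xi>) f = \<theta> * (?m - \<xi>) * ?a ?f1"
      unfolding L M by (simp add: algebra_simps)
    also have "\<theta> * (?m - \<xi>) = - h * ?u" unfolding shift using \<theta> \<sigma> by (simp add: s_eq b_eq field_simps)
    finally show ?thesis .
  qed
  have Y: "?Y \<ge> 0" by (rule avg_nonneg[OF sb]) simp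
  have b1: "\<bar>?a ?f1\<bar> \<le> sqrt ?Y"
  proof (rule real_le_rsqrt)
    show "\<bar>?a ?f1\<bar>\<^sup>2 \<le> ?Y" using avg_Cauchy_Schwarz[OF sb g(2) exp_growth_const[of 1], of \<xi>] by (simp add: avg_const[OF sb])
  qed
  have b2: "\<bar>c\<bar> \<le> sqrt (C * K) * sqrt ?Y"
  proof -
    let ?F = "\<lambda>y. f y - f 0" and ?V = "\<lambda>y. U y - ?u"
    \<comment> \<open>A covariance does not change when constants are subtracted; this brings in f -
      f 0, which the Poincare inequality controls.\<close>
    have c1: "?a (\<lambda>y. ?F y * ?V y) = c"
    proof -
      have "(\<lambda>y. ?F y * ?V y) = (\<lambda>y. (f y * U y - ?u * f y) - (f 0 * U y - f 0 * ?u))" by (intro ext) (simp add: algebra_simps)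
      moreover have "?a (\<lambda>y. (f y * U y - ?u * f y) - (f 0 * U y - f 0 * ?u)) = (?a (\<lambda>y. f y * U y) - ?u * ?a f) - (f 0 * ?u - f 0 * ?u)"
      proof -
        have g1: "exp_growth (\<lambda>y. f y * U y)" "exp_growth (\<lambda>y. ?u * f y)" "exp_growth (\<lambda>y. f 0 * U y)" "exp_growth (\<lambda>y. f 0 * ?u)"
          by (intro gi)+
        show ?thesis
          by (simp only: avg_diff[OF sb exp_growth_diff[OF g1(1,2)] exp_growth_diff[OF g1(3,4)]] avg_diff[OF sb g1(1,2)]
              avg_diff[OF sb g1(3,4)] avg_cmult[OF sb] avg_const[OF sb])
      qed
      ultimately show ?thesis by (simp add: c_def)
    qed
    have c2: "?a (\<lambda>y. (?V y)\<^sup>2) \<le> K"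
    proof -
      have "(\<lambda>y. (?V y)\<^sup>2) = (\<lambda>y. (U y)\<^sup>2 - (2 * ?u * U y - ?u\<^sup>2))" by (intro ext) (simp add: power2_eq_square algebra_simps)
      moreover have "?a (\<lambda>y. (U y)\<^sup>2 - (2 * ?u * U y - ?u\<^sup>2)) = ?a (\<lambda>y. (U y)\<^sup>2) - (2 * ?u * ?u - ?u\<^sup>2)"
      proof -
        have g1: "exp_growth (\<lambda>y. (U y)\<^sup>2)" "exp_growth (\<lambda>y. 2 * ?u * U y)" "exp_growth (\<lambda>y. ?u\<^sup>2)"
          by (intro exp_growth_intros exp_growth_U)+
        show ?thesis
          by (simp only: avg_diff[OF sb g1(1) exp_growth_diff[OF g1(2,3)]] avg_diff[OF sb g1(2,3)] avg_cmult[OF sb] avg_const[OF sb])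
      qed
      ultimately show ?thesis using K(2) by (simp add: power2_eq_square) (smt (verit) zero_le_square)
    qed
    have "c\<^sup>2 \<le> ?a (\<lambda>y. (?F y)\<^sup>2) * ?a (\<lambda>y. (?V y)\<^sup>2)"
      unfolding c1[symmetric] by (rule avg_Cauchy_Schwarz[OF sb]; intro gi)
    also have "\<dots> \<le> (C * ?Y) * K"
      by (intro mult_mono C c2 avg_nonneg[OF sb] mult_nonneg_nonneg Y) (use C in auto)
    finally have "\<bar>c\<bar> \<le> sqrt (C * ?Y * K)" using real_le_rsqrt[of "\<bar>c\<bar>"] by simp
    also have "C * ?Y * K = C * K * ?Y" by simp
    finally show ?thesis by (simp only: real_sqrt_mult)
  qed
  let ?X = "v * ((?a (\<lambda>y. f y * y) - ?a f * ?m) / s) - L_star \<theta> \<sigma> (eq_measure h \<theta> \<sigma> \<xi>) f - h * M_star (eq_measure h \<theta> \<sigma> \<xi>) f"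
  have K0: "K \<ge> 0" using K(1) by linarith
  have "?X = v * ?a ?f1 - b * v * c + h * ?u * ?a ?f1" using LM unfolding cov by (simp add: algebra_simps)
  then have "\<bar>?X\<bar> \<le> \<bar>v * ?a ?f1\<bar> + \<bar>b * v * c\<bar> + \<bar>h * ?u * ?a ?f1\<bar>" by linarith
  also have "\<dots> \<le> \<bar>v\<bar> * sqrt ?Y + b * \<bar>v\<bar> * (sqrt (C * K) * sqrt ?Y) + h * K * sqrt ?Y"
  proof (intro add_mono)
    show "\<bar>v * ?a ?f1\<bar> \<le> \<bar>v\<bar> * sqrt ?Y" unfolding abs_mult using b1 by (intro mult_left_mono) auto
    show "\<bar>b * v * c\<bar> \<le> b * \<bar>v\<bar> * (sqrt (C * K) * sqrt ?Y)"
      unfolding abs_mult using b2 b_bounds by (simp add: mult_left_mono)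
    show "\<bar>h * ?u * ?a ?f1\<bar> \<le> h * K * sqrt ?Y"
      unfolding abs_mult using b1 K(1) h K0 by (intro mult_mono) auto
  qed
  also have "\<dots> = (\<bar>v\<bar> + b * \<bar>v\<bar> * sqrt (C * K) + h * K) * sqrt ?Y" by (simp only: distrib_right mult.assoc)
  finally have "\<bar>?X\<bar>\<^sup>2 \<le> ((\<bar>v\<bar> + b * \<bar>v\<bar> * sqrt (C * K) + h * K) * sqrt ?Y)\<^sup>2" by (intro power_mono) auto
  then show ?thesis using Y by (simp only: power2_abs power_mult_distrib real_sqrt_pow2)
qed

end

section \<open>The upper bound\<close>

lemma abs_cont_on_linear: "abs_cont_on a b (\<lambda>t. c * t)"
  unfolding abs_cont_on_iff
proof (intro allI impI)
  fix e :: real assume e: "e > 0"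
  have "variation_sum (\<lambda>t. c * t) P < e" if P: "interval_family a b P \<and> (\<Sum>(u, v)\<in>P. v - u) < e / (\<bar>c\<bar> + 1)" for P
  proof -
    have "variation_sum (\<lambda>t. c * t) P = (\<Sum>(u, v)\<in>P. \<bar>c\<bar> * (v - u))"
      unfolding variation_sum_def
    proof (intro sum.cong refl)
      fix p assume p: "p \<in> P"
      obtain u v where uv: "p = (u, v)" by fastforce
      then have "u < v" using interval_familyD(3) P p by blast
      then show "(case p of (u, v) \<Rightarrow> \<bar>c * v - c * u\<bar>) = (case p of (u, v) \<Rightarrow> \<bar>c\<bar> * (v - u))"
        using uv by (simp add: right_diff_distrib[symmetric] abs_mult)
    qed
    also have "\<dots> = \<bar>c\<bar> * (\<Sum>(u, v)\<in>P. v - u)" by (simp add: sum_distrib_left case_prod_unfold)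
    also have "\<dots> \<le> \<bar>c\<bar> * (e / (\<bar>c\<bar> + 1))" using P by (intro mult_left_mono) auto
    also have "\<dots> < e" using e by (simp add: field_simps)
    finally show ?thesis .
  qed
  then show "\<exists>d>0. \<forall>P. interval_family a b P \<and> (\<Sum>(u, v)\<in>P. v - u) < d \<longrightarrow> variation_sum (\<lambda>t. c * t) P < e"
    using e by (intro exI[of _ "e / (\<bar>c\<bar> + 1)"]) auto
qed

text \<open>The competitor is the family of equilibria \<open>u\<^sup>e\<^sub>\<xi>\<close> with \<open>\<xi>\<close> moving linearly from
  \<open>-\<xi>\<^sub>b\<close> to \<open>\<xi>\<^sub>b\<close>.\<close>

lemma rate_upper_bound:
  fixes T \<theta> \<sigma> R :: real
  assumes T: "T > 0" and \<theta>: "\<theta> > 0" and \<sigma>: "\<sigma> > 0"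
  shows "\<exists>K\<ge>0. \<forall>h \<kappa> \<xi>. 0 \<le> h \<and> 2 * h / \<sigma>\<^sup>2 \<le> 1 \<and> 0 \<le> \<kappa> \<and> 0 \<le> \<xi> \<and> \<xi> \<le> R \<longrightarrow>
    (\<exists>\<phi>\<in>transition_paths \<kappa> h \<theta> \<sigma> T \<xi>. rate h \<theta> \<sigma> T \<phi> \<le> ennreal (T / (2 * \<sigma>\<^sup>2) * (2 * \<xi> / T + K * h)\<^sup>2))"
proof -
  define s where "s = \<sigma>\<^sup>2 / (2 * \<theta>)"
  have s: "s > 0" using \<theta> \<sigma> by (simp add: s_def)
  obtain K1 where K1: "K1 > 0" "\<And>b \<xi>. 0 \<le> b \<Longrightarrow> b \<le> 1 \<Longrightarrow> \<bar>\<xi>\<bar> \<le> R \<Longrightarrow> avg s b (\<lambda>y. \<bar>U y\<bar>) \<xi> \<le> K1"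
    using avg_bounded[OF s exp_growth_U, of R] by blast
  obtain K2 where K2: "K2 > 0" "\<And>b \<xi>. 0 \<le> b \<Longrightarrow> b \<le> 1 \<Longrightarrow> \<bar>\<xi>\<bar> \<le> R \<Longrightarrow> avg s b (\<lambda>y. \<bar>(U y)\<^sup>2\<bar>) \<xi> \<le> K2"
    using avg_bounded[OF s exp_growth_power[OF exp_growth_U, of 2], of R] by blast
  define Ku where "Ku = max K1 K2"
  define C where "C = 8 * (exp (R\<^sup>2 / s + 1 / 4) * sqrt (4 * pi * s))\<^sup>2"
  have C: "C > 0" using s by (simp add: C_def)
  have Ku: "Ku > 0" using K1(1) by (simp add: Ku_def)
  \<comment> \<open>2 / \<sigma>^2 converts b into h, 2 |R| / T bounds the speed; the last
    \<open>Ku\<close> bounds the average of \<open>U\<close>.\<close>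
  define K where "K = 2 / \<sigma>\<^sup>2 * (2 * \<bar>R\<bar> / T) * sqrt (C * Ku) + Ku"
  have K0: "K \<ge> 0" using C Ku T by (simp add: K_def)
  show ?thesis
  proof (intro exI[of _ K] conjI K0 allI impI)
    fix h \<kappa> \<xi> :: real
    assume asm: "0 \<le> h \<and> 2 * h / \<sigma>\<^sup>2 \<le> 1 \<and> 0 \<le> \<kappa> \<and> 0 \<le> \<xi> \<and> \<xi> \<le> R"
    define b where "b = 2 * h / \<sigma>\<^sup>2"
    have h: "0 \<le> h" "2 * h / \<sigma>\<^sup>2 \<le> 1" using asm by auto
    note loc = \<theta> \<sigma> h s_def b_def
    have b: "0 \<le> b" "b \<le> 1" using h by (simp_all add: b_def)
    define v where "v = 2 * \<xi> / T"
    define x where "x t = v * t - \<xi>" for t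
    define \<phi> where "\<phi> t = eq_measure h \<theta> \<sigma> (x t)" for t
    have v0: "v \<ge> 0" using asm T by (simp add: v_def)
    have xb: "\<bar>x t\<bar> \<le> R" if "t \<in> {0..T}" for t
    proof -
      have "v * t \<le> v * T" using that v0 by (intro mult_left_mono) auto
      moreover have "v * T = 2 * \<xi>" using T by (simp add: v_def)
      moreover have "0 \<le> v * t" using that v0 by simp
      ultimately show ?thesis using asm by (simp add: x_def abs_le_iff)
    qed
    have xT: "x 0 = - \<xi>" "x T = \<xi>" using T by (simp_all add: x_def v_def)
    have "\<phi> \<in> path_space \<kappa> T"
      unfolding path_space_def
    proof (intro CollectI conjI ballI allI impI)
      fix t assume "t \<in> {0..T}"
      show "\<phi> t \<in> M_inf \<kappa>"
        using real_distribution_eq_measure[OF loc] phi_moment_eq_measure[OF loc, of \<kappa>] asm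
        by (simp add: M_inf_def \<phi>_def)
    next
      fix t sq assume t: "t \<in> {0..T}" and sq: "(\<forall>n. sq n \<in> {0..T}) \<and> sq \<longlonglongrightarrow> t"
      then have "(\<lambda>n. x (sq n)) \<longlonglongrightarrow> x t" unfolding x_def by (intro tendsto_intros) auto
      then show "M_inf_tendsto \<kappa> (\<lambda>n. \<phi> (sq n)) (\<phi> t)"
        unfolding \<phi>_def using asm sq t by (intro eq_measure_continuity[OF loc, of \<kappa> _ R] xb) auto
    qed
    then have path: "\<phi> \<in> transition_paths \<kappa> h \<theta> \<sigma> T \<xi>"
      by (simp add: transition_paths_def paths_from_def \<phi>_def xT)
    obtain L where L: "L > 0" "\<forall>b \<xi> \<zeta> f. 0 \<le> b \<and> b \<le> 1 \<and> \<bar>\<xi>\<bar> \<le> R \<and> \<bar>\<zeta>\<bar> \<le> R \<and> f \<in> borel_measurable borel \<and> (\<forall>y. \<bar>f y\<bar> \<le> 1)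
      \<longrightarrow> \<bar>avg s b f \<xi> - avg s b f \<zeta>\<bar> \<le> L * \<bar>\<xi> - \<zeta>\<bar>"
      using avg_Lipschitz[OF s, of R] by (elim exE conjE) simp
    have ac: "abs_cont_path T \<phi>"
      unfolding abs_cont_path_def
    proof (intro allI impI)
      fix Kc :: "real set" assume "compact Kc"
      \<comment> \<open>A neighbourhood of order 0: the Lipschitz bound needs only the supremum of
        f.\<close>
      let ?W = "{f \<in> test_fun_on Kc. \<forall>y. \<bar>f y\<bar> < 1}" and ?H = "\<lambda>t. (L * v) * t"
      have fK: "f \<in> test_fun" if "f \<in> test_fun_on Kc" for f using that \<open>compact Kc\<close> by (auto simp: test_fun_def)
      have "test_nhd Kc ?W" unfolding test_nhd_def
        by (intro conjI exI[of _ 0] exI[of _ "1::real"]) auto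
      moreover have "\<bar>pairing (\<phi> t) f - pairing (\<phi> r) f\<bar> \<le> \<bar>?H t - ?H r\<bar>" if "r \<in> {0..T}" "t \<in> {0..T}" "f \<in> ?W" for r t f
      proof -
        have f: "f \<in> borel_measurable borel" using exp_growth_measurable[OF exp_growth_test_fun[OF fK]] that(3) by blast
        have "\<bar>avg s b f (x t) - avg s b f (x r)\<bar> \<le> L * \<bar>x t - x r\<bar>"
          using L(2)[THEN spec, of b, THEN spec, of "x t", THEN spec, of "x r", THEN spec, of f] b xb that f
          by (auto simp: less_imp_le)
        also have "\<dots> = \<bar>?H t - ?H r\<bar>"
          using L(1) v0 by (simp add: x_def right_diff_distrib[symmetric] abs_mult)
        finally show ?thesis unfolding \<phi>_def pairing_eq_measure[OF loc f] .
      qed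
      ultimately show "\<exists>W H. test_nhd Kc W \<and> abs_cont_on 0 T H \<and> (\<forall>s\<in>{0..T}. \<forall>t\<in>{0..T}. \<forall>f\<in>W.
          \<bar>pairing (\<phi> t) f - pairing (\<phi> s) f\<bar> \<le> \<bar>H t - H s\<bar>)"
        using abs_cont_on_linear by (intro exI[of _ ?W] exI[of _ ?H]) auto
    qed
    define c where "c = 2 * \<xi> / T + K * h"
    have c0: "c \<ge> 0" using asm T K0 by (simp add: c_def)
    have J: "rate_integrand h \<theta> \<sigma> \<phi> t \<le> ennreal (c\<^sup>2)" if t: "t \<in> {0..T}" for t
      unfolding rate_integrand_def
    proof (rule SUP_least)
      fix f assume "f \<in> {f \<in> test_fun. pairing (\<phi> t) (\<lambda>y. (deriv f y)\<^sup>2) \<noteq> 0}"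
      then have f: "f \<in> test_fun" and nz: "pairing (\<phi> t) (\<lambda>y. (deriv f y)\<^sup>2) \<noteq> 0" by auto
      have g: "exp_growth f" "exp_growth (deriv f)" using f test_fun_deriv exp_growth_test_fun by auto
      have Y: "pairing (\<phi> t) (\<lambda>y. (deriv f y)\<^sup>2) = avg s b (\<lambda>y. (deriv f y)\<^sup>2) (x t)"
        unfolding \<phi>_def by (intro pairing_eq_measure[OF loc] exp_growth_measurable exp_growth_power g)
      have Y0: "pairing (\<phi> t) (\<lambda>y. (deriv f y)\<^sup>2) > 0"
        using nz avg_nonneg[OF s b, of "\<lambda>y. (deriv f y)\<^sup>2" "x t"] unfolding Y by simp
      obtain A where A: "\<And>y. y \<notin> {- A..A} \<Longrightarrow> f y = 0" using f unfolding test_fun_iff by blast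
      have P: "avg s b (\<lambda>y. (f y - f 0)\<^sup>2) (x t) \<le> C * avg s b (\<lambda>y. (deriv f y)\<^sup>2) (x t)"
        unfolding C_def
        by (rule poincare[OF s b xb[OF t] g smooth_DERIV[OF test_fun_smooth[OF f]] smooth_continuous[OF smooth_deriv[OF test_fun_smooth[OF f]]] A])
      have k1: "\<bar>avg s b U (x t)\<bar> \<le> Ku"
        using avg_abs_le[OF s b exp_growth_U, of "x t"] K1(2)[OF b xb[OF t]] by (simp add: Ku_def)
      have k2: "avg s b (\<lambda>y. (U y)\<^sup>2) (x t) \<le> Ku"
        using K2(2)[OF b xb[OF t]] by (simp add: Ku_def)
      have Dt: "D_t \<phi> t f = v * ((avg s b (\<lambda>y. f y * y) (x t) - avg s b f (x t) * avg s b (\<lambda>y. y) (x t)) / s)"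
      proof -
        have "(x has_real_derivative v) (at t)" unfolding x_def[abs_def] by (auto intro!: derivative_eq_intros)
        from DERIV_chain2[OF avg_DERIV[OF s b g(1)] this]
        have "((\<lambda>t. avg s b f (x t)) has_real_derivative (v * ((avg s b (\<lambda>y. f y * y) (x t) - avg s b f (x t) * avg s b (\<lambda>y. y) (x t)) / s))) (at t)"
          by (rule DERIV_cong) simp
        then show ?thesis
          unfolding D_t_def \<phi>_def pairing_eq_measure[OF loc exp_growth_measurable[OF g(1)]] by (rule DERIV_imp_deriv)
      qed
      have "(D_t \<phi> t f - L_star \<theta> \<sigma> (\<phi> t) f - h * M_star (\<phi> t) f)\<^sup>2
        \<le> (\<bar>v\<bar> + b * \<bar>v\<bar> * sqrt (C * Ku) + h * Ku)\<^sup>2 * pairing (\<phi> t) (\<lambda>y. (deriv f y)\<^sup>2)"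
        unfolding Dt Y unfolding \<phi>_def by (rule rate_functional_bound[OF loc f C P k1 k2])
      also have "\<dots> \<le> c\<^sup>2 * pairing (\<phi> t) (\<lambda>y. (deriv f y)\<^sup>2)"
      proof (intro mult_right_mono power_mono)
        have "b * \<bar>v\<bar> * sqrt (C * Ku) \<le> h * (2 / \<sigma>\<^sup>2 * (2 * \<bar>R\<bar> / T) * sqrt (C * Ku))"
        proof -
          have "\<bar>v\<bar> \<le> 2 * \<bar>R\<bar> / T" using asm T v0 by (simp add: v_def divide_right_mono)
          then have "b * \<bar>v\<bar> * sqrt (C * Ku) \<le> b * (2 * \<bar>R\<bar> / T) * sqrt (C * Ku)"
            using b C Ku by (intro mult_right_mono mult_left_mono) auto
          then show ?thesis by (simp add: b_def mult_ac)
        qed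
        then show "\<bar>v\<bar> + b * \<bar>v\<bar> * sqrt (C * Ku) + h * Ku \<le> c"
          using v0 by (simp add: c_def K_def v_def algebra_simps)
        show "0 \<le> \<bar>v\<bar> + b * \<bar>v\<bar> * sqrt (C * Ku) + h * Ku" using b C Ku h by simp
      qed (use Y0 in simp)
      finally show "ennreal ((D_t \<phi> t f - L_star \<theta> \<sigma> (\<phi> t) f - h * M_star (\<phi> t) f)\<^sup>2 / pairing (\<phi> t) (\<lambda>y. (deriv f y)\<^sup>2)) \<le> ennreal (c\<^sup>2)"
        using Y0 by (intro ennreal_leI) (simp add: pos_divide_le_eq)
    qed
    have "(\<integral>\<^sup>+t\<in>{0..T}. rate_integrand h \<theta> \<sigma> \<phi> t \<partial>lborel) \<le> (\<integral>\<^sup>+t\<in>{0..T}. ennreal (c\<^sup>2) \<partial>lborel)"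
      by (intro nn_integral_mono) (use J in \<open>auto simp: indicator_def\<close>)
    also have "\<dots> = ennreal (c\<^sup>2 * T)"
      using T by (simp add: nn_integral_cmult_indicator ennreal_mult)
    finally have "rate h \<theta> \<sigma> T \<phi> \<le> ennreal (1 / (2 * \<sigma>\<^sup>2)) * ennreal (c\<^sup>2 * T)"
      unfolding rate_def using ac by (simp add: mult_left_mono)
    also have "\<dots> = ennreal (T / (2 * \<sigma>\<^sup>2) * c\<^sup>2)"
      using T by (simp add: ennreal_mult[symmetric] mult.commute)
    finally show "\<exists>\<phi>\<in>transition_paths \<kappa> h \<theta> \<sigma> T \<xi>. rate h \<theta> \<sigma> T \<phi> \<le> ennreal (T / (2 * \<sigma>\<^sup>2) * (2 * \<xi> / T + K * h)\<^sup>2)"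
      using path unfolding c_def by blast
  qed
qed

section \<open>The lower bound\<close>

lemma abs_cont_on_cmult: assumes "abs_cont_on a b F" shows "abs_cont_on a b (\<lambda>t. c * F t)"
  unfolding abs_cont_on_iff
proof (intro allI impI)
  fix e :: real assume e: "e > 0"
  then have "e / (\<bar>c\<bar> + 1) > 0" by simp
  then obtain d where d: "d > 0" "\<And>P. interval_family a b P \<Longrightarrow> (\<Sum>(u, v)\<in>P. v - u) < d \<Longrightarrow> variation_sum F P < e / (\<bar>c\<bar> + 1)"
    using assms[unfolded abs_cont_on_iff] by blast
  have "variation_sum (\<lambda>t. c * F t) P < e" if P: "interval_family a b P \<and> (\<Sum>(u, v)\<in>P. v - u) < d" for P
  proof -
    have "variation_sum (\<lambda>t. c * F t) P = \<bar>c\<bar> * variation_sum F P"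
      by (simp add: variation_sum_def sum_distrib_left case_prod_unfold right_diff_distrib[symmetric] abs_mult)
    also have "\<dots> \<le> \<bar>c\<bar> * (e / (\<bar>c\<bar> + 1))" using d(2)[of P] P by (intro mult_left_mono) auto
    also have "\<dots> < e" using e by (simp add: field_simps)
    finally show ?thesis .
  qed
  then show "\<exists>d>0. \<forall>P. interval_family a b P \<and> (\<Sum>(u, v)\<in>P. v - u) < d \<longrightarrow> variation_sum (\<lambda>t. c * F t) P < e"
    using d(1) by blast
qed

lemma deriv_funpow_cmult: assumes "smooth f" shows "(deriv ^^ k) (\<lambda>x. c * f x) = (\<lambda>x. c * (deriv ^^ k) f x)"
proof (induction k)
  case (Suc k)
  have "smooth ((deriv ^^ k) f)" by (induction k) (use assms smooth_deriv in auto)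
  then have "deriv (\<lambda>x. c * (deriv ^^ k) f x) = (\<lambda>x. c * deriv ((deriv ^^ k) f) x)"
    by (intro ext DERIV_imp_deriv DERIV_cmult smooth_DERIV)
  then show ?case using Suc by simp
qed simp

lemma test_fun_derivs_bounded:
  assumes "f \<in> test_fun" shows "\<exists>B>0. \<forall>k\<le>N. \<forall>x. \<bar>(deriv ^^ k) f x\<bar> \<le> B"
proof (induction N)
  case 0
  obtain B where "B > 0" "\<And>x. \<bar>f x\<bar> \<le> B" using test_fun_bounded[OF assms] by blast
  then show ?case by auto
next
  case (Suc N)
  then obtain B where B: "B > 0" "\<forall>k\<le>N. \<forall>x. \<bar>(deriv ^^ k) f x\<bar> \<le> B" by blast
  have "(deriv ^^ Suc N) f \<in> test_fun" by (induction N) (use assms test_fun_deriv in auto)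
  then obtain B' where B': "B' > 0" "\<And>x. \<bar>(deriv ^^ Suc N) f x\<bar> \<le> B'" using test_fun_bounded by blast
  have "\<bar>(deriv ^^ k) f x\<bar> \<le> max B B'" if "k \<le> Suc N" for k x
    using B(2) B'(2)[of x] that by (cases "k = Suc N") (auto simp: le_max_iff_disj)
  then show ?case using B(1) by (intro exI[of _ "max B B'"]) auto
qed

text \<open>A neighbourhood of 0 contains a small multiple c f; the factor is removed afterwards by
  linearity.\<close>

lemma abs_cont_on_pairing:
  assumes \<phi>: "abs_cont_path T \<phi>" and f: "f \<in> test_fun" shows "abs_cont_on 0 T (\<lambda>t. pairing (\<phi> t) f)"
proof -
  obtain K where K: "compact K" "f \<in> test_fun_on K" using f by (auto simp: test_fun_def)
  obtain W H where WH: "test_nhd K W \<and> abs_cont_on 0 T H \<and> (\<forall>s\<in>{0..T}. \<forall>t\<in>{0..T}. \<forall>f\<in>W.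
      \<bar>pairing (\<phi> t) f - pairing (\<phi> s) f\<bar> \<le> \<bar>H t - H s\<bar>)"
    using \<phi>[unfolded abs_cont_path_def, THEN spec, THEN mp, OF K(1)] by (elim exE)
  then have W: "test_nhd K W" "abs_cont_on 0 T H"
    "\<And>s t f. s \<in> {0..T} \<Longrightarrow> t \<in> {0..T} \<Longrightarrow> f \<in> W \<Longrightarrow> \<bar>pairing (\<phi> t) f - pairing (\<phi> s) f\<bar> \<le> \<bar>H t - H s\<bar>"
    by simp_all
  obtain N e where Ne: "e > 0" "{f \<in> test_fun_on K. \<forall>k\<le>N. \<forall>x. \<bar>(deriv ^^ k) f x\<bar> < e} \<subseteq> W"
    using W(1) unfolding test_nhd_def by blast
  obtain B where B: "B > 0" "\<forall>k\<le>N. \<forall>x. \<bar>(deriv ^^ k) f x\<bar> \<le> B" using test_fun_derivs_bounded[OF f] by blast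
  define c where "c = e / (2 * B)"
  have c: "c > 0" using Ne B by (simp add: c_def)
  have sf: "smooth f" using f by (rule test_fun_smooth)
  have "(\<lambda>x. c * f x) \<in> W"
  proof (rule subsetD[OF Ne(2)], intro CollectI conjI allI impI)
    show "(\<lambda>x. c * f x) \<in> test_fun_on K" using K(2) unfolding test_fun_on_iff by (auto intro: smooth_cmult)
    fix k x assume "k \<le> N"
    then have "\<bar>c * (deriv ^^ k) f x\<bar> \<le> c * B" using B(2) c by (simp add: abs_mult)
    also have "\<dots> < e" using B(1) Ne(1) by (simp add: c_def)
    finally show "\<bar>(deriv ^^ k) (\<lambda>x. c * f x) x\<bar> < e" unfolding deriv_funpow_cmult[OF sf] .
  qed
  then have "abs_cont_on 0 T (\<lambda>t. pairing (\<phi> t) (\<lambda>x. c * f x))"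
    by (intro abs_cont_on_dominated[OF W(2)] W(3))
  then have "abs_cont_on 0 T (\<lambda>t. 1 / c * pairing (\<phi> t) (\<lambda>x. c * f x))" by (rule abs_cont_on_cmult)
  then show ?thesis using c by (simp add: pairing_def)
qed

text \<open>Through \<open>X\<^sup>2 \<ge> 2 \<lambda> X - \<lambda>\<^sup>2\<close>, a pointwise upper bound \<open>A\<close> on the drift terms suffices; in
  particular their measurability in \<open>t\<close> plays no role.\<close>

lemma action_lower_bound:
  assumes T: "T > 0" and \<phi>: "abs_cont_path T \<phi>" and f: "f \<in> test_fun"
    and prob: "\<And>t. t \<in> {0..T} \<Longrightarrow> real_distribution (\<phi> t)"
    and nz: "\<And>t. t \<in> {0..T} \<Longrightarrow> pairing (\<phi> t) (\<lambda>y. (deriv f y)\<^sup>2) \<noteq> 0"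
    and B: "B > 0" "\<And>y. \<bar>deriv f y\<bar> \<le> B"
    and A: "\<And>t. t \<in> {0..T} \<Longrightarrow> L_star \<theta> \<sigma> (\<phi> t) f + h * M_star (\<phi> t) f \<le> A"
    and D: "0 \<le> D" "D \<le> pairing (\<phi> T) f - pairing (\<phi> 0) f - T * A"
  shows "ennreal (D\<^sup>2 / (T * B\<^sup>2)) \<le> (\<integral>\<^sup>+t\<in>{0..T}. rate_integrand h \<theta> \<sigma> \<phi> t \<partial>lborel)"
proof -
  obtain g where g: "integrable lborel g" "(LINT t:{0..T}|lborel. g t) = pairing (\<phi> T) f - pairing (\<phi> 0) f"
    "AE t in lborel. t \<in> {0<..<T} \<longrightarrow> ((\<lambda>t. pairing (\<phi> t) f) has_real_derivative g t) (at t)"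
    using abs_cont_on_FTC[OF T abs_cont_on_pairing[OF \<phi> f]] by blast
  define D' where "D' = pairing (\<phi> T) f - pairing (\<phi> 0) f - T * A"
  \<comment> \<open>The optimal \<lambda>, the average speed D' / T: it turns 2 \<lambda> D' -
    \<lambda>^2 T into D'^2 / T.\<close>
  define l where "l = D' / T"
  have D': "0 \<le> D'" "D \<le> D'" using D by (auto simp: D'_def)
  have l: "l \<ge> 0" using D' T by (simp add: l_def)
  define q where "q t = (2 * l * (g t - A) - l\<^sup>2) / B\<^sup>2" for t
  have gi: "integrable lborel (\<lambda>t. indicator {0..T} t * g t)"
    using integrable_mult_indicator[OF _ g(1), of "{0..T}"] by simp
  have qe: "indicator {0..T} t * q t = (2 * l / B\<^sup>2) * (indicator {0..T} t * g t) - ((2 * l * A + l\<^sup>2) / B\<^sup>2) * indicator {0..T} t" for t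
    by (simp add: q_def indicator_def diff_divide_distrib add_divide_distrib algebra_simps)
  have qi: "integrable lborel (\<lambda>t. indicator {0..T} t * q t)"
    unfolding qe using T by (intro Bochner_Integration.integrable_diff integrable_mult_right gi) simp
  have "(LINT t|lborel. indicator {0..T} t * q t) = (2 * l / B\<^sup>2) * (D' + T * A) - ((2 * l * A + l\<^sup>2) / B\<^sup>2) * T"
    unfolding qe using T g(2) gi
    by (subst Bochner_Integration.integral_diff) (auto simp: set_lebesgue_integral_def D'_def)
  also have "\<dots> = (2 * l * D' - l\<^sup>2 * T) / B\<^sup>2" by (simp add: diff_divide_distrib add_divide_distrib algebra_simps)
  also have "2 * l * D' - l\<^sup>2 * T = D'\<^sup>2 / T" using T by (simp add: l_def power2_eq_square field_simps)
  also have "D'\<^sup>2 / T / B\<^sup>2 = D'\<^sup>2 / (T * B\<^sup>2)" by simp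
  finally have qI: "(LINT t|lborel. indicator {0..T} t * q t) = D'\<^sup>2 / (T * B\<^sup>2)" .
  have "ennreal (D\<^sup>2 / (T * B\<^sup>2)) \<le> ennreal (D'\<^sup>2 / (T * B\<^sup>2))"
    using D' D T B by (intro ennreal_leI divide_right_mono power_mono) auto
  \<comment> \<open>The positive part is taken because \<open>ennreal\<close> truncates negative
    values.\<close>
  also have "\<dots> \<le> ennreal (LINT t|lborel. max 0 (indicator {0..T} t * q t))"
    unfolding qI[symmetric] by (intro ennreal_leI integral_mono qi Bochner_Integration.integrable_max integrable_zero) auto
  also have "\<dots> = (\<integral>\<^sup>+t. ennreal (max 0 (indicator {0..T} t * q t)) \<partial>lborel)"
    by (rule nn_integral_eq_integral[symmetric]) (auto intro!: qi Bochner_Integration.integrable_max)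
  also have "\<dots> \<le> (\<integral>\<^sup>+t\<in>{0..T}. rate_integrand h \<theta> \<sigma> \<phi> t \<partial>lborel)"
  proof (rule nn_integral_mono_AE)
    \<comment> \<open>The derivative is known only in the open interval, so the endpoints are
      discarded.\<close>
    have "AE t in lborel. t \<noteq> 0" "AE t in lborel. t \<noteq> T" by (rule AE_lborel_singleton)+
    then show "AE t in lborel. ennreal (max 0 (indicator {0..T} t * q t)) \<le> rate_integrand h \<theta> \<sigma> \<phi> t * indicator {0..T} t"
      using g(3)
    proof eventually_elim
      case (elim t)
      show ?case
      proof (cases "t \<in> {0..T}")
        case True
        interpret real_distribution "\<phi> t" using prob[OF True] .
        have "((\<lambda>t. pairing (\<phi> t) f) has_real_derivative g t) (at t)" using elim True by auto
        then have Dt: "D_t \<phi> t f = g t" unfolding D_t_def by (rule DERIV_imp_deriv)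
        let ?X = "D_t \<phi> t f - L_star \<theta> \<sigma> (\<phi> t) f - h * M_star (\<phi> t) f"
        let ?Y = "pairing (\<phi> t) (\<lambda>y. (deriv f y)\<^sup>2)"
        have sq: "(deriv f y)\<^sup>2 \<le> B\<^sup>2" for y using B abs_le_square_iff[of "deriv f y" B] by simp
        have dm: "deriv f \<in> borel_measurable borel"
          by (rule borel_measurable_continuous_onI[OF smooth_continuous[OF smooth_deriv[OF test_fun_smooth[OF f]]]])
        have "?Y \<le> (LINT y|\<phi> t. B\<^sup>2)"
          unfolding pairing_def
        proof (rule integral_mono)
          show "integrable (\<phi> t) (\<lambda>y. (deriv f y)\<^sup>2)"
            by (rule integrable_const_bound[of _ "B\<^sup>2"]) (use dm sq in auto)
        qed (use sq in auto)
        then have Y: "?Y \<le> B\<^sup>2" using prob_space by simp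
        have Y0: "?Y > 0" using nz[OF True] by (simp add: pairing_def less_le)
        have "g t - A \<le> ?X" using A[OF True] Dt by simp
        then have "2 * l * (g t - A) - l\<^sup>2 \<le> 2 * l * ?X - l\<^sup>2" using l by (simp add: mult_left_mono)
        also have "\<dots> \<le> ?X\<^sup>2" using zero_le_power2[of "?X - l"] by (simp add: power2_eq_square algebra_simps)
        finally have "q t \<le> ?X\<^sup>2 / B\<^sup>2" unfolding q_def using B by (intro divide_right_mono) auto
        also have "\<dots> \<le> ?X\<^sup>2 / ?Y" using Y Y0 B(1) by (intro divide_left_mono mult_pos_pos) auto
        finally have "max 0 (q t) \<le> ?X\<^sup>2 / ?Y" using Y0 by simp
        then have "ennreal (max 0 (q t)) \<le> ennreal (?X\<^sup>2 / ?Y)" by (rule ennreal_leI)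
        also have "\<dots> \<le> rate_integrand h \<theta> \<sigma> \<phi> t"
          unfolding rate_integrand_def using f nz[OF True] by (intro SUP_upper) auto
        finally show ?thesis using True by simp
      qed simp
    qed
  qed
  finally show ?thesis .
qed

text \<open>Compactness of [0, T]: times with moments beyond every bound have a convergent
  subsequence, along which continuity of the path forces the moments to stay bounded.\<close>

lemma path_space_moment_bound:
  assumes \<phi>: "\<phi> \<in> path_space \<kappa> T"
  obtains S where "S > 0" "\<And>t. t \<in> {0..T} \<Longrightarrow> phi_moment \<kappa> (\<phi> t) \<le> ennreal S"
proof (rule ccontr)
  assume no: "\<not> thesis"
  have "\<exists>t\<in>{0..T}. ennreal (real n + 1) < phi_moment \<kappa> (\<phi> t)" for n
  proof (rule ccontr)
    assume "\<not> ?thesis"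
    then have "\<And>t. t \<in> {0..T} \<Longrightarrow> phi_moment \<kappa> (\<phi> t) \<le> ennreal (real n + 1)" by (auto simp: not_less)
    then show False using that[of "real n + 1"] no by auto
  qed
  then obtain \<tau> where \<tau>: "\<And>n. \<tau> n \<in> {0..T}" "\<And>n. ennreal (real n + 1) < phi_moment \<kappa> (\<phi> (\<tau> n))" by metis
  obtain t r where t: "t \<in> {0..T}" "strict_mono (r :: nat \<Rightarrow> nat)" "(\<tau> \<circ> r) \<longlonglongrightarrow> t"
    using compact_Icc[of 0 T, unfolded compact_def] \<tau>(1) by blast
  then have "(\<lambda>n. \<tau> (r n)) \<longlonglongrightarrow> t" by (simp add: comp_def)
  then have "M_inf_tendsto \<kappa> (\<lambda>n. \<phi> (\<tau> (r n))) (\<phi> t)"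
    using \<phi> t(1) \<tau>(1) unfolding path_space_def by auto
  then have fin: "(SUP n. phi_moment \<kappa> (\<phi> (\<tau> (r n)))) < \<infinity>" by (simp add: M_inf_tendsto_def)
  then obtain c where c: "0 \<le> c" "(SUP n. phi_moment \<kappa> (\<phi> (\<tau> (r n)))) = ennreal c"
    by (cases "SUP n. phi_moment \<kappa> (\<phi> (\<tau> (r n)))") auto
  obtain n :: nat where n: "c \<le> real n" using real_arch_simple by blast
  have "ennreal (real (r n) + 1) < ennreal c"
    using \<tau>(2)[of "r n"] SUP_upper[of n UNIV "\<lambda>n. phi_moment \<kappa> (\<phi> (\<tau> (r n)))"] c(2) by (metis UNIV_I less_le_trans)
  then have "real (r n) + 1 < c" by (subst (asm) ennreal_less_iff) auto
  moreover have "real n \<le> real (r n)" using seq_suble[OF t(2), of n] by simp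
  ultimately show False using n by linarith
qed

section \<open>Softplus test functions\<close>

definition softplus :: "real \<Rightarrow> real \<Rightarrow> real" where
  "softplus \<epsilon> y = ln (1 + exp (\<epsilon> * y + 1 / \<epsilon>)) / \<epsilon>"

definition logistic :: "real \<Rightarrow> real \<Rightarrow> real" where
  "logistic \<epsilon> y = 1 - inverse (1 + exp (\<epsilon> * y + 1 / \<epsilon>))"

text \<open>The function \<open>(1 - exp (- \<delta> F)) / \<delta>\<close> of the softplus \<open>F\<close> is bounded, which makes the error of a logarithmic
  cutoff small, and tends to \<open>F\<close> as \<open>\<delta> \<rightarrow> 0\<close>. The shift \<open>1 / \<epsilon>\<close> moves the bend of the softplus
  off to \<open>-1 / \<epsilon>\<^sup>2\<close>.\<close>

definition profile :: "real \<Rightarrow> real \<Rightarrow> real \<Rightarrow> real" where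
  "profile \<epsilon> \<delta> y = (1 - exp (- (\<delta> * softplus \<epsilon> y))) / \<delta>"

definition profile1 :: "real \<Rightarrow> real \<Rightarrow> real \<Rightarrow> real" where
  "profile1 \<epsilon> \<delta> y = logistic \<epsilon> y * exp (- (\<delta> * softplus \<epsilon> y))"

definition profile2 :: "real \<Rightarrow> real \<Rightarrow> real \<Rightarrow> real" where
  "profile2 \<epsilon> \<delta> y = (\<epsilon> * (logistic \<epsilon> y * (1 - logistic \<epsilon> y)) - \<delta> * (logistic \<epsilon> y)\<^sup>2) * exp (- (\<delta> * softplus \<epsilon> y))"

lemma smooth_affine: "smooth (\<lambda>y. a * y + c)" by (intro smooth_add smooth_mult smooth_const smooth_ident)

lemma one_plus_exp_pos: "1 + exp (x::real) > 0" by (simp add: add_pos_pos)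

lemma smooth_logistic: "smooth (logistic \<epsilon>)"
  unfolding logistic_def[abs_def]
proof (intro smooth_diff smooth_const smooth_inverse smooth_add)
  show "smooth (\<lambda>y. exp (\<epsilon> * y + 1 / \<epsilon>))" by (rule smooth_compose[OF smooth_exp smooth_affine])
  show "1 + exp (\<epsilon> * x + 1 / \<epsilon>) \<noteq> 0" for x using one_plus_exp_pos[of "\<epsilon> * x + 1 / \<epsilon>"] by simp
qed

lemma logistic_bounds: "0 < logistic \<epsilon> y" "logistic \<epsilon> y < 1" "logistic \<epsilon> y \<le> exp (\<epsilon> * y + 1 / \<epsilon>)"
proof -
  let ?z = "exp (\<epsilon> * y + 1 / \<epsilon>)"
  have z: "?z > 0" by simp
  have l: "logistic \<epsilon> y = ?z / (1 + ?z)" using one_plus_exp_pos[of "\<epsilon> * y + 1 / \<epsilon>"] by (simp add: logistic_def field_simps)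
  show "0 < logistic \<epsilon> y" "logistic \<epsilon> y < 1" unfolding l using one_plus_exp_pos[of "\<epsilon> * y + 1 / \<epsilon>"] by auto
  show "logistic \<epsilon> y \<le> ?z" unfolding l using z by (simp add: divide_le_eq add_pos_pos)
qed

context
  fixes \<epsilon> :: real assumes \<epsilon>: "\<epsilon> > 0"
begin

lemma logistic_mono: "x \<le> y \<Longrightarrow> logistic \<epsilon> x \<le> logistic \<epsilon> y"
  using \<epsilon> unfolding logistic_def by (intro diff_mono order_refl le_imp_inverse_le) (auto simp: add_pos_pos)

lemma softplus_DERIV: "(softplus \<epsilon> has_real_derivative logistic \<epsilon> y) (at y)"
proof -
  let ?z = "exp (\<epsilon> * y + 1 / \<epsilon>)"
  have p: "1 + ?z > 0" by (rule one_plus_exp_pos)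
  have "((\<lambda>y. exp (\<epsilon> * y + 1 / \<epsilon>)) has_real_derivative ?z * \<epsilon>) (at y)"
    by (rule DERIV_chain2[OF DERIV_exp]) (auto intro!: derivative_eq_intros)
  then have "((\<lambda>y. 1 + exp (\<epsilon> * y + 1 / \<epsilon>)) has_real_derivative ?z * \<epsilon>) (at y)"
    using DERIV_add[OF DERIV_const] by fastforce
  from DERIV_cdivide[OF DERIV_chain2[OF DERIV_ln[OF p] this], of \<epsilon>]
  have "(softplus \<epsilon> has_real_derivative inverse (1 + ?z) * (?z * \<epsilon>) / \<epsilon>) (at y)"
    unfolding softplus_def[abs_def] .
  moreover have "inverse (1 + z) * (z * \<epsilon>) / \<epsilon> = 1 - inverse (1 + z)" if "1 + z > 0" for z :: real
  proof -
    have "inverse (1 + z) * (z * \<epsilon>) / \<epsilon> = z / (1 + z)" using \<epsilon> by (simp add: divide_inverse)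
    also have "\<dots> = 1 - inverse (1 + z)" using that by (simp add: field_simps)
    finally show ?thesis .
  qed
  ultimately show ?thesis using p by (simp only: logistic_def)
qed

lemma logistic_DERIV: "(logistic \<epsilon> has_real_derivative \<epsilon> * (logistic \<epsilon> y * (1 - logistic \<epsilon> y))) (at y)"
proof -
  let ?z = "exp (\<epsilon> * y + 1 / \<epsilon>)"
  have p: "1 + ?z \<noteq> 0" using one_plus_exp_pos[of "\<epsilon> * y + 1 / \<epsilon>"] by simp
  have "((\<lambda>y. exp (\<epsilon> * y + 1 / \<epsilon>)) has_real_derivative ?z * \<epsilon>) (at y)"
    by (rule DERIV_chain2[OF DERIV_exp]) (auto intro!: derivative_eq_intros)
  then have "((\<lambda>y. 1 + exp (\<epsilon> * y + 1 / \<epsilon>)) has_real_derivative ?z * \<epsilon>) (at y)"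
    using DERIV_add[OF DERIV_const] by fastforce
  from DERIV_diff[OF DERIV_const DERIV_inverse_fun[OF this p], of 1]
  have "(logistic \<epsilon> has_real_derivative 0 - - (inverse ((1 + ?z) ^ Suc (Suc 0))) * (?z * \<epsilon>)) (at y)"
    unfolding logistic_def[abs_def] by (rule DERIV_cong) (simp add: mult_ac)
  then show ?thesis
    by (rule DERIV_cong) (use p in \<open>simp add: logistic_def power2_eq_square field_simps\<close>)
qed

lemma smooth_softplus: "smooth (softplus \<epsilon>)"
  by (rule smooth_antiderivative[OF softplus_DERIV smooth_logistic])

lemma softplus_ge: "y + 1 / \<epsilon>\<^sup>2 \<le> softplus \<epsilon> y" "0 \<le> softplus \<epsilon> y"
proof -
  let ?x = "\<epsilon> * y + 1 / \<epsilon>"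
  have "?x \<le> ln (1 + exp ?x)" by (subst ln_ge_iff) (auto simp: add_pos_pos)
  then have "?x / \<epsilon> \<le> softplus \<epsilon> y" unfolding softplus_def using \<epsilon> by (intro divide_right_mono) auto
  moreover have "?x / \<epsilon> = y + 1 / \<epsilon>\<^sup>2" using \<epsilon> by (simp add: power2_eq_square add_divide_distrib)
  ultimately show "y + 1 / \<epsilon>\<^sup>2 \<le> softplus \<epsilon> y" by simp
  show "0 \<le> softplus \<epsilon> y" unfolding softplus_def using \<epsilon> by (intro divide_nonneg_pos ln_ge_zero) auto
qed

lemma softplus_le: "softplus \<epsilon> y \<le> \<bar>y\<bar> + softplus \<epsilon> 0"
proof -
  let ?e = "exp (1 / \<epsilon>)" and ?a = "exp (\<epsilon> * \<bar>y\<bar>)"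
  have "exp (\<epsilon> * y) \<le> ?a" using \<epsilon> by simp
  then have "exp (\<epsilon> * y) * ?e \<le> ?a * ?e" by (rule mult_right_mono) simp
  moreover have "1 \<le> ?a" using \<epsilon> by simp
  ultimately have "1 + exp (\<epsilon> * y) * ?e \<le> ?a + ?a * ?e" by (rule add_mono[rotated])
  then have "1 + exp (\<epsilon> * y + 1 / \<epsilon>) \<le> ?a * (1 + ?e)" by (simp only: exp_add distrib_left mult_1_right)
  then have "ln (1 + exp (\<epsilon> * y + 1 / \<epsilon>)) \<le> ln (?a * (1 + ?e))"
    by (subst ln_le_cancel_iff) (auto simp: add_pos_pos)
  also have "\<dots> = \<epsilon> * \<bar>y\<bar> + ln (1 + ?e)" using one_plus_exp_pos[of "1 / \<epsilon>"] by (subst ln_mult) auto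
  finally have "softplus \<epsilon> y \<le> (\<epsilon> * \<bar>y\<bar> + ln (1 + ?e)) / \<epsilon>" unfolding softplus_def using \<epsilon> by (intro divide_right_mono) auto
  then show ?thesis using \<epsilon> by (simp add: softplus_def add_divide_distrib)
qed

text \<open>From ln (1 + exp x) = x + ln (1 + exp (-x)). Averaged over the initial equilibrium,
  which has exponential moments, the excess over the line is tiny thanks to the shift 1 /
  \<epsilon>.\<close>

lemma softplus_minus_le: "softplus \<epsilon> y - (y + 1 / \<epsilon>\<^sup>2) \<le> exp (- (1 / \<epsilon>)) / \<epsilon> * exp (- \<epsilon> * y)"
proof -
  let ?x = "\<epsilon> * y + 1 / \<epsilon>"
  have "ln (1 + exp x) = x + ln (1 + exp (- x))" for x :: real
  proof -
    have e: "1 + exp x = exp x * (1 + exp (- x))" by (simp add: distrib_left exp_minus)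
    show ?thesis unfolding e using one_plus_exp_pos[of "- x"] by (subst ln_mult) auto
  qed
  then have "ln (1 + exp ?x) = ?x + ln (1 + exp (- ?x))" .
  also have "ln (1 + exp (- ?x)) \<le> exp (- ?x)" by (rule ln_add_one_self_le_self) simp
  finally have "softplus \<epsilon> y \<le> (?x + exp (- ?x)) / \<epsilon>" unfolding softplus_def using \<epsilon> by (intro divide_right_mono) auto
  also have "\<dots> = y + 1 / \<epsilon>\<^sup>2 + exp (- (1 / \<epsilon>)) / \<epsilon> * exp (- \<epsilon> * y)"
  proof -
    have "exp (- ?x) = exp (- (1 / \<epsilon>)) * exp (- \<epsilon> * y)" by (simp add: exp_add[symmetric])
    moreover have "?x / \<epsilon> = y + 1 / \<epsilon>\<^sup>2" using \<epsilon> by (simp add: power2_eq_square add_divide_distrib)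
    ultimately show ?thesis unfolding add_divide_distrib by simp
  qed
  finally show ?thesis by simp
qed

text \<open>-U is positive only for 0 < y < 1, where it is at most 1, and for y < -1, where the
  exponential decay of the logistic function beats the cubic growth. An arbitrary p below it is
  allowed so that the truncated slope fits.\<close>

lemma minus_U_logistic_le:
  assumes p: "0 \<le> p" "p \<le> logistic \<epsilon> y" shows "- U y * p \<le> 1 + 27 * exp (1 / \<epsilon>) / \<epsilon> ^ 3"
proof -
  have C: "27 * exp (1 / \<epsilon>) / \<epsilon> ^ 3 \<ge> 0" using \<epsilon> by simp
  have p1: "p \<le> 1" using p logistic_bounds(2)[of \<epsilon> y] by linarith
  have U: "U y = y * (y\<^sup>2 - 1)" by (simp add: U_def power3_eq_cube power2_eq_square algebra_simps)
  consider "y \<ge> 1" | "\<bar>y\<bar> \<le> 1" | "y \<le> - 1" by linarith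
  then show ?thesis
  proof cases
    case 1
    then have "U y \<ge> 0" unfolding U using one_le_power[of y 2] by (intro mult_nonneg_nonneg) auto
    then have "- U y * p \<le> 0" using p by (simp add: mult_nonneg_nonneg)
    then show ?thesis using C by linarith
  next
    case 2
    have "y\<^sup>2 \<le> 1" using 2 by (simp add: abs_square_le_1)
    then have "\<bar>y\<^sup>2 - 1\<bar> \<le> 1" by (simp add: abs_le_iff)
    then have "\<bar>U y\<bar> \<le> 1 * 1" unfolding U abs_mult using 2 by (intro mult_mono) auto
    then have "\<bar>- U y * p\<bar> \<le> 1 * 1" unfolding abs_mult using p p1 by (intro mult_mono) auto
    then show ?thesis using C by linarith
  next
    case 3
    define t where "t = - y"
    have t: "t \<ge> 1" using 3 by (simp add: t_def)
    have "- U y \<le> t ^ 3" using t by (simp add: U_def t_def power3_eq_cube)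
    moreover have "p \<le> exp (1 / \<epsilon>) * exp (- (\<epsilon> * t))" using p logistic_bounds(3)[of \<epsilon> y] by (simp add: t_def exp_add[symmetric] add.commute)
    ultimately have "- U y * p \<le> t ^ 3 * (exp (1 / \<epsilon>) * exp (- (\<epsilon> * t)))"
      using p t by (intro mult_mono) auto
    also have "\<dots> \<le> 27 * exp (1 / \<epsilon>) / \<epsilon> ^ 3"
    proof -
      have pos: "\<epsilon> * t \<ge> 0" using \<epsilon> t by simp
      \<comment> \<open>The origin of 27 = 3^3: x^3 <= 27 exp x by (1 + x / 3)^3 <= exp x.\<close>
      have "((\<epsilon> * t) / 3) ^ 3 \<le> (1 + (\<epsilon> * t) / 3) ^ 3" using pos by (intro power_mono) auto
      also have "\<dots> \<le> exp (\<epsilon> * t)" using exp_ge_one_plus_x_over_n_power_n[of 3 "\<epsilon> * t"] pos by simp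
      finally have "(\<epsilon> * t) ^ 3 \<le> 27 * exp (\<epsilon> * t)" by (simp add: power_divide)
      then have "\<epsilon> ^ 3 * t ^ 3 * exp (- (\<epsilon> * t)) \<le> 27 * exp (\<epsilon> * t) * exp (- (\<epsilon> * t))"
        unfolding power_mult_distrib by (rule mult_right_mono) simp
      then have "t ^ 3 * exp (- (\<epsilon> * t)) \<le> 27 / \<epsilon> ^ 3"
      proof -
        have "27 * exp (\<epsilon> * t) * exp (- (\<epsilon> * t)) = 27" by (simp add: mult.assoc exp_minus_inverse)
        then have "(t ^ 3 * exp (- (\<epsilon> * t))) * \<epsilon> ^ 3 \<le> 27"
          using \<open>\<epsilon> ^ 3 * t ^ 3 * exp (- (\<epsilon> * t)) \<le> 27 * exp (\<epsilon> * t) * exp (- (\<epsilon> * t))\<close> by (simp only: mult_ac)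
        then show ?thesis using \<epsilon> by (subst pos_le_divide_eq) auto
      qed
      then have "t ^ 3 * exp (- (\<epsilon> * t)) * exp (1 / \<epsilon>) \<le> 27 / \<epsilon> ^ 3 * exp (1 / \<epsilon>)" by (rule mult_right_mono) simp
      then show ?thesis by (simp add: mult_ac)
    qed
    finally show ?thesis by simp
  qed
qed

context
  fixes \<delta> :: real assumes \<delta>: "\<delta> > 0"
begin

lemma exp_softplus_DERIV:
  "((\<lambda>y. exp (- (\<delta> * softplus \<epsilon> y))) has_real_derivative exp (- (\<delta> * softplus \<epsilon> y)) * - (\<delta> * logistic \<epsilon> y)) (at y)"
  by (rule DERIV_chain2[OF DERIV_exp DERIV_minus[OF DERIV_cmult[OF softplus_DERIV]]])

lemma profile_DERIV: "(profile \<epsilon> \<delta> has_real_derivative profile1 \<epsilon> \<delta> y) (at y)"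
proof -
  have "(profile \<epsilon> \<delta> has_real_derivative (0 - exp (- (\<delta> * softplus \<epsilon> y)) * - (\<delta> * logistic \<epsilon> y)) / \<delta>) (at y)"
    unfolding profile_def[abs_def] by (rule DERIV_cdivide[OF DERIV_diff[OF DERIV_const exp_softplus_DERIV]])
  then show ?thesis by (rule DERIV_cong) (use \<delta> in \<open>simp add: profile1_def\<close>)
qed

lemma profile1_DERIV: "(profile1 \<epsilon> \<delta> has_real_derivative profile2 \<epsilon> \<delta> y) (at y)"
  unfolding profile1_def[abs_def]
  by (rule DERIV_cong[OF DERIV_mult[OF logistic_DERIV exp_softplus_DERIV]])
    (simp add: profile2_def power2_eq_square algebra_simps)

lemma smooth_profile: "smooth (profile \<epsilon> \<delta>)"
proof -
  have "smooth (\<lambda>y. - (\<delta> * softplus \<epsilon> y))" by (intro smooth_minus smooth_mult smooth_const smooth_softplus)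
  then have "smooth (\<lambda>y. exp (- (\<delta> * softplus \<epsilon> y)))" by (rule smooth_compose[OF smooth_exp])
  then show ?thesis unfolding profile_def[abs_def] divide_inverse by (intro smooth_mult smooth_diff smooth_const)
qed

lemma profile_bounds: "0 \<le> profile \<epsilon> \<delta> y" "profile \<epsilon> \<delta> y \<le> 1 / \<delta>" "profile \<epsilon> \<delta> y \<le> softplus \<epsilon> y"
  "softplus \<epsilon> y - profile \<epsilon> \<delta> y \<le> \<delta> * (softplus \<epsilon> y)\<^sup>2"
proof -
  let ?z = "\<delta> * softplus \<epsilon> y"
  have z: "?z \<ge> 0" using \<delta> softplus_ge by simp
  then show "0 \<le> profile \<epsilon> \<delta> y" using \<delta> by (simp add: profile_def)
  show "profile \<epsilon> \<delta> y \<le> 1 / \<delta>" using \<delta> by (simp add: profile_def divide_right_mono)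
  have "1 - exp (- ?z) \<le> ?z" using exp_ge_add_one_self[of "- ?z"] by linarith
  then have "profile \<epsilon> \<delta> y \<le> ?z / \<delta>" unfolding profile_def using \<delta> by (intro divide_right_mono) auto
  then show "profile \<epsilon> \<delta> y \<le> softplus \<epsilon> y" using \<delta> by simp
  have "\<bar>exp (- ?z) - 1 - - ?z\<bar> \<le> (- ?z)\<^sup>2 * max 1 (exp (- ?z))" by (rule exp_second_order)
  moreover have "max 1 (exp (- ?z)) = 1" using z by (simp add: max_def)
  ultimately have "?z - (1 - exp (- ?z)) \<le> ?z\<^sup>2" by simp
  then have "(?z - (1 - exp (- ?z))) / \<delta> \<le> ?z\<^sup>2 / \<delta>" using \<delta> by (intro divide_right_mono) auto
  then show "softplus \<epsilon> y - profile \<epsilon> \<delta> y \<le> \<delta> * (softplus \<epsilon> y)\<^sup>2"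
    using \<delta> by (simp add: profile_def diff_divide_distrib power2_eq_square mult_ac)
qed

lemma profile1_bounds: "0 < profile1 \<epsilon> \<delta> y" "profile1 \<epsilon> \<delta> y \<le> logistic \<epsilon> y" "profile1 \<epsilon> \<delta> y \<le> 1"
  "logistic \<epsilon> y - profile1 \<epsilon> \<delta> y \<le> \<delta> * softplus \<epsilon> y"
proof -
  let ?z = "\<delta> * softplus \<epsilon> y" and ?l = "logistic \<epsilon> y"
  have z: "?z \<ge> 0" using \<delta> softplus_ge by simp
  show "0 < profile1 \<epsilon> \<delta> y" using logistic_bounds[of \<epsilon> y] by (simp add: profile1_def)
  show 1: "profile1 \<epsilon> \<delta> y \<le> ?l" using logistic_bounds[of \<epsilon> y] z by (simp add: profile1_def mult_left_le)
  then show "profile1 \<epsilon> \<delta> y \<le> 1" using logistic_bounds(2)[of \<epsilon> y] by linarith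
  have "?l - profile1 \<epsilon> \<delta> y = ?l * (1 - exp (- ?z))" by (simp add: profile1_def algebra_simps)
  also have "\<dots> \<le> 1 * ?z"
    using logistic_bounds[of \<epsilon> y] exp_ge_add_one_self[of "- ?z"] z by (intro mult_mono) auto
  finally show "?l - profile1 \<epsilon> \<delta> y \<le> ?z" by simp
qed

text \<open>l (1 - l) <= 1/4, and the term coming from the damping is negative.\<close>

lemma profile2_le: "profile2 \<epsilon> \<delta> y \<le> \<epsilon> / 4"
proof -
  let ?l = "logistic \<epsilon> y" and ?e = "exp (- (\<delta> * softplus \<epsilon> y))"
  have "?l * (1 - ?l) \<le> 1 / 4" using zero_le_power2[of "?l - 1 / 2"] by (simp add: power2_eq_square algebra_simps)
  then have "\<epsilon> * (?l * (1 - ?l)) \<le> \<epsilon> * (1 / 4)" using \<epsilon> by (intro mult_left_mono) auto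
  moreover have "\<delta> * ?l\<^sup>2 \<ge> 0" using \<delta> by simp
  ultimately have "\<epsilon> * (?l * (1 - ?l)) - \<delta> * ?l\<^sup>2 \<le> \<epsilon> / 4" by linarith
  then have "profile2 \<epsilon> \<delta> y \<le> \<epsilon> / 4 * ?e" unfolding profile2_def by (rule mult_right_mono) simp
  also have "\<dots> \<le> \<epsilon> / 4 * 1" using \<delta> \<epsilon> softplus_ge by (intro mult_left_mono) auto
  finally show ?thesis by simp
qed

end

end

section \<open>The truncated test function\<close>

lemma abs_le_one_plus_square: "\<bar>y\<bar> \<le> 1 + y\<^sup>2" for y :: real
  using zero_le_power2[of "\<bar>y\<bar> - 1"] by (simp add: power2_eq_square algebra_simps)

text \<open>Dropping the quartic term keeps what is available for every \<kappa>, 0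
  included.\<close>

lemma phi_moment_integrable:
  assumes \<mu>: "real_distribution \<mu>" and \<kappa>: "0 \<le> \<kappa>" and S: "0 \<le> S" "phi_moment \<kappa> \<mu> \<le> ennreal S"
  shows "integrable \<mu> (\<lambda>y. 1 + y\<^sup>2)" "(LINT y|\<mu>. 1 + y\<^sup>2) \<le> S"
proof -
  interpret real_distribution \<mu> by fact
  have "(\<integral>\<^sup>+y. ennreal (1 + y\<^sup>2) \<partial>\<mu>) \<le> phi_moment \<kappa> \<mu>"
    unfolding phi_moment_def using \<kappa> by (intro nn_integral_mono ennreal_leI) simp
  then have le: "(\<integral>\<^sup>+y. ennreal (1 + y\<^sup>2) \<partial>\<mu>) \<le> ennreal S" using S(2) by (rule order_trans)
  show i: "integrable \<mu> (\<lambda>y. 1 + y\<^sup>2)"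
  proof (rule integrableI_nonneg)
    show "(\<integral>\<^sup>+y. ennreal (1 + y\<^sup>2) \<partial>\<mu>) < \<infinity>" by (rule le_less_trans[OF le]) simp
  qed auto
  have "ennreal (LINT y|\<mu>. 1 + y\<^sup>2) \<le> ennreal S"
    using le by (subst nn_integral_eq_integral[OF i, symmetric]) auto
  then show "(LINT y|\<mu>. 1 + y\<^sup>2) \<le> S" using S(1) by (simp add: ennreal_le_iff)
qed

lemma integrable_quadratic_bound:
  assumes "integrable \<mu> (\<lambda>y::real. 1 + y\<^sup>2)" "sets \<mu> = sets borel" "k \<in> borel_measurable borel" "\<And>y. \<bar>k y\<bar> \<le> c * (1 + y\<^sup>2)"
  shows "integrable \<mu> k"
proof (rule Bochner_Integration.integrable_bound[OF integrable_mult_right[OF assms(1), of c]])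
  show "k \<in> borel_measurable \<mu>" using assms(2,3) measurable_cong_sets by blast
  show "AE y in \<mu>. norm (k y) \<le> norm (c * (1 + y\<^sup>2))"
    by (rule AE_I2) (use assms(4) abs_ge_self order_trans in \<open>fastforce\<close>)
qed

text \<open>Damping 1 / r gives height at most r, and cutoff scale r^2 gives cutoff derivatives of
  order 1 / r^2: their product is of order 1 / r.\<close>

definition truncated_profile :: "real \<Rightarrow> real \<Rightarrow> real \<Rightarrow> real" where
  "truncated_profile \<epsilon> r y = profile \<epsilon> (1 / r) y * cutoff (r\<^sup>2) y"

lemma cutoff_derivs_all:
  "\<exists>C>0. \<forall>M\<ge>1. \<forall>y. \<bar>deriv (cutoff M) y\<bar> \<le> C / M * (\<bar>y\<bar> / (1 + y\<^sup>2)) \<and> \<bar>deriv (deriv (cutoff M)) y\<bar> \<le> C / M"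
proof -
  obtain C where "C > 0" "\<And>M y. M \<ge> 1 \<Longrightarrow> \<bar>deriv (cutoff M) y\<bar> \<le> C / M * (\<bar>y\<bar> / (1 + y\<^sup>2))"
    "\<And>M y. M \<ge> 1 \<Longrightarrow> \<bar>deriv (deriv (cutoff M)) y\<bar> \<le> C / M"
    using cutoff_derivs by blast
  then show ?thesis by (intro exI[of _ C]) auto
qed

locale truncation =
  fixes \<epsilon> r C :: real
  assumes \<epsilon>: "\<epsilon> > 0" and r: "r \<ge> 1" and C0: "C > 0"
    and C: "\<And>M y. M \<ge> 1 \<Longrightarrow> \<bar>deriv (cutoff M) y\<bar> \<le> C / M * (\<bar>y\<bar> / (1 + y\<^sup>2)) \<and> \<bar>deriv (deriv (cutoff M)) y\<bar> \<le> C / M"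
begin

abbreviation "f \<equiv> truncated_profile \<epsilon> r"
abbreviation "F \<equiv> softplus \<epsilon>"
abbreviation "g \<equiv> logistic \<epsilon>"
abbreviation "\<chi>' \<equiv> cutoff (r\<^sup>2)"
abbreviation "p0 \<equiv> profile \<epsilon> (1 / r)"
abbreviation "p1 \<equiv> profile1 \<epsilon> (1 / r)"
abbreviation "p2 \<equiv> profile2 \<epsilon> (1 / r)"

lemma \<delta>: "1 / r > 0" using r by simp
lemma r2: "r\<^sup>2 \<ge> 1" using r by (simp add: one_le_power)

lemma inv_r2_le: "1 / r\<^sup>2 \<le> 1 / r" using r by (simp add: power2_eq_square field_simps)

lemma cutoff_D: "(\<chi>' has_real_derivative deriv \<chi>' y) (at y)" "(deriv \<chi>' has_real_derivative deriv (deriv \<chi>') y) (at y)"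
  by (rule smooth_DERIV smooth_deriv smooth_cutoff)+

lemma f_D: "(f has_real_derivative p1 y * \<chi>' y + p0 y * deriv \<chi>' y) (at y)"
  unfolding truncated_profile_def[abs_def]
  by (rule DERIV_cong[OF DERIV_mult[OF profile_DERIV[OF \<epsilon> \<delta>] cutoff_D(1)]]) simp

lemma deriv_f: "deriv f y = p1 y * \<chi>' y + p0 y * deriv \<chi>' y"
  by (rule DERIV_imp_deriv[OF f_D])

lemma deriv_deriv_f: "deriv (deriv f) y = p2 y * \<chi>' y + 2 * (p1 y * deriv \<chi>' y) + p0 y * deriv (deriv \<chi>') y"
  unfolding deriv_f[abs_def]
  by (rule DERIV_imp_deriv, rule DERIV_cong[OF DERIV_add[OF DERIV_mult[OF profile1_DERIV[OF \<epsilon> \<delta>] cutoff_D(1)]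
        DERIV_mult[OF profile_DERIV[OF \<epsilon> \<delta>] cutoff_D(2)]]]) simp

lemma smooth_f: "smooth f"
  unfolding truncated_profile_def[abs_def] by (intro smooth_mult smooth_profile[OF \<epsilon> \<delta>] smooth_cutoff)

lemma f_test_fun: "f \<in> test_fun"
  unfolding test_fun_iff
proof (intro conjI smooth_f exI[of _ "exp (r\<^sup>2)"] allI impI)
  have "r\<^sup>2 > 0" using r2 by linarith
  then show "f x = 0" if "x \<notin> {- exp (r\<^sup>2)..exp (r\<^sup>2)}" for x
    using cutoff_zero[of "r\<^sup>2" x] that by (simp add: truncated_profile_def)
qed

lemma ratio_bounds: "0 \<le> \<bar>y\<bar> / (1 + y\<^sup>2)" "\<bar>y\<bar> / (1 + y\<^sup>2) \<le> 1" for y :: real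
  using quad_pos[of y] abs_le_one_plus_square[of y] by auto

lemma p0_le: "0 \<le> p0 y" "p0 y \<le> r" using profile_bounds[OF \<epsilon> \<delta>, of y] by auto

lemma p1_bd: "0 < p1 y" "p1 y \<le> g y" "p1 y \<le> 1" "g y - p1 y \<le> 1 / r * F y"
  using profile1_bounds[OF \<epsilon> \<delta>, of y] by auto

text \<open>Height r times the cutoff slope C / r^2. The sharper first form keeps the decay in y
  that the cubic \<open>U\<close> consumes.\<close>

lemma tail_deriv: "\<bar>p0 y * deriv \<chi>' y\<bar> \<le> C / r * (\<bar>y\<bar> / (1 + y\<^sup>2))" "\<bar>p0 y * deriv \<chi>' y\<bar> \<le> C / r"
proof -
  let ?q = "\<bar>y\<bar> / (1 + y\<^sup>2)"
  have "\<bar>p0 y * deriv \<chi>' y\<bar> \<le> r * (C / r\<^sup>2 * ?q)"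
    unfolding abs_mult using p0_le[of y] C[OF r2, of y] by (intro mult_mono) auto
  also have "\<dots> = C / r * ?q" using r by (simp add: power2_eq_square)
  finally show 1: "\<bar>p0 y * deriv \<chi>' y\<bar> \<le> C / r * ?q" .
  also have "\<dots> \<le> C / r * 1" using C0 r ratio_bounds[of y] by (intro mult_left_mono) auto
  finally show "\<bar>p0 y * deriv \<chi>' y\<bar> \<le> C / r" by simp
qed

lemma p1_chi: "0 \<le> p1 y * \<chi>' y" "p1 y * \<chi>' y \<le> g y" "p1 y * \<chi>' y \<le> 1"
proof -
  show "0 \<le> p1 y * \<chi>' y" using p1_bd[of y] cutoff_bounds[of "r\<^sup>2" y] by simp
  have "p1 y * \<chi>' y \<le> p1 y" using p1_bd[of y] cutoff_bounds[of "r\<^sup>2" y] by (simp add: mult_left_le)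
  then show "p1 y * \<chi>' y \<le> g y" "p1 y * \<chi>' y \<le> 1" using p1_bd[of y] by linarith+
qed

lemma deriv_f_bound: "\<bar>deriv f y\<bar> \<le> 1 + C / r"
  using p1_chi[of y] tail_deriv(2)[of y] unfolding deriv_f by linarith

text \<open>The terms of the product rule contribute \<epsilon> / 4, twice C / r and once C / r.
  One-sidedness matches \<open>action_lower_bound\<close>, which asks for an upper bound on the
  drift.\<close>

lemma deriv2_f_bound: "deriv (deriv f) y \<le> \<epsilon> / 4 + 3 * C / r"
proof -
  have C1: "C / r\<^sup>2 \<le> C / r" using inv_r2_le mult_left_mono[of "1 / r\<^sup>2" "1 / r" C] C0 by simp
  have "p2 y * \<chi>' y \<le> \<epsilon> / 4 * 1"
  proof (cases "p2 y \<ge> 0")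
    case True then show ?thesis using profile2_le[OF \<epsilon> \<delta>, of y] cutoff_bounds[of "r\<^sup>2" y] by (intro mult_mono) auto
  next
    case False then have "p2 y * \<chi>' y \<le> 0" using cutoff_bounds[of "r\<^sup>2" y] by (intro mult_nonpos_nonneg) auto
    then show ?thesis using \<epsilon> by simp
  qed
  moreover have "p1 y * deriv \<chi>' y \<le> C / r"
  proof -
    have "\<bar>deriv \<chi>' y\<bar> \<le> C / r\<^sup>2 * 1"
      using C[OF r2, of y] ratio_bounds[of y] C0 mult_left_mono[of "\<bar>y\<bar> / (1 + y\<^sup>2)" 1 "C / r\<^sup>2"] by simp
    then have "\<bar>p1 y * deriv \<chi>' y\<bar> \<le> 1 * (C / r)" unfolding abs_mult using p1_bd[of y] C1 by (intro mult_mono) auto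
    then show ?thesis by simp
  qed
  moreover have "p0 y * deriv (deriv \<chi>') y \<le> C / r"
  proof -
    have "\<bar>p0 y * deriv (deriv \<chi>') y\<bar> \<le> r * (C / r\<^sup>2)" unfolding abs_mult using p0_le[of y] C[OF r2, of y] by (intro mult_mono) auto
    then show ?thesis using r by (simp add: power2_eq_square)
  qed
  ultimately show ?thesis unfolding deriv_deriv_f by (simp add: algebra_simps)
qed

text \<open>Where the logarithmic scale pays off: |U y| <= |y| (1 + y^2) cancels the denominator of
  the cutoff slope, leaving y^2.\<close>

lemma U_term_bound: "- U y * deriv f y \<le> (1 + 27 * exp (1 / \<epsilon>) / \<epsilon> ^ 3) + C / r * (1 + y\<^sup>2)"
proof -
  have "- U y * (p1 y * \<chi>' y) \<le> 1 + 27 * exp (1 / \<epsilon>) / \<epsilon> ^ 3" by (rule minus_U_logistic_le[OF \<epsilon> p1_chi(1,2)])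
  moreover have "- U y * (p0 y * deriv \<chi>' y) \<le> C / r * (1 + y\<^sup>2)"
  proof -
    have "\<bar>U y\<bar> = \<bar>y\<bar> * \<bar>y\<^sup>2 - 1\<bar>" unfolding abs_mult[symmetric] by (simp add: U_def power3_eq_cube power2_eq_square algebra_simps)
    also have "\<dots> \<le> \<bar>y\<bar> * (1 + y\<^sup>2)" by (intro mult_left_mono) (auto simp: abs_le_iff)
    finally have u: "\<bar>U y\<bar> \<le> \<bar>y\<bar> * (1 + y\<^sup>2)" .
    have "\<bar>- U y * (p0 y * deriv \<chi>' y)\<bar> \<le> (\<bar>y\<bar> * (1 + y\<^sup>2)) * (C / r * (\<bar>y\<bar> / (1 + y\<^sup>2)))"
      unfolding abs_mult[of "- U y"] using u tail_deriv(1)[of y] by (intro mult_mono) auto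
    also have "\<dots> = C / r * y\<^sup>2" using quad_pos[of y] by (simp add: power2_eq_square)
    also have "\<dots> \<le> C / r * (1 + y\<^sup>2)" using C0 r by (intro mult_left_mono) auto
    finally show ?thesis by linarith
  qed
  ultimately show ?thesis unfolding deriv_f by (simp add: algebra_simps)
qed

lemma one_minus_cutoff: "1 - \<chi>' y \<le> 2 * (1 + \<bar>y\<bar>) / r"
proof -
  have "r\<^sup>2 > 0" using r2 by linarith
  then have "1 - \<chi>' y \<le> 2 * (1 + \<bar>y\<bar>) / r\<^sup>2" by (rule one_minus_cutoff_le)
  also have "\<dots> \<le> 2 * (1 + \<bar>y\<bar>) / r"
    using mult_left_mono[OF inv_r2_le, of "2 * (1 + \<bar>y\<bar>)"] by simp
  finally show ?thesis .
qed

text \<open>Since \<open>g\<close> is increasing, \<open>(y - m) (g y - g m) \<ge> 0\<close>: the mean-field drift can only help.\<close>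

lemma drift_term_bound:
  assumes m: "\<bar>m\<bar> \<le> S"
  defines "G \<equiv> F 0 + 2 + C"
  shows "- ((y - m) * deriv f y) \<le> - (g m * (y - m)) + (3 + G + 3 * S + S * G) / r * (1 + y\<^sup>2)"
proof -
  have G: "G \<ge> 0" unfolding G_def using softplus_ge(2)[OF \<epsilon>, of 0] C0 by linarith
  have S: "S \<ge> 0" using m by linarith
  have mono: "0 \<le> (y - m) * (g y - g m)"
  proof (cases "y \<ge> m")
    case True then show ?thesis using logistic_mono[OF \<epsilon>, of m y] by (intro mult_nonneg_nonneg) auto
  next
    case False then show ?thesis using logistic_mono[OF \<epsilon>, of y m] by (intro mult_nonpos_nonpos) auto
  qed
  have e1: "0 \<le> g y - p1 y * \<chi>' y" using p1_chi by simp
  have e2: "g y - p1 y * \<chi>' y \<le> (3 * \<bar>y\<bar> + F 0 + 2) / r"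
  proof -
    have "p1 y * (1 - \<chi>' y) \<le> 1 * (2 * (1 + \<bar>y\<bar>) / r)"
      using p1_bd[of y] one_minus_cutoff[of y] cutoff_bounds[of "r\<^sup>2" y] by (intro mult_mono) auto
    moreover have "g y - p1 y \<le> (\<bar>y\<bar> + F 0) / r"
    proof -
      have "1 / r * F y \<le> 1 / r * (\<bar>y\<bar> + F 0)" using r softplus_le[OF \<epsilon>, of y] by (intro mult_left_mono) auto
      then show ?thesis using p1_bd(4)[of y] by simp
    qed
    moreover have "g y - p1 y * \<chi>' y = (g y - p1 y) + p1 y * (1 - \<chi>' y)" by (simp add: algebra_simps)
    moreover have "(\<bar>y\<bar> + F 0) / r + 2 * (1 + \<bar>y\<bar>) / r = (3 * \<bar>y\<bar> + F 0 + 2) / r" by (simp add: add_divide_distrib[symmetric])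
    ultimately show ?thesis by linarith
  qed
  \<comment> \<open>The cost of replacing the slope of f by \<open>g\<close>: damping, cutoff and
    the slope of the cutoff, all of order (1 + |y|) / r.\<close>
  define d where "d = g y - deriv f y"
  have d: "\<bar>d\<bar> \<le> (3 * \<bar>y\<bar> + G) / r"
  proof -
    have "d = (g y - p1 y * \<chi>' y) - p0 y * deriv \<chi>' y" by (simp add: d_def deriv_f)
    then have "\<bar>d\<bar> \<le> (3 * \<bar>y\<bar> + F 0 + 2) / r + C / r" using e1 e2 tail_deriv(2)[of y] by linarith
    also have "\<dots> = (3 * \<bar>y\<bar> + G) / r" by (simp add: G_def add_divide_distrib[symmetric])
    finally show ?thesis .
  qed
  have "(y - m) * d \<le> \<bar>y - m\<bar> * \<bar>d\<bar>" by (metis abs_ge_self abs_mult)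
  also have "\<dots> \<le> (\<bar>y\<bar> + S) * ((3 * \<bar>y\<bar> + G) / r)" using d m S by (intro mult_mono) auto
  also have "\<dots> = ((\<bar>y\<bar> + S) * (3 * \<bar>y\<bar> + G)) / r" by simp
  also have "\<dots> \<le> ((3 + G + 3 * S + S * G) * (1 + y\<^sup>2)) / r"
  proof (rule divide_right_mono)
    have "(\<bar>y\<bar> + S) * (3 * \<bar>y\<bar> + G) = 3 * y\<^sup>2 + (G + 3 * S) * \<bar>y\<bar> + S * G"
      by (simp add: power2_eq_square algebra_simps)
    also have "\<dots> \<le> 3 * (1 + y\<^sup>2) + (G + 3 * S) * (1 + y\<^sup>2) + S * G * (1 + y\<^sup>2)"
    proof (intro add_mono)
      show "(G + 3 * S) * \<bar>y\<bar> \<le> (G + 3 * S) * (1 + y\<^sup>2)" using abs_le_one_plus_square[of y] G S by (intro mult_left_mono) auto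
      show "S * G \<le> S * G * (1 + y\<^sup>2)" using S G mult_left_mono[of 1 "1 + y\<^sup>2" "S * G"] by simp
    qed simp
    also have "\<dots> = (3 + G + 3 * S + S * G) * (1 + y\<^sup>2)" by (simp add: algebra_simps)
    finally show "(\<bar>y\<bar> + S) * (3 * \<bar>y\<bar> + G) \<le> (3 + G + 3 * S + S * G) * (1 + y\<^sup>2)" .
  qed (use r in simp)
  finally have b: "(y - m) * d \<le> (3 + G + 3 * S + S * G) / r * (1 + y\<^sup>2)" by simp
  have "- ((y - m) * deriv f y) = - ((y - m) * (g y - g m)) - g m * (y - m) + (y - m) * d"
    by (simp add: d_def algebra_simps)
  then show ?thesis using mono b by linarith
qed

lemma f_le: "f y \<le> F y" "0 \<le> f y"
  using profile_bounds[OF \<epsilon> \<delta>, of y] cutoff_bounds[of "r\<^sup>2" y] mult_left_le[of "\<chi>' y" "p0 y"]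
  by (auto simp: truncated_profile_def)

text \<open>Two losses, \<delta> F^2 from the damping with \<delta> = 1 / r and F (1 - \<chi>) from
  the cutoff, both quadratic in y over r.\<close>

lemma f_ge: "F y - f y \<le> (6 + 4 * (F 0)\<^sup>2) / r * (1 + y\<^sup>2)"
proof -
  have F: "0 \<le> F y" "F y \<le> \<bar>y\<bar> + F 0" using softplus_ge(2)[OF \<epsilon>] softplus_le[OF \<epsilon>] by auto
  have F2: "(F y)\<^sup>2 \<le> 2 * y\<^sup>2 + 2 * (F 0)\<^sup>2"
  proof -
    have "(F y)\<^sup>2 \<le> (\<bar>y\<bar> + F 0)\<^sup>2" using F by (intro power_mono) auto
    also have "\<dots> \<le> 2 * y\<^sup>2 + 2 * (F 0)\<^sup>2" using zero_le_power2[of "\<bar>y\<bar> - F 0"] by (simp add: power2_eq_square algebra_simps)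
    finally show ?thesis .
  qed
  have "F y - f y = (F y - p0 y) + p0 y * (1 - \<chi>' y)" by (simp add: truncated_profile_def algebra_simps)
  also have "\<dots> \<le> 1 / r * (F y)\<^sup>2 + F y * (2 * (1 + \<bar>y\<bar>) / r)"
    using profile_bounds[OF \<epsilon> \<delta>, of y] one_minus_cutoff[of y] cutoff_bounds[of "r\<^sup>2" y] F by (intro add_mono mult_mono) auto
  also have "\<dots> = ((F y)\<^sup>2 + 2 * F y * (1 + \<bar>y\<bar>)) / r" using r by (simp add: field_simps)
  also have "\<dots> \<le> ((6 + 4 * (F 0)\<^sup>2) * (1 + y\<^sup>2)) / r"
  proof (rule divide_right_mono)
    have "2 * F y * (1 + \<bar>y\<bar>) \<le> (F y)\<^sup>2 + (1 + \<bar>y\<bar>)\<^sup>2" using zero_le_power2[of "F y - (1 + \<bar>y\<bar>)"] by (simp add: power2_eq_square algebra_simps)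
    moreover have "(1 + \<bar>y\<bar>)\<^sup>2 \<le> 2 + 2 * y\<^sup>2" using zero_le_power2[of "1 - \<bar>y\<bar>"] by (simp add: power2_eq_square algebra_simps)
    moreover have "(6 + 4 * (F 0)\<^sup>2) * (1 + y\<^sup>2) = 6 + 6 * y\<^sup>2 + 4 * (F 0)\<^sup>2 + 4 * ((F 0)\<^sup>2 * y\<^sup>2)" by (simp add: algebra_simps)
    moreover have "0 \<le> (F 0)\<^sup>2 * y\<^sup>2" by simp
    ultimately show "(F y)\<^sup>2 + 2 * F y * (1 + \<bar>y\<bar>) \<le> (6 + 4 * (F 0)\<^sup>2) * (1 + y\<^sup>2)"
      using F2 by linarith
  qed (use r in simp)
  finally show ?thesis by simp
qed

text \<open>The strict inequality is an open condition, so the cutoff is locally constant 1 and only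
  the positive \<open>p1\<close> remains.\<close>

lemma deriv_f_nonzero: assumes "ln (1 + y\<^sup>2) < r\<^sup>2" shows "deriv f y \<noteq> 0"
proof -
  have r20: "r\<^sup>2 > 0" using r2 by linarith
  have "((\<lambda>y::real. 1) has_real_derivative 0) (at y)" by simp
  then have "(\<chi>' has_real_derivative 0) (at y)"
  proof (rule has_field_derivative_transform_within_open[where S = "{y. ln (1 + y\<^sup>2) < r\<^sup>2}"])
    have "continuous_on UNIV (\<lambda>y::real. ln (1 + y\<^sup>2))" by (rule smooth_continuous[OF smooth_log_quad])
    then show "open {y. ln (1 + y\<^sup>2) < r\<^sup>2}" by (intro open_Collect_less continuous_on_const)
  qed (use assms cutoff_one r20 in auto)
  then have "deriv \<chi>' y = 0" by (rule DERIV_imp_deriv)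
  moreover have "\<chi>' y = 1" using cutoff_one[OF r20, of y] assms by simp
  ultimately show ?thesis using p1_bd(1)[of y] unfolding deriv_f by simp
qed

context
  fixes \<mu> :: "real measure" and S :: real
  assumes \<mu>: "real_distribution \<mu>" and i2: "integrable \<mu> (\<lambda>y. 1 + y\<^sup>2)" and S: "(LINT y|\<mu>. 1 + y\<^sup>2) \<le> S"
begin

interpretation real_distribution \<mu> by (rule \<mu>)

lemma quad_integrable: "k \<in> borel_measurable borel \<Longrightarrow> (\<And>y. \<bar>k y\<bar> \<le> c * (1 + y\<^sup>2)) \<Longrightarrow> integrable \<mu> k"
  by (rule integrable_quadratic_bound[OF i2]) auto

lemma integrable_ident: "integrable \<mu> (\<lambda>y. y)"
  by (rule quad_integrable[of _ 1]) (use abs_le_one_plus_square in auto)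

lemma mean_bound: "\<bar>pairing \<mu> (\<lambda>y. y)\<bar> \<le> S"
proof -
  have "\<bar>pairing \<mu> (\<lambda>y. y)\<bar> \<le> (LINT y|\<mu>. \<bar>y\<bar>)" unfolding pairing_def by (rule integral_abs_bound)
  also have "\<dots> \<le> (LINT y|\<mu>. 1 + y\<^sup>2)"
    by (intro integral_mono integrable_abs integrable_ident i2 abs_le_one_plus_square)
  finally show ?thesis using S by linarith
qed

lemma S_ge: "S \<ge> 1"
proof -
  have "(LINT y|\<mu>. 1) \<le> (LINT y|\<mu>. 1 + y\<^sup>2)" by (intro integral_mono i2) auto
  then show ?thesis using S prob_space by simp
qed

lemma integrable_test_fun: "k \<in> test_fun \<Longrightarrow> integrable \<mu> k"
proof -
  assume k: "k \<in> test_fun"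
  obtain B where "\<And>x. \<bar>k x\<bar> \<le> B" using test_fun_bounded[OF k] by blast
  then show ?thesis
    using borel_measurable_continuous_onI[OF smooth_continuous[OF test_fun_smooth[OF k]]]
    by (intro integrable_const_bound[of _ B]) auto
qed

lemma deriv_f_test: "deriv f \<in> test_fun" "deriv (deriv f) \<in> test_fun"
  using f_test_fun test_fun_deriv by auto

text \<open>The pointwise bounds are integrated. The linear term - g m (y - m) drops out because m
  is the mean of \<mu>, and every contribution of the truncation carries 1 / r.\<close>

lemma generator_bound:
  assumes \<theta>: "\<theta> \<ge> 0" and h: "h \<ge> 0"
  defines "G \<equiv> F 0 + 2 + C"
  shows "L_star \<theta> \<sigma> \<mu> f + h * M_star \<mu> f \<le> \<sigma>\<^sup>2 * \<epsilon> / 8 + h * (1 + 27 * exp (1 / \<epsilon>) / \<epsilon> ^ 3)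
     + (3 / 2 * \<sigma>\<^sup>2 * C + \<theta> * (3 + G + 3 * S + S * G) * S + h * C * S) / r"
proof -
  let ?m = "pairing \<mu> (\<lambda>y. y)"
  define Ce where "Ce = 1 + 27 * exp (1 / \<epsilon>) / \<epsilon> ^ 3"
  define K where "K = 3 + G + 3 * S + S * G"
  have smU: "smooth U" unfolding U_def[abs_def] by (intro smooth_diff smooth_power smooth_ident)
  have i1: "integrable \<mu> (deriv (deriv f))" by (rule integrable_test_fun[OF deriv_f_test(2)])
  have i3: "integrable \<mu> (\<lambda>y. (y - ?m) * deriv f y)"
    by (intro integrable_test_fun test_fun_mult deriv_f_test smooth_diff smooth_ident smooth_const)
  have i4: "integrable \<mu> (\<lambda>y. U y * deriv f y)" by (intro integrable_test_fun test_fun_mult deriv_f_test smU)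
  let ?A = "\<lambda>y. \<sigma>\<^sup>2 / 2 * deriv (deriv f) y + (\<theta> * - ((y - ?m) * deriv f y) + h * - (U y * deriv f y))"
  let ?B = "\<lambda>y. (\<sigma>\<^sup>2 / 2 * (\<epsilon> / 4 + 3 * C / r) + h * Ce) + (\<theta> * - (g ?m * (y - ?m)) + (\<theta> * (K / r) + h * (C / r)) * (1 + y\<^sup>2))"
  have iA: "integrable \<mu> ?A"
    by (intro Bochner_Integration.integrable_add integrable_mult_right integrable_minus i1 i3 i4)
  have iym: "integrable \<mu> (\<lambda>y. y - ?m)" by (intro Bochner_Integration.integrable_diff integrable_ident) simp
  have iB: "integrable \<mu> ?B"
    by (intro Bochner_Integration.integrable_add integrable_mult_right integrable_minus iym i2) simp_all
  have "L_star \<theta> \<sigma> \<mu> f + h * M_star \<mu> f = (LINT y|\<mu>. ?A y)"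
    unfolding L_star_def M_star_def D_y_def mult_distr_def using i1 i3 i4 by (simp add: pairing_def)
  also have "\<dots> \<le> (LINT y|\<mu>. ?B y)"
  proof (rule integral_mono[OF iA iB])
    fix y
    have "\<sigma>\<^sup>2 / 2 * deriv (deriv f) y \<le> \<sigma>\<^sup>2 / 2 * (\<epsilon> / 4 + 3 * C / r)"
      by (intro mult_left_mono deriv2_f_bound) simp
    moreover have "\<theta> * - ((y - ?m) * deriv f y) \<le> \<theta> * (- (g ?m * (y - ?m)) + K / r * (1 + y\<^sup>2))"
      unfolding K_def G_def by (intro mult_left_mono drift_term_bound mean_bound \<theta>)
    moreover have "h * - (U y * deriv f y) \<le> h * (Ce + C / r * (1 + y\<^sup>2))"
      unfolding Ce_def using U_term_bound[of y] by (intro mult_left_mono h) simp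
    moreover have "?B y = \<sigma>\<^sup>2 / 2 * (\<epsilon> / 4 + 3 * C / r)
        + (\<theta> * (- (g ?m * (y - ?m)) + K / r * (1 + y\<^sup>2)) + h * (Ce + C / r * (1 + y\<^sup>2)))"
      by (simp only: distrib_left distrib_right mult.assoc add_ac)
    ultimately show "?A y \<le> ?B y" by linarith
  qed
  also have "\<dots> = (\<sigma>\<^sup>2 / 2 * (\<epsilon> / 4 + 3 * C / r) + h * Ce) + (\<theta> * (K / r) + h * (C / r)) * (LINT y|\<mu>. 1 + y\<^sup>2)"
  proof -
    have "(LINT y|\<mu>. y - ?m) = 0"
      using integrable_ident prob_space by (simp add: pairing_def)
    then have z: "(LINT y|\<mu>. \<theta> * - (g ?m * (y - ?m))) = 0" by simp
    have ii: "integrable \<mu> (\<lambda>y. \<theta> * - (g ?m * (y - ?m)))" "integrable \<mu> (\<lambda>y. (\<theta> * (K / r) + h * (C / r)) * (1 + y\<^sup>2))"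
      by (intro integrable_mult_right integrable_minus iym i2)+
    show ?thesis
      using z ii prob_space
      by (simp only: Bochner_Integration.integral_add[OF _ Bochner_Integration.integrable_add[OF ii]] integrable_const
          Bochner_Integration.integral_add[OF ii] integral_mult_right_zero) simp
  qed
  also have "\<dots> \<le> (\<sigma>\<^sup>2 / 2 * (\<epsilon> / 4 + 3 * C / r) + h * Ce) + (\<theta> * (K / r) + h * (C / r)) * S"
  proof (intro add_left_mono mult_left_mono S)
    have "G \<ge> 0" unfolding G_def using softplus_ge(2)[OF \<epsilon>, of 0] C0 by linarith
    then have "K \<ge> 0" using S_ge by (simp add: K_def)
    then show "0 \<le> \<theta> * (K / r) + h * (C / r)" using \<theta> h C0 r by simp
  qed
  also have "\<dots> = \<sigma>\<^sup>2 * \<epsilon> / 8 + h * Ce + (3 / 2 * \<sigma>\<^sup>2 * C + \<theta> * K * S + h * C * S) / r"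
    by (simp add: add_divide_distrib algebra_simps)
  finally show ?thesis unfolding Ce_def K_def .
qed

lemma integrable_softplus: "integrable \<mu> F"
proof (rule quad_integrable[of _ "1 + F 0"])
  show "F \<in> borel_measurable borel" by (rule borel_measurable_continuous_onI[OF smooth_continuous[OF smooth_softplus[OF \<epsilon>]]])
  fix y
  have "\<bar>F y\<bar> \<le> \<bar>y\<bar> + F 0" using softplus_ge(2)[OF \<epsilon>, of y] softplus_le[OF \<epsilon>, of y] by simp
  also have "\<dots> \<le> 1 * (1 + y\<^sup>2) + F 0 * (1 + y\<^sup>2)"
    using abs_le_one_plus_square[of y] mult_left_mono[of 1 "1 + y\<^sup>2" "F 0"] softplus_ge(2)[OF \<epsilon>, of 0]
    by (intro add_mono) auto
  also have "\<dots> = (1 + F 0) * (1 + y\<^sup>2)" by (simp only: distrib_right)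
  finally show "\<bar>F y\<bar> \<le> (1 + F 0) * (1 + y\<^sup>2)" .
qed

lemma pairing_f_le: "pairing \<mu> f \<le> pairing \<mu> F"
  unfolding pairing_def by (intro integral_mono integrable_test_fun f_test_fun integrable_softplus f_le)

lemma pairing_f_ge: "pairing \<mu> F - (6 + 4 * (F 0)\<^sup>2) * S / r \<le> pairing \<mu> f"
proof -
  have "pairing \<mu> F - pairing \<mu> f = (LINT y|\<mu>. F y - f y)"
    unfolding pairing_def using integrable_softplus integrable_test_fun[OF f_test_fun] by simp
  also have "\<dots> \<le> (LINT y|\<mu>. (6 + 4 * (F 0)\<^sup>2) / r * (1 + y\<^sup>2))"
    by (intro integral_mono Bochner_Integration.integrable_diff integrable_softplus integrable_test_fun f_test_fun integrable_mult_right i2 f_ge)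
  also have "\<dots> = (6 + 4 * (F 0)\<^sup>2) / r * (LINT y|\<mu>. 1 + y\<^sup>2)" by (rule integral_mult_right_zero)
  also have "\<dots> \<le> (6 + 4 * (F 0)\<^sup>2) / r * S" using r by (intro mult_left_mono S) simp
  finally show ?thesis by simp
qed

text \<open>Makes f admissible in the supremum of the rate function. Otherwise ln (1 + y^2) >= r^2
  almost surely, whereas its mean is at most 4 S.\<close>

lemma pairing_deriv_sq_nonzero:
  assumes big: "r\<^sup>2 > 4 * S" shows "pairing \<mu> (\<lambda>y. (deriv f y)\<^sup>2) \<noteq> 0"
proof
  assume 0: "pairing \<mu> (\<lambda>y. (deriv f y)\<^sup>2) = 0"
  have "(\<lambda>y. deriv f y * deriv f y) \<in> test_fun" by (intro test_fun_mult test_fun_smooth deriv_f_test)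
  then have "integrable \<mu> (\<lambda>y. (deriv f y)\<^sup>2)" using integrable_test_fun by (simp add: power2_eq_square)
  then have "AE y in \<mu>. (deriv f y)\<^sup>2 = 0"
    using 0 integral_nonneg_eq_0_iff_AE[of \<mu> "\<lambda>y. (deriv f y)\<^sup>2"] by (simp add: pairing_def)
  then have ae: "AE y in \<mu>. r\<^sup>2 \<le> ln (1 + y\<^sup>2)"
    by eventually_elim (use deriv_f_nonzero in \<open>force simp: not_less[symmetric]\<close>)
  have il: "integrable \<mu> (\<lambda>y. ln (1 + y\<^sup>2))"
  proof (rule quad_integrable[of _ 4])
    show "(\<lambda>y::real. ln (1 + y\<^sup>2)) \<in> borel_measurable borel" by (rule borel_measurable_continuous_onI[OF smooth_continuous[OF smooth_log_quad]])
    fix y :: real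
    show "\<bar>ln (1 + y\<^sup>2)\<bar> \<le> 4 * (1 + y\<^sup>2)"
      using log_quad_bounds[of y] abs_le_one_plus_square[of y] zero_le_power2[of y] by (smt (verit))
  qed
  have "r\<^sup>2 = (LINT y|\<mu>. r\<^sup>2)" using prob_space by simp
  also have "\<dots> \<le> (LINT y|\<mu>. ln (1 + y\<^sup>2))" by (intro integral_mono_AE il ae) simp
  also have "\<dots> \<le> (LINT y|\<mu>. 4 * (1 + y\<^sup>2))"
  proof (intro integral_mono il integrable_mult_right i2)
    show "ln (1 + y\<^sup>2) \<le> 4 * (1 + y\<^sup>2)" for y :: real
      using log_quad_bounds[of y] abs_le_one_plus_square[of y] zero_le_power2[of y] by (smt (verit))
  qed
  also have "\<dots> = 4 * (LINT y|\<mu>. 1 + y\<^sup>2)" by (rule integral_mult_right_zero)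
  also have "\<dots> \<le> 4 * S" using S by simp
  finally show False using big by simp
qed

end

end

text \<open>The softplus lies above the line y + 1 / \<epsilon>^2 at time T and, on average, at most
  Ke exp (-1 / \<epsilon>) / \<epsilon> above it at time 0. The intercepts cancel, and the drift
  accounts for the T-term of D. The other errors are of order 1 / r with path-dependent constants
  and vanish as r tends to infinity.\<close>

lemma rate_lower_bound:
  fixes T \<theta> \<sigma> h \<kappa> \<epsilon> \<xi> :: real
  assumes T: "T > 0" and \<theta>: "\<theta> > 0" and \<sigma>: "\<sigma> > 0" and h: "h \<ge> 0" and \<kappa>: "\<kappa> \<ge> 0" and \<epsilon>: "\<epsilon> > 0"
    and \<phi>: "\<phi> \<in> path_space \<kappa> T"
    and mT: "pairing (\<phi> T) (\<lambda>y. y) = \<xi>" and m0: "pairing (\<phi> 0) (\<lambda>y. y) = - \<xi>"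
    and ie: "integrable (\<phi> 0) (\<lambda>y. exp (- \<epsilon> * y))" and Ke: "pairing (\<phi> 0) (\<lambda>y. exp (- \<epsilon> * y)) \<le> Ke"
    and D: "D = 2 * \<xi> - Ke * (exp (- (1 / \<epsilon>)) / \<epsilon>) - T * (\<sigma>\<^sup>2 * \<epsilon> / 8 + h * (1 + 27 * exp (1 / \<epsilon>) / \<epsilon> ^ 3))" "D \<ge> 0"
  shows "ennreal (D\<^sup>2 / (2 * \<sigma>\<^sup>2 * T)) \<le> rate h \<theta> \<sigma> T \<phi>"
proof (cases "abs_cont_path T \<phi>")
  case False then show ?thesis by (simp add: rate_def)
next
  case True
  let ?J = "\<integral>\<^sup>+t\<in>{0..T}. rate_integrand h \<theta> \<sigma> \<phi> t \<partial>lborel"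
  obtain S where S: "S > 0" "\<And>t. t \<in> {0..T} \<Longrightarrow> phi_moment \<kappa> (\<phi> t) \<le> ennreal S"
    using path_space_moment_bound[OF \<phi>] by blast
  have prob: "real_distribution (\<phi> t)" if "t \<in> {0..T}" for t using \<phi> that by (auto simp: path_space_def M_inf_def)
  have i2: "integrable (\<phi> t) (\<lambda>y. 1 + y\<^sup>2)" "(LINT y|\<phi> t. 1 + y\<^sup>2) \<le> S" if "t \<in> {0..T}" for t
    using phi_moment_integrable[OF prob[OF that] \<kappa> _ S(2)[OF that]] S(1) by auto
  obtain C where C: "C > 0" "\<forall>M\<ge>1. \<forall>y. \<bar>deriv (cutoff M) y\<bar> \<le> C / M * (\<bar>y\<bar> / (1 + y\<^sup>2)) \<and> \<bar>deriv (deriv (cutoff M)) y\<bar> \<le> C / M"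
    using cutoff_derivs_all by blast
  define Ce where "Ce = 1 + 27 * exp (1 / \<epsilon>) / \<epsilon> ^ 3"
  define G where "G = softplus \<epsilon> 0 + 2 + C"
  define K1 where "K1 = 3 / 2 * \<sigma>\<^sup>2 * C + \<theta> * (3 + G + 3 * S + S * G) * S + h * C * S"
  define K2 where "K2 = (6 + 4 * (softplus \<epsilon> 0)\<^sup>2) * S"
  have T0: "0 \<in> {0..T}" "T \<in> {0..T}" using T by auto
  \<comment> \<open>\<open>max 0\<close> makes the claim trivial as long as the truncation error
    exceeds D.\<close>
  have step: "ennreal ((max 0 (D - (K2 + T * K1) / r))\<^sup>2 / (T * (1 + C / r)\<^sup>2)) \<le> ?J" if rr: "r \<ge> 1" "r\<^sup>2 > 4 * S" for r
  proof -
    interpret truncation \<epsilon> r C using \<epsilon> rr(1) C by unfold_locales auto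
    let ?A = "\<sigma>\<^sup>2 * \<epsilon> / 8 + h * Ce + K1 / r"
    have A: "L_star \<theta> \<sigma> (\<phi> t) f + h * M_star (\<phi> t) f \<le> ?A" if t: "t \<in> {0..T}" for t
      unfolding Ce_def K1_def G_def
      by (rule generator_bound[OF prob[OF t] i2[OF t] less_imp_le[OF \<theta>] h])
    have nz: "pairing (\<phi> t) (\<lambda>y. (deriv f y)\<^sup>2) \<noteq> 0" if t: "t \<in> {0..T}" for t
      by (rule pairing_deriv_sq_nonzero[OF prob[OF t] i2[OF t] rr(2)])
    have B: "1 + C / r > 0" using C0 rr(1) by (simp add: add_pos_nonneg)
    have up: "\<xi> + 1 / \<epsilon>\<^sup>2 \<le> pairing (\<phi> T) F"
    proof -
      interpret P: real_distribution "\<phi> T" by (rule prob[OF T0(2)])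
      have "(LINT y|\<phi> T. y + 1 / \<epsilon>\<^sup>2) \<le> pairing (\<phi> T) F"
        unfolding pairing_def
        by (intro integral_mono Bochner_Integration.integrable_add integrable_softplus[OF prob i2] integrable_ident[OF prob i2] T0 softplus_ge[OF \<epsilon>]) simp
      then show ?thesis
        using mT integrable_ident[OF prob i2, OF T0(2) T0(2) T0(2)] P.prob_space by (simp add: pairing_def)
    qed
    have lo: "pairing (\<phi> 0) F \<le> - \<xi> + 1 / \<epsilon>\<^sup>2 + Ke * (exp (- (1 / \<epsilon>)) / \<epsilon>)"
    proof -
      interpret P: real_distribution "\<phi> 0" by (rule prob[OF T0(1)])
      let ?c = "exp (- (1 / \<epsilon>)) / \<epsilon>"
      have id: "integrable (\<phi> 0) (\<lambda>y. y)" by (rule integrable_ident[OF prob i2, OF T0(1) T0(1) T0(1)])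
      have "pairing (\<phi> 0) F \<le> (LINT y|\<phi> 0. (y + 1 / \<epsilon>\<^sup>2) + ?c * exp (- \<epsilon> * y))"
        unfolding pairing_def
      proof (intro integral_mono Bochner_Integration.integrable_add integrable_softplus[OF prob i2] id T0 integrable_mult_right ie)
        show "F y \<le> y + 1 / \<epsilon>\<^sup>2 + ?c * exp (- \<epsilon> * y)" for y using softplus_minus_le[OF \<epsilon>, of y] by linarith
      qed simp
      also have "\<dots> = - \<xi> + 1 / \<epsilon>\<^sup>2 + ?c * pairing (\<phi> 0) (\<lambda>y. exp (- \<epsilon> * y))"
        using m0 id ie P.prob_space by (simp add: pairing_def)
      also have "\<dots> \<le> - \<xi> + 1 / \<epsilon>\<^sup>2 + ?c * Ke" using Ke \<epsilon> by (intro add_left_mono mult_left_mono) auto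
      finally show ?thesis by (simp add: mult.commute)
    qed
    have fT: "pairing (\<phi> T) F - K2 / r \<le> pairing (\<phi> T) f"
      unfolding K2_def by (rule pairing_f_ge[OF prob[OF T0(2)] i2[OF T0(2)]])
    have f0: "pairing (\<phi> 0) f \<le> pairing (\<phi> 0) F" by (rule pairing_f_le[OF prob[OF T0(1)] i2[OF T0(1)]])
    have DD: "D - (K2 + T * K1) / r \<le> pairing (\<phi> T) f - pairing (\<phi> 0) f - T * ?A"
      using fT f0 up lo unfolding D(1) Ce_def by (simp add: add_divide_distrib distrib_left)
    show ?thesis
    proof (cases "D - (K2 + T * K1) / r \<ge> 0")
      case True2: True
      show ?thesis
        using action_lower_bound[OF T True f_test_fun prob nz B deriv_f_bound A True2 DD] True2 by simp
    qed simp
  qed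
  have lim: "(\<lambda>n. ennreal ((max 0 (D - (K2 + T * K1) / real n))\<^sup>2 / (T * (1 + C / real n)\<^sup>2))) \<longlonglongrightarrow> ennreal ((max 0 (D - 0))\<^sup>2 / (T * (1 + 0)\<^sup>2))"
    by (intro tendsto_ennrealI tendsto_divide tendsto_power tendsto_max tendsto_const tendsto_diff tendsto_mult tendsto_add
        lim_const_over_n) (use T in simp)
  have ev: "eventually (\<lambda>n. ennreal ((max 0 (D - (K2 + T * K1) / real n))\<^sup>2 / (T * (1 + C / real n)\<^sup>2)) \<le> ?J) sequentially"
  proof -
    \<comment> \<open>n >= 4 S + 1 yields n >= 1 and n^2 >= n > 4 S, the two conditions on
      r.\<close>
    obtain N :: nat where N: "4 * S + 1 \<le> real N" using real_arch_simple by blast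
    show ?thesis using eventually_ge_at_top[of N]
    proof eventually_elim
      case (elim n)
      then have n: "real n \<ge> 4 * S + 1" using N by linarith
      then have n1: "real n \<ge> 1" using S(1) by linarith
      then have "real n \<le> (real n)\<^sup>2" using self_le_power[of "real n" 2] by simp
      then show ?case using n n1 by (intro step) linarith+
    qed
  qed
  have "ennreal ((max 0 (D - 0))\<^sup>2 / (T * (1 + 0)\<^sup>2)) \<le> ?J"
    by (rule tendsto_upperbound[OF lim ev]) simp
  then have J: "ennreal (D\<^sup>2 / T) \<le> ?J" using D(2) by simp
  have "ennreal (D\<^sup>2 / (2 * \<sigma>\<^sup>2 * T)) = ennreal (1 / (2 * \<sigma>\<^sup>2)) * ennreal (D\<^sup>2 / T)"
    using T by (simp add: ennreal_mult[symmetric])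
  also have "\<dots> \<le> ennreal (1 / (2 * \<sigma>\<^sup>2)) * ?J" by (rule mult_left_mono[OF J]) simp
  finally show ?thesis using True by (simp add: rate_def)
qed

section \<open>Expansion of the compatibility equation\<close>

text \<open>Central moments of variance s: the odd ones vanish, the even ones are 1, s, 3 s^2, 15
  s^3. Degree 7 is that of U V.\<close>

lemma gauss_moment_poly:
  fixes s \<xi> :: real and a :: "nat \<Rightarrow> real"
  assumes s: "s > 0"
  shows "mom s 0 (\<lambda>y. \<Sum>n<8. a n * (y - \<xi>) ^ n) \<xi> = sqrt (2 * pi * s) * (a 0 + a 2 * s + 3 * a 4 * s\<^sup>2 + 15 * a 6 * s ^ 3)"
proof -
  let ?N = "normal_density \<xi> (sqrt s)"
  have ss: "sqrt s > 0" "(sqrt s)\<^sup>2 = s" using s by auto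
  have wt: "wt s 0 \<xi> y = sqrt (2 * pi * s) * ?N y" for y
    using s by (simp add: wt_def normal_density_def)
  have ev: "has_bochner_integral lborel (\<lambda>y. ?N y * (y - \<xi>) ^ (2 * k)) (fact (2 * k) / ((2 / s) ^ k * fact k))" for k
    using normal_moment_even[OF ss(1), of \<xi> k] unfolding ss(2) .
  have od: "has_bochner_integral lborel (\<lambda>y. ?N y * (y - \<xi>) ^ (2 * k + 1)) 0" for k
    by (rule normal_moment_odd[OF ss(1)])
  have m: "has_bochner_integral lborel (\<lambda>y. ?N y * (y - \<xi>) ^ n) ([1, 0, s, 0, 3 * s\<^sup>2, 0, 15 * s ^ 3, 0] ! n)" if "n < 8" for n
  proof -
    have "n = 0 \<or> n = 1 \<or> n = 2 \<or> n = 3 \<or> n = 4 \<or> n = 5 \<or> n = 6 \<or> n = 7" using that by linarith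
    then show ?thesis
      using ev[of 0] od[of 0] ev[of 1] od[of 1] ev[of 2] od[of 2] ev[of 3] od[of 3] s
      by (elim disjE) (simp_all add: fact_numeral field_simps power2_eq_square power3_eq_cube eval_nat_numeral)
  qed
  have "has_bochner_integral lborel (\<lambda>y. \<Sum>n<8. (sqrt (2 * pi * s) * a n) * (?N y * (y - \<xi>) ^ n))
      (\<Sum>n<8. (sqrt (2 * pi * s) * a n) * ([1, 0, s, 0, 3 * s\<^sup>2, 0, 15 * s ^ 3, 0] ! n))"
    by (intro has_bochner_integral_sum has_bochner_integral_mult_right m) auto
  moreover have "(\<Sum>n<8. (sqrt (2 * pi * s) * a n) * (?N y * (y - \<xi>) ^ n)) = (\<Sum>n<8. a n * (y - \<xi>) ^ n) * wt s 0 \<xi> y" for y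
    unfolding wt sum_distrib_right by (intro sum.cong refl) simp
  moreover have "(\<Sum>n<8. (sqrt (2 * pi * s) * a n) * ([1, 0, s, 0, 3 * s\<^sup>2, 0, 15 * s ^ 3, 0] ! n))
      = sqrt (2 * pi * s) * (a 0 + a 2 * s + 3 * a 4 * s\<^sup>2 + 15 * a 6 * s ^ 3)"
    by (simp add: eval_nat_numeral lessThan_Suc algebra_simps)
  ultimately show ?thesis unfolding mom_def by (simp add: has_bochner_integral_iff)
qed

text \<open>Taylor coefficients of \<open>U\<close> at \<xi>. The positive zero, at \<xi>^2 = 1 - 3
  s, is \<xi>0.\<close>

lemma gauss_moment_U:
  assumes s: "s > 0" shows "mom s 0 U \<xi> = sqrt (2 * pi * s) * (\<xi> * (\<xi>\<^sup>2 - (1 - 3 * s)))"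
proof -
  have "U = (\<lambda>y. \<Sum>n<8. ([\<xi> ^ 3 - \<xi>, 3 * \<xi>\<^sup>2 - 1, 3 * \<xi>, 1, 0, 0, 0, 0] ! n) * (y - \<xi>) ^ n)"
    by (intro ext) (simp add: U_def eval_nat_numeral lessThan_Suc algebra_simps)
  then have "mom s 0 U \<xi> = sqrt (2 * pi * s) * ((\<xi> ^ 3 - \<xi>) + 3 * \<xi> * s)"
    using gauss_moment_poly[OF s, of "\<lambda>n. [\<xi> ^ 3 - \<xi>, 3 * \<xi>\<^sup>2 - 1, 3 * \<xi>, 1, 0, 0, 0, 0] ! n" \<xi>] by simp
  also have "(\<xi> ^ 3 - \<xi>) + 3 * \<xi> * s = \<xi> * (\<xi>\<^sup>2 - (1 - 3 * s))" by (simp add: eval_nat_numeral algebra_simps)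
  finally show ?thesis .
qed

text \<open>U V = y^7 / 4 - 3 y^5 / 4 + y^3 / 2, with the powers replaced by the moments of the
  normal law of mean \<xi> and variance s.\<close>

definition UV_moment :: "real \<Rightarrow> real \<Rightarrow> real" where
  "UV_moment s \<xi> = (\<xi> ^ 7 + 21 * s * \<xi> ^ 5 + 105 * s\<^sup>2 * \<xi> ^ 3 + 105 * s ^ 3 * \<xi>) / 4
     - 3 / 4 * (\<xi> ^ 5 + 10 * s * \<xi> ^ 3 + 15 * s\<^sup>2 * \<xi>) + (\<xi> ^ 3 + 3 * s * \<xi>) / 2"

lemma gauss_moment_UV:
  assumes s: "s > 0" shows "mom s 0 (\<lambda>y. U y * V y) \<xi> = sqrt (2 * pi * s) * UV_moment s \<xi>"
proof -
  \<comment> \<open>Taylor coefficients of U V at \<xi>.\<close>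
  define c where "c = [\<xi> ^ 7 / 4 - 3 / 4 * \<xi> ^ 5 + \<xi> ^ 3 / 2, 7 * \<xi> ^ 6 / 4 - 15 / 4 * \<xi> ^ 4 + 3 * \<xi>\<^sup>2 / 2,
    21 * \<xi> ^ 5 / 4 - 30 / 4 * \<xi> ^ 3 + 3 * \<xi> / 2, 35 * \<xi> ^ 4 / 4 - 30 / 4 * \<xi>\<^sup>2 + 1 / 2, 35 * \<xi> ^ 3 / 4 - 15 / 4 * \<xi>,
    21 * \<xi>\<^sup>2 / 4 - 3 / 4, 7 * \<xi> / 4, 1 / 4]"
  have "(\<lambda>y. U y * V y) = (\<lambda>y. \<Sum>n<8. (c ! n) * (y - \<xi>) ^ n)"
    by (intro ext) (simp add: c_def U_def V_def eval_nat_numeral lessThan_Suc field_simps)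
  then have "mom s 0 (\<lambda>y. U y * V y) \<xi> = sqrt (2 * pi * s) * (c ! 0 + c ! 2 * s + 3 * (c ! 4) * s\<^sup>2 + 15 * (c ! 6) * s ^ 3)"
    using gauss_moment_poly[OF s, of "\<lambda>n. c ! n" \<xi>] by simp
  also have "c ! 0 + c ! 2 * s + 3 * (c ! 4) * s\<^sup>2 + 15 * (c ! 6) * s ^ 3 = UV_moment s \<xi>"
    by (simp add: c_def UV_moment_def eval_nat_numeral field_simps)
  finally show ?thesis .
qed

text \<open>Second-order expansion of exp (- b V) in b. As - b V <= 1/4, the remainder is at most
  b^2 V^2 exp (1/4), integrable uniformly in \<xi>.\<close>

lemma mom_U_expansion:
  assumes s: "s > 0"
  obtains K where "K > 0" "\<And>b \<xi>. 0 \<le> b \<Longrightarrow> b \<le> 1 \<Longrightarrow> \<bar>\<xi>\<bar> \<le> R \<Longrightarrow>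
    \<bar>mom s b U \<xi> / sqrt (2 * pi * s) - (\<xi> * (\<xi>\<^sup>2 - (1 - 3 * s)) - b * UV_moment s \<xi>)\<bar> \<le> K * b\<^sup>2"
proof -
  let ?N = "sqrt (2 * pi * s)"
  have N: "?N > 0" using s by simp
  define K0 where "K0 = exp (1 / 4 + R\<^sup>2 / (2 * s)) * (LINT y|lborel. \<bar>U y * (V y)\<^sup>2\<bar> * exp (- (y\<^sup>2 / (4 * s))))"
  define K where "K = exp (1 / 4) * K0 / ?N + 1"
  have K0: "K0 \<ge> 0" unfolding K0_def by (intro mult_nonneg_nonneg integral_nonneg_AE AE_I2) auto
  have Kp: "K > 0" unfolding K_def using K0 N by (intro add_nonneg_pos) auto
  show thesis
  proof (rule that[OF Kp])
    fix b \<xi> :: real assume b: "0 \<le> b" "b \<le> 1" and \<xi>: "\<bar>\<xi>\<bar> \<le> R"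
    have z: "0 \<le> (0::real)" "(0::real) \<le> 1" by auto
    note g = exp_growth_intros exp_growth_U exp_growth_V
    have i1: "integrable lborel (\<lambda>y. U y * wt s b \<xi> y)" by (rule exp_growth_integrable[OF s exp_growth_U b])
    have i2: "integrable lborel (\<lambda>y. U y * wt s 0 \<xi> y)" by (rule exp_growth_integrable[OF s exp_growth_U z])
    have i3: "integrable lborel (\<lambda>y. U y * V y * wt s 0 \<xi> y)" by (intro exp_growth_integrable[OF s _ z] g)
    have i4: "integrable lborel (\<lambda>y. \<bar>U y * (V y)\<^sup>2\<bar> * wt s 0 \<xi> y)" by (intro exp_growth_integrable[OF s _ z] g)
    let ?R = "\<lambda>y. U y * wt s b \<xi> y - (U y * wt s 0 \<xi> y - b * (U y * V y * wt s 0 \<xi> y))"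
    have iR: "integrable lborel ?R" using i1 i2 i3 by (intro Bochner_Integration.integrable_diff integrable_mult_right)
    have e: "mom s b U \<xi> - (mom s 0 U \<xi> - b * mom s 0 (\<lambda>y. U y * V y) \<xi>) = (LINT y|lborel. ?R y)"
      unfolding mom_def using i1 i2 i3 by simp
    have "\<bar>LINT y|lborel. ?R y\<bar> \<le> (LINT y|lborel. \<bar>?R y\<bar>)" by (rule integral_abs_bound)
    also have "\<dots> \<le> (LINT y|lborel. (b\<^sup>2 * exp (1 / 4)) * (\<bar>U y * (V y)\<^sup>2\<bar> * wt s 0 \<xi> y))"
    proof (rule integral_mono)
      fix y
      have w: "wt s b \<xi> y = wt s 0 \<xi> y * exp (- (b * V y))" by (simp add: wt_def exp_add[symmetric])
      have m: "max 1 (exp (- (b * V y))) \<le> exp (1 / 4)"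
      proof -
        have "b * (- (1 / 4)) \<le> b * V y" using b V_ge by (intro mult_left_mono) auto
        then show ?thesis using b by (intro max.boundedI) auto
      qed
      have "\<bar>exp (- (b * V y)) - 1 - - (b * V y)\<bar> \<le> (- (b * V y))\<^sup>2 * max 1 (exp (- (b * V y)))" by (rule exp_second_order)
      also have "\<dots> \<le> (- (b * V y))\<^sup>2 * exp (1 / 4)" using m by (intro mult_left_mono) auto
      finally have q: "\<bar>exp (- (b * V y)) - 1 + b * V y\<bar> \<le> (b * V y)\<^sup>2 * exp (1 / 4)" by simp
      have "?R y = U y * wt s 0 \<xi> y * (exp (- (b * V y)) - 1 + b * V y)" unfolding w by (simp add: algebra_simps)
      then have "\<bar>?R y\<bar> = \<bar>U y\<bar> * wt s 0 \<xi> y * \<bar>exp (- (b * V y)) - 1 + b * V y\<bar>"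
        using wt_pos[of s 0 \<xi> y] by (simp add: abs_mult)
      also have "\<dots> \<le> \<bar>U y\<bar> * wt s 0 \<xi> y * ((b * V y)\<^sup>2 * exp (1 / 4))"
        using q wt_pos[of s 0 \<xi> y] by (intro mult_left_mono) auto
      finally show "\<bar>?R y\<bar> \<le> (b\<^sup>2 * exp (1 / 4)) * (\<bar>U y * (V y)\<^sup>2\<bar> * wt s 0 \<xi> y)"
        by (simp add: abs_mult power_mult_distrib mult_ac)
    qed (use iR i4 in auto)
    also have "\<dots> = (b\<^sup>2 * exp (1 / 4)) * mom s 0 (\<lambda>y. \<bar>U y * (V y)\<^sup>2\<bar>) \<xi>" by (simp add: mom_def)
    also have "\<dots> \<le> (b\<^sup>2 * exp (1 / 4)) * K0"
      unfolding K0_def by (intro mult_left_mono mom_abs_le_gauss[OF s z _ \<xi>] g) auto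
    finally have "\<bar>mom s b U \<xi> - (mom s 0 U \<xi> - b * mom s 0 (\<lambda>y. U y * V y) \<xi>)\<bar> \<le> b\<^sup>2 * exp (1 / 4) * K0" unfolding e .
    then have "\<bar>mom s b U \<xi> - (mom s 0 U \<xi> - b * mom s 0 (\<lambda>y. U y * V y) \<xi>)\<bar> / ?N \<le> b\<^sup>2 * exp (1 / 4) * K0 / ?N"
      using N by (intro divide_right_mono) auto
    moreover have "\<bar>mom s b U \<xi> - (mom s 0 U \<xi> - b * mom s 0 (\<lambda>y. U y * V y) \<xi>)\<bar> / ?N
        = \<bar>mom s b U \<xi> / ?N - (\<xi> * (\<xi>\<^sup>2 - (1 - 3 * s)) - b * UV_moment s \<xi>)\<bar>"
    proof -
      have "\<bar>x\<bar> / ?N = \<bar>x / ?N\<bar>" for x using N by simp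
      moreover have "(x - (n * p - b * (n * q))) / n = x / n - (p - b * q)" if "n > 0" for x p q n :: real
        using that by (simp add: field_simps)
      ultimately show ?thesis unfolding gauss_moment_U[OF s] gauss_moment_UV[OF s] using N by (simp only:)
    qed
    moreover have "b\<^sup>2 * exp (1 / 4) * K0 / ?N \<le> K * b\<^sup>2" by (simp add: K_def algebra_simps)
    ultimately show "\<bar>mom s b U \<xi> / ?N - (\<xi> * (\<xi>\<^sup>2 - (1 - 3 * s)) - b * UV_moment s \<xi>)\<bar> \<le> K * b\<^sup>2" by linarith
  qed
qed

lemma UV_moment_Lipschitz:
  obtains L where "L > 0" "\<And>x. \<bar>x - x0\<bar> \<le> 1 \<Longrightarrow> \<bar>UV_moment s x - UV_moment s x0\<bar> \<le> L * \<bar>x - x0\<bar>"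
proof -
  define D where "D x = (7 * x ^ 6 + 105 * s * x ^ 4 + 315 * s\<^sup>2 * x\<^sup>2 + 105 * s ^ 3) / 4
     - 3 / 4 * (5 * x ^ 4 + 30 * s * x\<^sup>2 + 15 * s\<^sup>2) + (3 * x\<^sup>2 + 3 * s) / 2" for x
  have D: "(UV_moment s has_real_derivative D x) (at x)" for x
    unfolding UV_moment_def[abs_def] D_def
    by (auto intro!: derivative_eq_intros simp: eval_nat_numeral field_simps)
  have "compact (D ` {x0 - 1..x0 + 1})"
    unfolding D_def[abs_def] by (intro compact_continuous_image continuous_intros) auto
  then have "bounded (D ` {x0 - 1..x0 + 1})" by (rule compact_imp_bounded)
  then obtain B where B: "\<And>x. x \<in> {x0 - 1..x0 + 1} \<Longrightarrow> \<bar>D x\<bar> \<le> B"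
    unfolding bounded_iff real_norm_def by blast
  show thesis
  proof (rule that[of "\<bar>B\<bar> + 1"])
    fix x assume x: "\<bar>x - x0\<bar> \<le> 1"
    have "norm (UV_moment s x - UV_moment s x0) \<le> (\<bar>B\<bar> + 1) * norm (x - x0)"
    proof (rule field_differentiable_bound[of "{x0 - 1..x0 + 1}"])
      show "(UV_moment s has_field_derivative D z) (at z within {x0 - 1..x0 + 1})" for z
        by (rule has_field_derivative_at_within[OF D])
      show "norm (D z) \<le> \<bar>B\<bar> + 1" if "z \<in> {x0 - 1..x0 + 1}" for z using B[OF that] by simp
    qed (use x in auto)
    then show "\<bar>UV_moment s x - UV_moment s x0\<bar> \<le> (\<bar>B\<bar> + 1) * \<bar>x - x0\<bar>" by simp
  qed simp
qed

text \<open>Odd powers of x0 reduce to x0 times powers of 1 - 3 s. This is where the factor s^2 (1 -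
  2 s) in \<xi>1 originates.\<close>

lemma UV_moment_at_root:
  assumes "x0\<^sup>2 = 1 - 3 * s" shows "UV_moment s x0 = x0 * (6 * s\<^sup>2 * (1 - 2 * s))"
proof -
  have p: "x0 ^ 3 = x0 * (1 - 3 * s)" "x0 ^ 5 = x0 * (1 - 3 * s)\<^sup>2" "x0 ^ 7 = x0 * (1 - 3 * s) ^ 3"
    unfolding assms[symmetric] by (simp_all add: eval_nat_numeral)
  show ?thesis unfolding UV_moment_def p by (simp add: eval_nat_numeral field_simps)
qed

lemma mom_continuous:
  assumes s: "s > 0" and b: "0 \<le> b" "b \<le> 1" and f: "exp_growth f" shows "continuous_on A (mom s b f)"
proof -
  have "continuous_on A (tilt s b f)"
    by (rule DERIV_continuous_on[OF has_field_derivative_at_within[OF tilt_DERIV[OF s b f]]])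
  then have "continuous_on A (\<lambda>\<xi>. exp (- (\<xi>\<^sup>2 / (2 * s))) * tilt s b f \<xi>)" using s by (intro continuous_intros) auto
  then show ?thesis using mom_eq_tilt[OF s, of b f] by (simp cong: continuous_on_cong)
qed

text \<open>At x0 + h x1 + e h^2 the normalised moment of \<open>U\<close> is 2 (1 - 3 s) e h^2 up
  to E h^2. For e = d and e = -d it has opposite signs.\<close>

lemma compatible_solution_near:
  fixes \<theta> \<sigma> :: real
  assumes \<theta>: "\<theta> > 0" and \<sigma>: "\<sigma> > 0" and q: "3 * \<sigma>\<^sup>2 < 2 * \<theta>"
  defines "s \<equiv> \<sigma>\<^sup>2 / (2 * \<theta>)"
  defines "x0 \<equiv> sqrt (1 - 3 * s)"
  defines "x1 \<equiv> sqrt (1 - 3 * s) * (6 / \<sigma>\<^sup>2) * s\<^sup>2 * ((1 - 2 * s) / (1 - 3 * s))"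
  shows "\<exists>d h0. h0 > 0 \<and> (\<forall>h. 0 < h \<and> h < h0 \<longrightarrow> (\<exists>\<xi>>0. compatible h \<theta> \<sigma> \<xi> \<and> \<bar>\<xi> - (x0 + h * x1)\<bar> \<le> d * h\<^sup>2))"
proof -
  have s_eq: "s = \<sigma>\<^sup>2 / (2 * \<theta>)" by (simp add: s_def)
  have s: "s > 0" using \<theta> \<sigma> by (simp add: s_def)
  have qp: "1 - 3 * s > 0" using q \<theta> by (simp add: s_def field_simps)
  have x0: "x0 > 0" "x0\<^sup>2 = 1 - 3 * s" using qp by (simp_all add: x0_def)
  have \<sigma>2: "\<sigma>\<^sup>2 > 0" using \<sigma> by simp
  obtain K where K: "K > 0" "\<And>b \<xi>. 0 \<le> b \<Longrightarrow> b \<le> 1 \<Longrightarrow> \<bar>\<xi>\<bar> \<le> x0 + 1 \<Longrightarrow>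
    \<bar>mom s b U \<xi> / sqrt (2 * pi * s) - (\<xi> * (\<xi>\<^sup>2 - (1 - 3 * s)) - b * UV_moment s \<xi>)\<bar> \<le> K * b\<^sup>2"
    using mom_U_expansion[OF s, of "x0 + 1"] by blast
  obtain L where L: "L > 0" "\<And>x. \<bar>x - x0\<bar> \<le> 1 \<Longrightarrow> \<bar>UV_moment s x - UV_moment s x0\<bar> \<le> L * \<bar>x - x0\<bar>"
    using UV_moment_Lipschitz[of x0 s] by blast
  define X where "X = \<bar>x1\<bar> + 1"
  \<comment> \<open>Remainders of order h^2: the quadratic and cubic terms in the displacement
    \<eta>, the change of \<open>UV_moment\<close> over \<eta>, and the second-order term in
    b.\<close>
  define E where "E = (3 * x0 + 1) * X\<^sup>2 + 2 / \<sigma>\<^sup>2 * L * X + K * (2 / \<sigma>\<^sup>2)\<^sup>2"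
  have X: "X > 0" by (simp add: X_def)
  have E: "E > 0" unfolding E_def using x0 X L K \<sigma>2 by (intro add_pos_pos mult_pos_pos) auto
  \<comment> \<open>Chosen so that 2 (1 - 3 s) d = E + 1 beats the remainder E.\<close>
  define d where "d = (E + 1) / (2 * (1 - 3 * s))"
  have d: "d > 0" using E qp by (simp add: d_def)
  \<comment> \<open>The minima bound b, |\<eta>| and d h by 1 and keep the solution
    positive.\<close>
  define h0 where "h0 = min (min (\<sigma>\<^sup>2 / 2) (1 / X)) (min (1 / d) (x0 / X))"
  have h0: "h0 > 0" unfolding h0_def using \<sigma>2 X d x0 by simp
  have main: "2 * (1 - 3 * s) * e * h\<^sup>2 - E * h\<^sup>2 \<le> mom s (2 * h / \<sigma>\<^sup>2) U (x0 + h * x1 + e * h\<^sup>2) / sqrt (2 * pi * s)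
      \<and> mom s (2 * h / \<sigma>\<^sup>2) U (x0 + h * x1 + e * h\<^sup>2) / sqrt (2 * pi * s) \<le> 2 * (1 - 3 * s) * e * h\<^sup>2 + E * h\<^sup>2"
    if h: "0 < h" "h < h0" and e: "\<bar>e\<bar> \<le> d" for h e
  proof -
    define b where "b = 2 * h / \<sigma>\<^sup>2"
    define \<eta> where "\<eta> = h * x1 + e * h\<^sup>2"
    define u where "u = UV_moment s (x0 + \<eta>) - UV_moment s x0"
    have b: "0 \<le> b" "b \<le> 1" using h \<sigma>2 by (simp_all add: b_def h0_def)
    have "\<bar>e\<bar> * h \<le> 1"
    proof -
      have "\<bar>e\<bar> * h \<le> d * (1 / d)" using e h d by (intro mult_mono) (auto simp: h0_def)
      then show ?thesis using d by simp
    qed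
    then have "\<bar>e * h\<bar> \<le> 1" using h by (simp add: abs_mult)
    moreover have "\<eta> = h * (x1 + e * h)" by (simp add: \<eta>_def power2_eq_square algebra_simps)
    moreover have "\<bar>x1 + e * h\<bar> \<le> \<bar>x1\<bar> + \<bar>e * h\<bar>" by (rule abs_triangle_ineq)
    ultimately have \<eta>X: "\<bar>\<eta>\<bar> \<le> h * X" using h by (simp add: abs_mult X_def)
    have "h * X < 1" using h X by (simp add: h0_def pos_less_divide_eq)
    then have \<eta>1: "\<bar>\<eta>\<bar> \<le> 1" using \<eta>X by linarith
    have rem: "\<bar>mom s b U (x0 + \<eta>) / sqrt (2 * pi * s) - ((x0 + \<eta>) * ((x0 + \<eta>)\<^sup>2 - (1 - 3 * s)) - b * UV_moment s (x0 + \<eta>))\<bar> \<le> K * b\<^sup>2"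
      using K(2)[OF b, of "x0 + \<eta>"] \<eta>1 x0 by simp
    have cub: "(x0 + \<eta>) * ((x0 + \<eta>)\<^sup>2 - (1 - 3 * s)) = 2 * (1 - 3 * s) * \<eta> + (3 * x0 + \<eta>) * \<eta>\<^sup>2"
      unfolding x0(2)[symmetric] by (simp add: power2_eq_square algebra_simps)
    \<comment> \<open>The first-order balance that determines x1.\<close>
    have lin: "2 * (1 - 3 * s) * (h * x1) = b * UV_moment s x0"
    proof -
      have "(1 - 3 * s) * x1 = x0 * (6 / \<sigma>\<^sup>2) * s\<^sup>2 * (1 - 2 * s)" using qp by (simp add: x1_def x0_def)
      moreover have "2 * (1 - 3 * s) * (h * x1) = 2 * h * ((1 - 3 * s) * x1)" by simp
      ultimately have "2 * (1 - 3 * s) * (h * x1) = 2 * h * (x0 * (6 / \<sigma>\<^sup>2) * s\<^sup>2 * (1 - 2 * s))" by simp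
      then show ?thesis unfolding UV_moment_at_root[OF x0(2)] b_def by simp
    qed
    have split: "(x0 + \<eta>) * ((x0 + \<eta>)\<^sup>2 - (1 - 3 * s)) - b * UV_moment s (x0 + \<eta>) = 2 * (1 - 3 * s) * e * h\<^sup>2 + ((3 * x0 + \<eta>) * \<eta>\<^sup>2 - b * u)"
    proof -
      have "2 * (1 - 3 * s) * \<eta> = b * UV_moment s x0 + 2 * (1 - 3 * s) * e * h\<^sup>2"
        unfolding lin[symmetric] \<eta>_def by (simp add: algebra_simps)
      then show ?thesis unfolding cub u_def by (simp add: algebra_simps)
    qed
    have \<eta>sq: "\<eta>\<^sup>2 \<le> h\<^sup>2 * X\<^sup>2" using \<eta>X abs_le_square_iff[of \<eta> "h * X"] h X by (simp add: power_mult_distrib)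
    have t1: "\<bar>(3 * x0 + \<eta>) * \<eta>\<^sup>2\<bar> \<le> (3 * x0 + 1) * (h\<^sup>2 * X\<^sup>2)"
      unfolding abs_mult using \<eta>sq \<eta>1 x0 by (intro mult_mono) auto
    have t2: "\<bar>b * u\<bar> \<le> 2 / \<sigma>\<^sup>2 * L * X * h\<^sup>2"
    proof -
      have "\<bar>u\<bar> \<le> L * (h * X)" using L(2)[of "x0 + \<eta>"] \<eta>1 \<eta>X L(1) unfolding u_def by (simp add: order_trans[OF _ mult_left_mono])
      then have "\<bar>b * u\<bar> \<le> b * (L * (h * X))" using b by (simp add: abs_mult mult_left_mono)
      then show ?thesis by (simp add: b_def power2_eq_square mult_ac)
    qed
    have t3: "K * b\<^sup>2 = K * (2 / \<sigma>\<^sup>2)\<^sup>2 * h\<^sup>2" by (simp add: b_def power_mult_distrib power_divide)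
    have "E * h\<^sup>2 = (3 * x0 + 1) * (h\<^sup>2 * X\<^sup>2) + 2 / \<sigma>\<^sup>2 * L * X * h\<^sup>2 + K * (2 / \<sigma>\<^sup>2)\<^sup>2 * h\<^sup>2"
      by (simp add: E_def algebra_simps)
    moreover have x: "x0 + h * x1 + e * h\<^sup>2 = x0 + \<eta>" by (simp add: \<eta>_def)
    moreover note rem[unfolded split t3 abs_le_iff] t1[unfolded abs_le_iff] t2[unfolded abs_le_iff]
    ultimately show ?thesis unfolding x b_def[symmetric] by linarith
  qed
  have "\<exists>\<xi>>0. compatible h \<theta> \<sigma> \<xi> \<and> \<bar>\<xi> - (x0 + h * x1)\<bar> \<le> d * h\<^sup>2" if h: "0 < h" "h < h0" for h
  proof -
    have hb: "0 \<le> h" "2 * h / \<sigma>\<^sup>2 \<le> 1" using h \<sigma>2 by (simp_all add: h0_def)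
    have b0: "0 \<le> 2 * h / \<sigma>\<^sup>2" using hb by simp
    let ?M = "mom s (2 * h / \<sigma>\<^sup>2) U" and ?lo = "x0 + h * x1 + (- d) * h\<^sup>2" and ?hi = "x0 + h * x1 + d * h\<^sup>2"
    have N: "sqrt (2 * pi * s) > 0" using s by simp
    have dd: "2 * (1 - 3 * s) * d = E + 1" using qp by (simp add: d_def)
    have h2: "h\<^sup>2 > 0" using h by simp
    have "?M ?hi / sqrt (2 * pi * s) \<ge> (E + 1) * h\<^sup>2 - E * h\<^sup>2" using main[OF h, of d] d dd by simp
    moreover have eh: "(E + 1) * h\<^sup>2 - E * h\<^sup>2 = h\<^sup>2" by (simp add: algebra_simps)
    ultimately have "?M ?hi / sqrt (2 * pi * s) > 0" using h2 by linarith
    then have hi: "?M ?hi > 0" using N by (simp add: zero_less_divide_iff)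
    have "?M ?lo / sqrt (2 * pi * s) \<le> 2 * (1 - 3 * s) * (- d) * h\<^sup>2 + E * h\<^sup>2" using main[OF h, of "- d"] d by simp
    also have "2 * (1 - 3 * s) * (- d) * h\<^sup>2 = - ((E + 1) * h\<^sup>2)" unfolding dd[symmetric] by simp
    finally have "?M ?lo / sqrt (2 * pi * s) < 0" using h2 eh by linarith
    then have lo: "?M ?lo < 0" using N by (simp add: divide_less_0_iff)
    have "?lo \<le> ?hi" using d h2 by simp
    then obtain \<xi> where \<xi>: "?lo \<le> \<xi>" "\<xi> \<le> ?hi" "?M \<xi> = 0"
      using IVT'[of ?M ?lo 0 ?hi] lo hi mom_continuous[OF s b0 hb(2) exp_growth_U] by force
    have "d * h\<^sup>2 \<le> h"
    proof -
      have "d * h \<le> d * (1 / d)" using h d by (intro mult_left_mono) (auto simp: h0_def)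
      then have "d * h * h \<le> 1 * h" using h d by (intro mult_right_mono) auto
      then show ?thesis by (simp add: power2_eq_square)
    qed
    moreover have "h * x1 \<ge> - (h * \<bar>x1\<bar>)" using h mult_left_mono[of "- \<bar>x1\<bar>" x1 h] by simp
    moreover have "h * X < x0" using h X by (simp add: h0_def pos_less_divide_eq)
    ultimately have "\<xi> > 0" using \<xi>(1) by (simp add: X_def algebra_simps)
    moreover have "compatible h \<theta> \<sigma> \<xi>"
      using compatible_iff[OF \<theta> \<sigma> hb s_eq refl h(1)] \<xi>(3) by simp
    moreover have "\<bar>\<xi> - (x0 + h * x1)\<bar> \<le> d * h\<^sup>2" using \<xi>(1,2) by (simp add: abs_le_iff)
    ultimately show ?thesis by blast
  qed
  then show ?thesis using h0 by blast
qed

section \<open>Asymptotics of the infimum\<close>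

text \<open>Diagonal choice: \<gamma> h is the infimum of the admissible tolerances plus h, since
  the infimum itself need not be admissible.\<close>

lemma vanishing_majorant_exists:
  fixes P :: "real \<Rightarrow> real \<Rightarrow> bool"
  assumes ev: "\<And>\<eta>. \<eta> > 0 \<Longrightarrow> \<forall>\<^sub>F h in at_right 0. P h \<eta>"
    and mono: "\<And>h \<eta> \<eta>'. P h \<eta> \<Longrightarrow> \<eta> \<le> \<eta>' \<Longrightarrow> P h \<eta>'"
  shows "\<exists>\<gamma>. (\<gamma> \<longlongrightarrow> 0) (at_right 0) \<and> (\<forall>\<^sub>F h in at_right 0. P h (\<gamma> h))"
proof (intro exI conjI)
  let ?S = "\<lambda>h. {\<eta>. \<eta> > 0 \<and> P h \<eta>}"
  let ?\<gamma> = "\<lambda>h. Inf (?S h) + h"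
  have pos: "\<forall>\<^sub>F h in at_right 0. (h::real) > 0" by (simp add: eventually_at_filter)
  have bdd: "bdd_below (?S h)" for h by (rule bdd_belowI[of _ 0]) auto
  show "\<forall>\<^sub>F h in at_right 0. P h (?\<gamma> h)"
    using ev[OF zero_less_one] pos
  proof eventually_elim
    case (elim h)
    then have "?S h \<noteq> {}" by (auto intro: exI[of _ 1])
    then obtain \<eta> where "\<eta> \<in> ?S h" "\<eta> < Inf (?S h) + h"
      using cInf_lessD[of "?S h" "Inf (?S h) + h"] elim by auto
    then show ?case using mono[of h \<eta>] by auto
  qed
  have "((\<lambda>h. Inf (?S h)) \<longlongrightarrow> 0) (at_right 0)"
  proof (rule tendstoI)
    fix e :: real assume e: "e > 0"
    have "e / 2 > 0" using e by simp
    from ev[OF this] show "\<forall>\<^sub>F h in at_right 0. dist (Inf (?S h)) 0 < e"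
    proof eventually_elim
      case (elim h)
      then have m: "e / 2 \<in> ?S h" using e by simp
      then have "Inf (?S h) \<le> e / 2" using bdd by (rule cInf_lower)
      moreover have "?S h \<noteq> {}" using m by blast
      then have "0 \<le> Inf (?S h)" by (rule cInf_greatest) auto
      ultimately show ?case using e by (simp add: dist_real_def)
    qed
  qed
  moreover have "((\<lambda>h::real. h) \<longlongrightarrow> 0) (at_right 0)" by (rule tendsto_ident_at)
  ultimately show "(?\<gamma> \<longlongrightarrow> 0) (at_right 0)" using tendsto_add[of "\<lambda>h. Inf (?S h)" 0 _ "\<lambda>h. h" 0] by simp
qed

text \<open>exp x >= x^2 / 2 at x = 1 / \<epsilon>.\<close>

lemma exp_minus_recip_le: assumes "\<epsilon> > 0" shows "exp (- (1 / \<epsilon>)) / \<epsilon> \<le> 2 * (\<epsilon>::real)"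
proof -
  have "(1 / \<epsilon>)\<^sup>2 / 2 \<le> exp (1 / \<epsilon>)"
    using exp_lower_Taylor_quadratic[of "1 / \<epsilon>"] assms by (smt (verit) divide_pos_pos)
  then have "(1 / \<epsilon>)\<^sup>2 / 2 * exp (- (1 / \<epsilon>)) \<le> exp (1 / \<epsilon>) * exp (- (1 / \<epsilon>))" by (rule mult_right_mono) simp
  then have "(1 / \<epsilon>)\<^sup>2 / 2 * exp (- (1 / \<epsilon>)) \<le> 1" by (simp add: exp_minus_inverse)
  then have "(2 * \<epsilon>) * ((1 / \<epsilon>)\<^sup>2 / 2 * exp (- (1 / \<epsilon>))) \<le> (2 * \<epsilon>) * 1" using assms by (intro mult_left_mono) auto
  moreover have "(2 * \<epsilon>) * ((1 / \<epsilon>)\<^sup>2 / 2 * exp (- (1 / \<epsilon>))) = exp (- (1 / \<epsilon>)) / \<epsilon>"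
    using assms by (simp add: power2_eq_square)
  ultimately show ?thesis by simp
qed

text \<open>h0 can be uniform over all paths because \<open>rate_lower_bound\<close> no longer
  contains their moment bounds.\<close>

lemma transition_rate_lower_bound:
  fixes T \<theta> \<sigma> R x0 \<eta> :: real
  assumes T: "T > 0" and \<theta>: "\<theta> > 0" and \<sigma>: "\<sigma> > 0" and R: "R > 0" and x0: "x0 > 0" and \<eta>: "\<eta> > 0"
  shows "\<exists>h0>0. \<forall>h \<kappa> \<xi>. 0 < h \<and> h < h0 \<and> 0 \<le> \<kappa> \<and> x0 / 2 \<le> \<xi> \<and> \<xi> \<le> R \<and> compatible h \<theta> \<sigma> \<xi> \<and> compatible h \<theta> \<sigma> (- \<xi>) \<longrightarrow>
    (\<forall>\<phi>\<in>transition_paths \<kappa> h \<theta> \<sigma> T \<xi>. ennreal (2 * \<xi>\<^sup>2 / (\<sigma>\<^sup>2 * T) - \<eta>) \<le> rate h \<theta> \<sigma> T \<phi>)"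
proof -
  define s where "s = \<sigma>\<^sup>2 / (2 * \<theta>)"
  have s: "s > 0" using \<theta> \<sigma> by (simp add: s_def)
  have \<sigma>2: "\<sigma>\<^sup>2 > 0" using \<sigma> by simp
  \<comment> \<open>For \<epsilon> <= 1, exp (- \<epsilon> y) <= exp |y|; so Ke is available before
    \<epsilon> is chosen.\<close>
  obtain Ke where Ke: "Ke > 0" "\<And>b \<xi>. 0 \<le> b \<Longrightarrow> b \<le> 1 \<Longrightarrow> \<bar>\<xi>\<bar> \<le> R \<Longrightarrow> avg s b (\<lambda>y. \<bar>exp (1 * \<bar>y\<bar>)\<bar>) \<xi> \<le> Ke"
    using avg_bounded[OF s exp_growth_exp_abs[of 1], of R] by blast
  \<comment> \<open>The loss allowed in the distance 2 \<xi>: x0 keeps 2 \<xi> - \<delta>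
    non-negative, and the other bound makes 4 \<xi> \<delta> <= 2 \<sigma>^2 T \<eta>, a loss of at
    most \<eta> in the action.\<close>
  define \<delta> where "\<delta> = min x0 (\<eta> * \<sigma>\<^sup>2 * T / (2 * R))"
  have \<delta>: "\<delta> > 0" using x0 \<eta> \<sigma>2 T R by (simp add: \<delta>_def)
  \<comment> \<open>Coefficient of \<epsilon> in the losses that do not involve h; \<epsilon> is
    then small enough for them to use at most half of \<delta>.\<close>
  define A where "A = 2 * Ke + T * \<sigma>\<^sup>2 / 8"
  have A: "A > 0" unfolding A_def using Ke T \<sigma>2 by (intro add_pos_pos) auto
  define \<epsilon> where "\<epsilon> = min 1 (\<delta> / (2 * A))"
  have \<epsilon>: "\<epsilon> > 0" "\<epsilon> \<le> 1" using \<delta> A by (simp_all add: \<epsilon>_def)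
  define Ce where "Ce = 1 + 27 * exp (1 / \<epsilon>) / \<epsilon> ^ 3"
  have Ce: "Ce > 0" unfolding Ce_def using \<epsilon> by (intro add_pos_nonneg) auto
  \<comment> \<open>\<open>Ce\<close> blows up as \<epsilon> tends to 0, so h0 is chosen after
    \<epsilon>; the h-term uses the other half of \<delta>.\<close>
  define h0 where "h0 = min (\<sigma>\<^sup>2 / 2) (\<delta> / (2 * T * Ce))"
  have h0: "h0 > 0" using \<sigma>2 \<delta> T Ce by (simp add: h0_def)
  show ?thesis
  proof (intro exI[of _ h0] conjI h0 allI impI ballI)
    fix h \<kappa> \<xi> :: real and \<phi>
    assume asm: "0 < h \<and> h < h0 \<and> 0 \<le> \<kappa> \<and> x0 / 2 \<le> \<xi> \<and> \<xi> \<le> R \<and> compatible h \<theta> \<sigma> \<xi> \<and> compatible h \<theta> \<sigma> (- \<xi>)"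
      and \<phi>: "\<phi> \<in> transition_paths \<kappa> h \<theta> \<sigma> T \<xi>"
    define b where "b = 2 * h / \<sigma>\<^sup>2"
    have hb: "0 \<le> h" "2 * h / \<sigma>\<^sup>2 \<le> 1" using asm \<sigma>2 by (simp_all add: h0_def)
    note loc = \<theta> \<sigma> hb s_def b_def
    have b: "0 \<le> b" "b \<le> 1" using hb by (simp_all add: b_def)
    have \<phi>p: "\<phi> \<in> path_space \<kappa> T" "\<phi> 0 = eq_measure h \<theta> \<sigma> (- \<xi>)" "\<phi> T = eq_measure h \<theta> \<sigma> \<xi>"
      using \<phi> by (auto simp: transition_paths_def paths_from_def)
    have mean: "pairing (eq_measure h \<theta> \<sigma> x) (\<lambda>y. y) = x" if "compatible h \<theta> \<sigma> x" for x
      using that pairing_eq_measure[OF loc, of "\<lambda>y. y"] by (simp add: compatible_def eq_mean_eq[OF loc])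
    have ge: "exp_growth (\<lambda>y. exp (- \<epsilon> * y))" by (rule exp_growth_exp)
    have "avg s b (\<lambda>y. exp (- \<epsilon> * y)) (- \<xi>) \<le> avg s b (\<lambda>y. \<bar>exp (1 * \<bar>y\<bar>)\<bar>) (- \<xi>)"
    proof (rule avg_mono[OF s b ge])
      show "exp_growth (\<lambda>y. \<bar>exp (1 * \<bar>y\<bar>)\<bar>)" by (intro exp_growth_abs exp_growth_exp_abs)
      fix y :: real
      have "\<bar>- \<epsilon> * y\<bar> \<le> 1 * \<bar>y\<bar>" unfolding abs_mult using \<epsilon> by (intro mult_right_mono) auto
      then have "- \<epsilon> * y \<le> 1 * \<bar>y\<bar>" by linarith
      then show "exp (- \<epsilon> * y) \<le> \<bar>exp (1 * \<bar>y\<bar>)\<bar>" by simp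
    qed
    also have "\<dots> \<le> Ke" using asm x0 by (intro Ke(2)[OF b]) auto
    finally have Ke': "pairing (\<phi> 0) (\<lambda>y. exp (- \<epsilon> * y)) \<le> Ke"
      unfolding \<phi>p(2) pairing_eq_measure[OF loc exp_growth_measurable[OF ge]] .
    define D where "D = 2 * \<xi> - Ke * (exp (- (1 / \<epsilon>)) / \<epsilon>) - T * (\<sigma>\<^sup>2 * \<epsilon> / 8 + h * (1 + 27 * exp (1 / \<epsilon>) / \<epsilon> ^ 3))"
    have D: "2 * \<xi> - \<delta> \<le> D"
    proof -
      have "Ke * (exp (- (1 / \<epsilon>)) / \<epsilon>) \<le> Ke * (2 * \<epsilon>)" using Ke(1) exp_minus_recip_le[OF \<epsilon>(1)] by (intro mult_left_mono) auto
      moreover have "A * \<epsilon> \<le> \<delta> / 2"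
      proof -
        have "A * \<epsilon> \<le> A * (\<delta> / (2 * A))" using A by (intro mult_left_mono) (auto simp: \<epsilon>_def)
        then show ?thesis using A by simp
      qed
      moreover have "T * (h * Ce) \<le> \<delta> / 2"
      proof -
        have "h * (T * Ce) \<le> \<delta> / (2 * T * Ce) * (T * Ce)" using asm T Ce by (intro mult_right_mono) (auto simp: h0_def)
        then show ?thesis using T Ce by (simp add: mult_ac)
      qed
      moreover have "A * \<epsilon> = Ke * (2 * \<epsilon>) + T * (\<sigma>\<^sup>2 * \<epsilon> / 8)" by (simp add: A_def algebra_simps)
      moreover have "D = 2 * \<xi> - Ke * (exp (- (1 / \<epsilon>)) / \<epsilon>) - (T * (\<sigma>\<^sup>2 * \<epsilon> / 8) + T * (h * Ce))"
        unfolding D_def Ce_def by (simp only: distrib_left)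
      ultimately show ?thesis by linarith
    qed
    have \<xi>\<delta>: "\<delta> \<le> 2 * \<xi>" using asm by (auto simp: \<delta>_def)
    then have D0: "0 \<le> D" using D by linarith
    have "2 * \<xi>\<^sup>2 / (\<sigma>\<^sup>2 * T) - \<eta> \<le> D\<^sup>2 / (2 * \<sigma>\<^sup>2 * T)"
    proof -
      have "(2 * \<xi> - \<delta>)\<^sup>2 \<le> D\<^sup>2" using D \<xi>\<delta> by (intro power_mono) auto
      moreover have "4 * \<xi>\<^sup>2 - 4 * \<xi> * \<delta> \<le> (2 * \<xi> - \<delta>)\<^sup>2" by (simp add: power2_eq_square algebra_simps)
      moreover have "4 * \<xi> * \<delta> \<le> 2 * \<sigma>\<^sup>2 * T * \<eta>"
      proof -
        have "4 * \<xi> * \<delta> \<le> 4 * R * (\<eta> * \<sigma>\<^sup>2 * T / (2 * R))"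
          using asm \<delta> R x0 by (intro mult_mono) (auto simp: \<delta>_def)
        then show ?thesis using R by (simp add: mult_ac)
      qed
      ultimately have "4 * \<xi>\<^sup>2 - 2 * \<sigma>\<^sup>2 * T * \<eta> \<le> D\<^sup>2" by linarith
      then have "(4 * \<xi>\<^sup>2 - 2 * \<sigma>\<^sup>2 * T * \<eta>) / (2 * \<sigma>\<^sup>2 * T) \<le> D\<^sup>2 / (2 * \<sigma>\<^sup>2 * T)"
        using \<sigma>2 T by (intro divide_right_mono) auto
      then show ?thesis using \<sigma>2 T \<sigma> by (simp add: diff_divide_distrib mult.commute)
    qed
    then have "ennreal (2 * \<xi>\<^sup>2 / (\<sigma>\<^sup>2 * T) - \<eta>) \<le> ennreal (D\<^sup>2 / (2 * \<sigma>\<^sup>2 * T))" by (rule ennreal_leI)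
    also have "\<dots> \<le> rate h \<theta> \<sigma> T \<phi>"
    proof (rule rate_lower_bound[OF T \<theta> \<sigma> _ _ \<epsilon>(1) \<phi>p(1) _ _ _ Ke' D_def D0])
      show "pairing (\<phi> T) (\<lambda>y. y) = \<xi>" "pairing (\<phi> 0) (\<lambda>y. y) = - \<xi>" unfolding \<phi>p using asm mean by auto
      show "integrable (\<phi> 0) (\<lambda>y. exp (- \<epsilon> * y))" unfolding \<phi>p by (rule integrable_eq_measure[OF loc ge])
    qed (use asm in auto)
    finally show "ennreal (2 * \<xi>\<^sup>2 / (\<sigma>\<^sup>2 * T) - \<eta>) \<le> rate h \<theta> \<sigma> T \<phi>" .
  qed
qed

text \<open>Joins the two one-sided bounds; the upper one also makes the infimum finite, so that the
  difference is one of real numbers.\<close>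

lemma transition_rate_INF_close:
  fixes T \<theta> \<sigma> R x0 \<eta> :: real
  assumes T: "T > 0" and \<theta>: "\<theta> > 0" and \<sigma>: "\<sigma> > 0" and R: "R > 0" and x0: "x0 > 0" and \<eta>: "\<eta> > 0"
  shows "\<exists>h0>0. \<forall>h \<kappa> \<xi>. 0 < h \<and> h < h0 \<and> 0 \<le> \<kappa> \<and> x0 / 2 \<le> \<xi> \<and> \<xi> \<le> R \<and> compatible h \<theta> \<sigma> \<xi> \<and> compatible h \<theta> \<sigma> (- \<xi>) \<longrightarrow>
    \<bar>enn2ereal (INF \<phi>\<in>transition_paths \<kappa> h \<theta> \<sigma> T \<xi>. rate h \<theta> \<sigma> T \<phi>) - ereal (2 * \<xi>\<^sup>2 / (\<sigma>\<^sup>2 * T))\<bar> \<le> ereal \<eta>"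
proof -
  have \<sigma>2: "\<sigma>\<^sup>2 > 0" using \<sigma> by simp
  obtain h1 where h1: "h1 > 0" "\<And>h \<kappa> \<xi> \<phi>. 0 < h \<Longrightarrow> h < h1 \<Longrightarrow> 0 \<le> \<kappa> \<Longrightarrow> x0 / 2 \<le> \<xi> \<Longrightarrow> \<xi> \<le> R \<Longrightarrow>
      compatible h \<theta> \<sigma> \<xi> \<Longrightarrow> compatible h \<theta> \<sigma> (- \<xi>) \<Longrightarrow> \<phi> \<in> transition_paths \<kappa> h \<theta> \<sigma> T \<xi> \<Longrightarrow>
      ennreal (2 * \<xi>\<^sup>2 / (\<sigma>\<^sup>2 * T) - \<eta>) \<le> rate h \<theta> \<sigma> T \<phi>"
    using transition_rate_lower_bound[OF assms] by auto
  obtain K where K: "K \<ge> 0" "\<And>h \<kappa> \<xi>. 0 \<le> h \<Longrightarrow> 2 * h / \<sigma>\<^sup>2 \<le> 1 \<Longrightarrow> 0 \<le> \<kappa> \<Longrightarrow> 0 \<le> \<xi> \<Longrightarrow> \<xi> \<le> R \<Longrightarrow>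
      \<exists>\<phi>\<in>transition_paths \<kappa> h \<theta> \<sigma> T \<xi>. rate h \<theta> \<sigma> T \<phi> \<le> ennreal (T / (2 * \<sigma>\<^sup>2) * (2 * \<xi> / T + K * h)\<^sup>2)"
    using rate_upper_bound[OF T \<theta> \<sigma>, of R] by auto
  \<comment> \<open>Bounds the coefficient of h in the expanded square for h <= 1; the added 1 keeps
    Q positive.\<close>
  define Q where "Q = (2 * R * K + T * K\<^sup>2 / 2) / \<sigma>\<^sup>2 + 1"
  have "0 \<le> (2 * R * K + T * K\<^sup>2 / 2) / \<sigma>\<^sup>2" using R K(1) T by simp
  then have Q: "Q > 0" by (simp add: Q_def)
  define h0 where "h0 = min (min h1 1) (min (\<sigma>\<^sup>2 / 2) (\<eta> / Q))"
  have h0: "h0 > 0" using h1 \<sigma>2 \<eta> Q by (simp add: h0_def)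
  show ?thesis
  proof (intro exI[of _ h0] conjI h0 allI impI)
    fix h \<kappa> \<xi> :: real
    assume asm: "0 < h \<and> h < h0 \<and> 0 \<le> \<kappa> \<and> x0 / 2 \<le> \<xi> \<and> \<xi> \<le> R \<and> compatible h \<theta> \<sigma> \<xi> \<and> compatible h \<theta> \<sigma> (- \<xi>)"
    let ?X = "INF \<phi>\<in>transition_paths \<kappa> h \<theta> \<sigma> T \<xi>. rate h \<theta> \<sigma> T \<phi>" and ?L = "2 * \<xi>\<^sup>2 / (\<sigma>\<^sup>2 * T)"
    have L: "?L \<ge> 0" using T by simp
    have \<xi>0: "\<xi> \<ge> 0" using asm x0 by linarith
    have lower: "ennreal (?L - \<eta>) \<le> ?X"
      by (rule INF_greatest) (use asm h1(2) in \<open>auto simp: h0_def\<close>)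
    obtain \<phi> where \<phi>: "\<phi> \<in> transition_paths \<kappa> h \<theta> \<sigma> T \<xi>" "rate h \<theta> \<sigma> T \<phi> \<le> ennreal (T / (2 * \<sigma>\<^sup>2) * (2 * \<xi> / T + K * h)\<^sup>2)"
      using K(2)[of h \<kappa> \<xi>] asm \<xi>0 \<sigma>2 by (auto simp: h0_def)
    have hK: "h * Q < \<eta>" using asm Q by (simp add: h0_def pos_less_divide_eq)
    have "T / (2 * \<sigma>\<^sup>2) * (2 * \<xi> / T + K * h)\<^sup>2 = ?L + h * ((2 * \<xi> * K + T * K\<^sup>2 * h / 2) / \<sigma>\<^sup>2)"
    proof -
      have "T * (2 * \<xi> / T + K * h)\<^sup>2 = 4 * \<xi>\<^sup>2 / T + 4 * \<xi> * K * h + T * K\<^sup>2 * h\<^sup>2"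
        using T by (simp add: power2_eq_square field_simps)
      then have "T / (2 * \<sigma>\<^sup>2) * (2 * \<xi> / T + K * h)\<^sup>2 = (4 * \<xi>\<^sup>2 / T + 4 * \<xi> * K * h + T * K\<^sup>2 * h\<^sup>2) / (2 * \<sigma>\<^sup>2)"
        by (simp only: times_divide_eq_left)
      also have "\<dots> = ?L + h * ((2 * \<xi> * K + T * K\<^sup>2 * h / 2) / \<sigma>\<^sup>2)"
      proof -
        have "(4 * a / T + 4 * \<xi> * K * h + T * k * (h * h)) / (2 * w) = 2 * a / (w * T) + h * ((2 * \<xi> * K + T * k * h / 2) / w)"
          if "w > 0" for w a k
          using T that by (simp add: field_simps)
        from this[OF \<sigma>2, of "\<xi>\<^sup>2" "K\<^sup>2"] show ?thesis by (simp only: power2_eq_square[of h])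
      qed
      finally show ?thesis .
    qed
    also have "\<dots> \<le> ?L + h * Q"
    proof -
      have "2 * \<xi> * K \<le> 2 * R * K" using asm K(1) by (intro mult_right_mono) auto
      moreover have "T * K\<^sup>2 * h \<le> T * K\<^sup>2 * 1" using asm T by (intro mult_left_mono) (auto simp: h0_def)
      ultimately have "(2 * \<xi> * K + T * K\<^sup>2 * h / 2) / \<sigma>\<^sup>2 \<le> (2 * R * K + T * K\<^sup>2 / 2) / \<sigma>\<^sup>2"
        by (intro divide_right_mono) auto
      then have "(2 * \<xi> * K + T * K\<^sup>2 * h / 2) / \<sigma>\<^sup>2 \<le> Q" by (simp add: Q_def)
      then show ?thesis using asm by (intro add_left_mono mult_left_mono) auto
    qed
    also have "\<dots> \<le> ?L + \<eta>" using hK by simp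
    finally have "?X \<le> ennreal (?L + \<eta>)"
      using \<phi> INF_lower[OF \<phi>(1), of "rate h \<theta> \<sigma> T"] by (meson ennreal_leI order_trans)
    then obtain x where x: "x \<ge> 0" "?X = ennreal x" by (cases ?X) (auto simp: top_unique)
    have "x \<le> ?L + \<eta>" using \<open>?X \<le> ennreal (?L + \<eta>)\<close> L \<eta> unfolding x(2) by (subst (asm) ennreal_le_iff) auto
    moreover have "?L - \<eta> \<le> x"
    proof (cases "?L - \<eta> \<ge> 0")
      case True then show ?thesis using lower x(1) unfolding x(2) by (simp add: ennreal_le_iff)
    qed (use x(1) in linarith)
    ultimately have "\<bar>x - ?L\<bar> \<le> \<eta>" by linarith
    then show "\<bar>enn2ereal ?X - ereal ?L\<bar> \<le> ereal \<eta>" unfolding x(2) using x(1) by simp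
  qed
qed

theorem theorem6p2:
  fixes T \<theta> \<sigma> :: real and \<xi>b :: "real \<Rightarrow> real"
  assumes "T > 0" and "\<theta> > 0" and "\<sigma> > 0" and "3 * \<sigma>\<^sup>2 < 2 * \<theta>"
    and \<xi>b: "\<forall>\<^sub>F h in at_right 0. \<xi>b h > 0 \<and>
               {\<xi>. \<xi> \<noteq> 0 \<and> compatible h \<theta> \<sigma> \<xi>} = {\<xi>b h, - \<xi>b h}"
  shows "(\<exists>\<gamma> :: real \<Rightarrow> real. (\<gamma> \<longlongrightarrow> 0) (at_right 0) \<and>
            (\<forall>\<^sub>F h in at_right 0. \<forall>\<kappa>\<in>{0..h / 2}.
               \<bar>enn2ereal (INF \<phi>\<in>transition_paths \<kappa> h \<theta> \<sigma> T (\<xi>b h). rate h \<theta> \<sigma> T \<phi>)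
                  - ereal (2 * (\<xi>b h)\<^sup>2 / (\<sigma>\<^sup>2 * T))\<bar> \<le> ereal (\<gamma> h))) \<and>
         (let s = \<sigma>\<^sup>2 / (2 * \<theta>);
              \<xi>0 = sqrt (1 - 3 * s);
              \<xi>1 = sqrt (1 - 3 * s) * (6 / \<sigma>\<^sup>2) * s\<^sup>2 * ((1 - 2 * s) / (1 - 3 * s))
          in (\<lambda>h. \<xi>b h - (\<xi>0 + h * \<xi>1)) \<in> O[at_right 0](\<lambda>h. h\<^sup>2))"
proof -
  define s where "s = \<sigma>\<^sup>2 / (2 * \<theta>)"
  define x0 where "x0 = sqrt (1 - 3 * s)"
  define x1 where "x1 = sqrt (1 - 3 * s) * (6 / \<sigma>\<^sup>2) * s\<^sup>2 * ((1 - 2 * s) / (1 - 3 * s))"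
  have "1 - 3 * s > 0" using assms(2,4) by (simp add: s_def field_simps)
  then have x0: "x0 > 0" by (simp add: x0_def)
  obtain d h0 where dh: "h0 > 0" "\<And>h. 0 < h \<Longrightarrow> h < h0 \<Longrightarrow> \<exists>\<xi>>0. compatible h \<theta> \<sigma> \<xi> \<and> \<bar>\<xi> - (x0 + h * x1)\<bar> \<le> d * h\<^sup>2"
    using compatible_solution_near[OF assms(2-4)] unfolding x0_def x1_def s_def by blast
  have pos: "\<forall>\<^sub>F h in at_right 0. (h::real) > 0" by (simp add: eventually_at_filter)
  have "\<forall>\<^sub>F h in at_right 0. h < h0" by (rule order_tendstoD(2)[OF tendsto_ident_at dh(1)])
  \<comment> \<open>The solution constructed near x0 + h x1 is positive, so the assumed description
    of the non-zero solutions identifies it with \<xi>b h.\<close>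
  with \<xi>b pos have near: "\<forall>\<^sub>F h in at_right 0. \<bar>\<xi>b h - (x0 + h * x1)\<bar> \<le> d * h\<^sup>2"
  proof eventually_elim
    case (elim h)
    obtain \<xi> where \<xi>: "\<xi> > 0" "compatible h \<theta> \<sigma> \<xi>" "\<bar>\<xi> - (x0 + h * x1)\<bar> \<le> d * h\<^sup>2" using dh(2)[of h] elim by blast
    then have "\<xi> \<in> {\<xi>b h, - \<xi>b h}" using elim by (metis (mono_tags, lifting) mem_Collect_eq less_irrefl)
    then have "\<xi> = \<xi>b h" using \<xi>(1) elim by auto
    then show ?case using \<xi>(3) by simp
  qed
  have O: "(\<lambda>h. \<xi>b h - (x0 + h * x1)) \<in> O[at_right 0](\<lambda>h. h\<^sup>2)"
    by (rule bigoI[of _ d]) (use near in \<open>simp\<close>)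
  have lim: "(\<xi>b \<longlongrightarrow> x0) (at_right 0)"
  proof -
    have "((\<lambda>h::real. h) \<longlongrightarrow> 0) (at_right 0)" by (rule tendsto_ident_at)
    then have "((\<lambda>h. d * h\<^sup>2) \<longlongrightarrow> d * 0\<^sup>2) (at_right 0)" "((\<lambda>h. x0 + h * x1) \<longlongrightarrow> x0 + 0 * x1) (at_right 0)"
      by (intro tendsto_intros; assumption)+
    then have l: "((\<lambda>h. d * h\<^sup>2) \<longlongrightarrow> 0) (at_right 0)" "((\<lambda>h. x0 + h * x1) \<longlongrightarrow> x0) (at_right 0)" by simp_all
    have "((\<lambda>h. \<xi>b h - (x0 + h * x1)) \<longlongrightarrow> 0) (at_right 0)"
      by (rule Lim_null_comparison[OF _ l(1)]) (use near in simp)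
    from tendsto_add[OF this l(2)] show ?thesis by simp
  qed
  \<comment> \<open>Eventually \<xi>b lies between x0 / 2 and x0 + 1, the window on which the bounds
    are uniform.\<close>
  have low: "\<forall>\<^sub>F h in at_right 0. x0 / 2 < \<xi>b h" using lim by (rule order_tendstoD) (use x0 in simp)
  have upp: "\<forall>\<^sub>F h in at_right 0. \<xi>b h < x0 + 1" using lim by (rule order_tendstoD) simp
  have R: "x0 + 1 > 0" using x0 by simp
  \<comment> \<open>\<kappa> is quantified inside the predicate, so that one \<gamma> serves all of
    them.\<close>
  let ?P = "\<lambda>h \<eta>. \<forall>\<kappa>\<in>{0..h / 2}. \<bar>enn2ereal (INF \<phi>\<in>transition_paths \<kappa> h \<theta> \<sigma> T (\<xi>b h). rate h \<theta> \<sigma> T \<phi>)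
                  - ereal (2 * (\<xi>b h)\<^sup>2 / (\<sigma>\<^sup>2 * T))\<bar> \<le> ereal \<eta>"
  have "\<exists>\<gamma>. (\<gamma> \<longlongrightarrow> 0) (at_right 0) \<and> (\<forall>\<^sub>F h in at_right 0. ?P h (\<gamma> h))"
  proof (rule vanishing_majorant_exists)
    fix \<eta> :: real assume "\<eta> > 0"
    obtain h1 where h1: "h1 > 0" "\<And>h \<kappa> \<xi>. 0 < h \<Longrightarrow> h < h1 \<Longrightarrow> 0 \<le> \<kappa> \<Longrightarrow> x0 / 2 \<le> \<xi> \<Longrightarrow> \<xi> \<le> x0 + 1 \<Longrightarrow>
        compatible h \<theta> \<sigma> \<xi> \<Longrightarrow> compatible h \<theta> \<sigma> (- \<xi>) \<Longrightarrow>
        \<bar>enn2ereal (INF \<phi>\<in>transition_paths \<kappa> h \<theta> \<sigma> T \<xi>. rate h \<theta> \<sigma> T \<phi>) - ereal (2 * \<xi>\<^sup>2 / (\<sigma>\<^sup>2 * T))\<bar> \<le> ereal \<eta>"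
      using transition_rate_INF_close[OF assms(1-3) R x0 \<open>\<eta> > 0\<close>] by auto
    have "\<forall>\<^sub>F h in at_right 0. h < h1" by (rule order_tendstoD(2)[OF tendsto_ident_at h1(1)])
    then show "\<forall>\<^sub>F h in at_right 0. ?P h \<eta>"
      using \<xi>b pos low upp
    proof eventually_elim
      case (elim h)
      then have S: "{\<xi>. \<xi> \<noteq> 0 \<and> compatible h \<theta> \<sigma> \<xi>} = {\<xi>b h, - \<xi>b h}" by simp
      have "\<xi>b h \<in> {\<xi>. \<xi> \<noteq> 0 \<and> compatible h \<theta> \<sigma> \<xi>}" "- \<xi>b h \<in> {\<xi>. \<xi> \<noteq> 0 \<and> compatible h \<theta> \<sigma> \<xi>}"
        unfolding S by simp_all
      then have c: "compatible h \<theta> \<sigma> (\<xi>b h)" "compatible h \<theta> \<sigma> (- \<xi>b h)" by simp_all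
      show ?case
        using elim by (intro ballI h1(2) c) auto
    qed
  next
    fix h \<eta> \<eta>' :: real assume "?P h \<eta>" "\<eta> \<le> \<eta>'"
    then show "?P h \<eta>'" by (meson ereal_less_eq(3) order_trans)
  qed
  then show ?thesis using O unfolding Let_def s_def[symmetric] x0_def x1_def by blast
qed

end
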